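(* Let $n\ge 2$. Suppose $f$ is a positive continuous function on $S^{n-1}$ and $\nu$ is an isotropic $f$-centered Borel measure on $S^{n-1}$. Then \[V(W_{\nu,f}) \leq \frac{ (n+1-\mathrm{disp}\,W_{\nu,f})^{n+1}}{n!\,(n+1)^{(n+1)/2}}\,\| f\|^{n}_{L^2(\nu)}\] with equality if and only if $\mathrm{conv}\,\mathrm{supp}\,\nu$ is a regular simplex inscribed in $S^{n-1}$ and $f$ is constant on $\mathrm{supp}\,\nu$.
   Context: The setting is Euclidean space $\mathbb{R}^n$, $n\ge 2$, with unit sphere $S^{n-1}$; $V$ denotes volume ($n$-dimensional Lebesgue measure). All Borel measures are non-negative and finite. $\mathrm{supp}\,\nu$ is the support of $\nu$ and $\mathrm{conv}$ denotes convex hull. $\|f\|_{L^2(\nu)}=\left(\int_{S^{n-1}} f^2\,d\nu\right)^{1/2}$. A Borel measure $\nu$ on $S^{n-1}$ is called isotropic if $\int_{S^{n-1}} u\otimes u\,d\nu(u)=I_n$, where $u\otimes u$ is the orthogonal projection onto the line spanned by $u$ and $I_n$ is the identity map on $\mathbb{R}^n$. For a positive continuous function $f$ on $S^{n-1}$, $\nu$ is called $f$-centered if $\int_{S^{n-1}} f(u)\,u\,d\nu(u)=o$, where $o$ is the origin. The Wulff shape determined by $\nu$ and $f$ is \[W_{\nu,f}=\{x\in\mathbb{R}^n: x\cdot u\le f(u)\text{ for all }u\in\mathrm{supp}\,\nu\}.\] When $\nu$ is isotropic and $f$-centered, $W_{\nu,f}$ is a compact convex set containing the origin in its interior. Its displacement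 is the real number \[\mathrm{disp}\,W_{\nu,f}=\mathrm{cd}\,W_{\nu,f}\cdot\int_{S^{n-1}}\frac{u}{f(u)}\,d\nu(u),\] where $\mathrm{cd}\,W_{\nu,f}$ denotes the centroid of $W_{\nu,f}$ and $\cdot$ is the standard inner product. *)

theory Defs
  imports "HOL-Analysis.Analysis"
begin

definition borel_measure_on_sphere :: "(real^'n) measure \<Rightarrow> bool" where
  "borel_measure_on_sphere \<nu> \<longleftrightarrow>
     finite_measure \<nu> \<and> sets \<nu> = sets (restrict_space borel (sphere 0 1))"

text \<open>Linear maps are represented by matrices; see the lemma below for \<open>u \<otimes> u\<close>.\<close>

definition tensor_square :: "real^'n \<Rightarrow> real^'n^'n" where
  "tensor_square u = (\<chi> i j. u $ i * u $ j)"

lemma tensor_square_mult: "tensor_square u *v x = (u \<bullet> x) *\<^sub>R u"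
  by (simp add: vec_eq_iff tensor_square_def matrix_vector_mult_def inner_vec_def
      sum_distrib_left mult_ac)

definition isotropic :: "(real^'n) measure \<Rightarrow> bool" where
  "isotropic \<nu> \<longleftrightarrow> (LINT u|\<nu>. tensor_square u) = mat 1"

definition centered :: "(real^'n \<Rightarrow> real) \<Rightarrow> (real^'n) measure \<Rightarrow> bool" where
  "centered f \<nu> \<longleftrightarrow> (LINT u|\<nu>. f u *\<^sub>R u) = 0"

definition supp :: "(real^'n) measure \<Rightarrow> (real^'n) set" where
  "supp \<nu> = {u \<in> space \<nu>. \<forall>U. open U \<longrightarrow> u \<in> U \<longrightarrow> 0 < measure \<nu> (U \<inter> space \<nu>)}"

definition L2_norm_on :: "(real^'n) measure \<Rightarrow> (real^'n \<Rightarrow> real) \<Rightarrow> real" where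
  "L2_norm_on \<nu> f = sqrt (LINT u|\<nu>. (f u)\<^sup>2)"

definition wulff_shape :: "(real^'n) measure \<Rightarrow> (real^'n \<Rightarrow> real) \<Rightarrow> (real^'n) set" where
  "wulff_shape \<nu> f = {x. \<forall>u \<in> supp \<nu>. x \<bullet> u \<le> f u}"

definition centroid :: "(real^'n) set \<Rightarrow> real^'n" where
  "centroid K = (1 / measure lborel K) *\<^sub>R (LINT x:K|lborel. x)"

definition disp :: "(real^'n) measure \<Rightarrow> (real^'n \<Rightarrow> real) \<Rightarrow> real" where
  "disp \<nu> f = centroid (wulff_shape \<nu> f) \<bullet> (LINT u|\<nu>. (1 / f u) *\<^sub>R u)"

text \<open>The vertices of a simplex are its extreme points; a simplex is regular when all its
  edges have the same length.\<close>

definition regular_simplex :: "int \<Rightarrow> (real^'n) set \<Rightarrow> bool" where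
  "regular_simplex k S \<longleftrightarrow> k simplex S \<and>
     (\<exists>d. \<forall>v w. v extreme_point_of S \<longrightarrow> w extreme_point_of S \<longrightarrow> v \<noteq> w \<longrightarrow> dist v w = d)"

definition inscribed_in_sphere :: "(real^'n) set \<Rightarrow> bool" where
  "inscribed_in_sphere S \<longleftrightarrow> {v. v extreme_point_of S} \<subseteq> sphere 0 1"

end

theory Submission
  imports Defs "HOL-Probability.Probability"
begin

text \<open>The proof adds one dimension and transports mass. Let \<open>K\<close> be the support of \<open>\<nu>\<close>, let \<open>L\<close> be the
\<open>L\<^sup>2\<close> norm of \<open>f\<close> and put \<open>w u = (- u, f u / L)\<close> in dimension \<open>n + 1\<close>. Because \<open>\<nu>\<close> is isotropic and
\<open>f\<close>-centered, the vectors \<open>w u\<close> are again isotropic: the mixed terms are integrals of \<open>f u *\<^sub>R u\<close>. Up to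
the scaling of its last coordinate, the cone on which all \<open>w u\<close> are positive is the cone over the
interior of the Wulff shape \<open>W\<close>.

On that cone there is a Brascamp-Lieb inequality (\<open>brascamp_lieb_cone\<close>). Take the one-dimensional
map \<open>\<phi>\<close> that carries the exponential to the standard normal distribution, and superpose it along the
directions \<open>w u\<close> to a map \<open>T\<close>. The derivative of \<open>T\<close> is a weighted frame \<open>\<integral> \<tau> u * (w u \<otimes> w u)\<close>, and its
determinant is at least \<open>exp (\<integral> |w u|\<^sup>2 * ln (\<tau> u))\<close> (\<open>det_weighted_frame\<close>): apply Jensen's inequality to
each diagonal entry in an eigenbasis. Moreover \<open>|T z|\<^sup>2\<close> is at most the integral of the squares of the
one-dimensional transports, weighted by \<open>|w u|\<^sup>2\<close>. Together these bound an exponential density on the cone by the pullback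
of the Gaussian density under the injective map \<open>T\<close>, so that the change of variables formula gives
\<open>\<integral>\<^sub>C exp (- q \<bullet> z) \<le> exp (- entropy)\<close>.

The weights \<open>1 / f u\<close> make the exponent \<open>q\<close> equal to \<open>(- p, (n + 1) / L)\<close> with \<open>p = \<integral> u / f u\<close>. Integrating
over the rays of the cone turns its integral into \<open>L * n! * \<integral>\<^sub>W (n + 1 - p \<bullet> y) powr - (n + 1)\<close>; the
integrand is convex in \<open>p \<bullet> y\<close>, so its tangent at the centroid bounds the integral below by
\<open>L * n! * V(W) / (n + 1 - disp) ^ (n + 1)\<close> (\<open>volume_le_cone_integral\<close>). A last application of Jensen's
inequality bounds \<open>exp (- entropy)\<close> by \<open>(L / sqrt (n + 1)) ^ (n + 1)\<close> (\<open>entropy_bound\<close>).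

If equality holds, the last step forces \<open>f\<close> to be constant on \<open>K\<close>. Equality in the determinant bound at
almost every point of the cone forces \<open>w u\<close> and \<open>w v\<close> to be orthogonal for distinct \<open>u\<close> and \<open>v\<close> in \<open>K\<close>, that
is \<open>u \<bullet> v = - 1 / n\<close>; since the \<open>w u\<close> span, \<open>K\<close> consists of the \<open>n + 1\<close> vertices of a regular simplex.
Conversely, for such a simplex the cone is a rotated orthant, and \<open>p = 0\<close>, so that every step can be
computed exactly.\<close>

section \<open>Orthonormal eigenbases of symmetric matrices\<close>

text \<open>A maximiser of the quadratic form \<open>x \<bullet> f x\<close> on the unit sphere of \<open>S\<close> is an eigenvector: in every
direction \<open>y\<close> orthogonal to it the first variation \<open>y \<bullet> f x\<close> vanishes.\<close>

lemma selfadjoint_eigenvector: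
  fixes f :: "'a::euclidean_space \<Rightarrow> 'a"
  assumes lin: "linear f" and sym: "\<And>x y. f x \<bullet> y = x \<bullet> f y"
    and S: "subspace S" and inv: "f ` S \<subseteq> S" and ne: "S \<noteq> {0}"
  obtains x where "x \<in> S" "norm x = 1" "f x = (x \<bullet> f x) *\<^sub>R x"
proof -
  interpret linear f by (rule lin)
  have "compact (sphere 0 1 \<inter> S)"
    by (intro compact_Int_closed compact_sphere closed_subspace S)
  moreover have "sphere 0 1 \<inter> S \<noteq> {}"
  proof -
    obtain y where y: "y \<in> S" "y \<noteq> 0" using ne S subspace_0 by blast
    then have "(1 / norm y) *\<^sub>R y \<in> sphere 0 1 \<inter> S" using S subspace_mul by auto
    then show ?thesis by blast
  qed
  moreover have "continuous_on (sphere 0 1 \<inter> S) (\<lambda>x. x \<bullet> f x)"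
    by (intro continuous_intros linear_continuous_on linear_conv_bounded_linear[THEN iffD1] lin)
  ultimately obtain x where x: "x \<in> sphere 0 1 \<inter> S"
    and max: "\<And>y. y \<in> sphere 0 1 \<inter> S \<Longrightarrow> y \<bullet> f y \<le> x \<bullet> f x"
    using continuous_attains_sup[of "sphere 0 1 \<inter> S" "\<lambda>x. x \<bullet> f x"] by blast
  define l where "l = x \<bullet> f x"
  have nx: "norm x = 1" and xx: "x \<bullet> x = 1" and xS: "x \<in> S" using x by (auto simp: norm_eq_1)
  have bd: "y \<bullet> f y \<le> l * (y \<bullet> y)" if "y \<in> S" for y
  proof (cases "y = 0")
    case False
    let ?y = "(1 / norm y) *\<^sub>R y"
    have "?y \<in> sphere 0 1 \<inter> S" using that False S subspace_mul by auto
    from max[OF this] have "(y \<bullet> f y) / (norm y)\<^sup>2 \<le> l"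
      by (simp add: scaleR l_def power2_eq_square)
    then show ?thesis using False by (simp add: divide_le_eq power2_norm_eq_inner)
  qed (simp add: zero)
  have orth: "y \<bullet> f x = 0" if y: "y \<in> S" "y \<bullet> x = 0" for y
  proof (rule ccontr)
    assume ne0: "y \<bullet> f x \<noteq> 0"
    define b where "b = y \<bullet> f x"
    define c where "c = y \<bullet> f y - l * (y \<bullet> y)"
    have q: "2 * t * b + t\<^sup>2 * c \<le> 0" for t
    proof -
      have "x + t *\<^sub>R y \<in> S" using xS y S by (simp add: subspace_add subspace_mul)
      from bd[OF this] have "l + t * (x \<bullet> f y) + t * (y \<bullet> f x) + t\<^sup>2 * (y \<bullet> f y)
          \<le> l * (1 + t\<^sup>2 * (y \<bullet> y))"
        using y(2) xx by (simp add: add scaleR inner_add_left inner_add_right algebra_simps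
            inner_commute[of x y] power2_eq_square l_def)
      moreover have "x \<bullet> f y = b" using sym[of x y] by (simp add: b_def inner_commute)
      ultimately show ?thesis by (simp add: b_def c_def algebra_simps)
    qed
    have b0: "b \<noteq> 0" using ne0 b_def by simp
    \<comment> \<open>a step so small that the linear term \<open>2 * t * b\<close> outweighs the quadratic one\<close>
    define t where "t = b / (\<bar>c\<bar> + 1)"
    have pos: "\<bar>c\<bar> + 1 > 0" by simp
    have tb: "t * (\<bar>c\<bar> + 1) = b" using pos by (simp add: t_def)
    have "2 * t * b + t\<^sup>2 * c = t\<^sup>2 * (2 * \<bar>c\<bar> + 2 + c)"
      by (simp add: tb[symmetric] power2_eq_square algebra_simps)
    moreover have "t\<^sup>2 > 0" using b0 pos by (simp add: t_def)
    moreover have "2 * \<bar>c\<bar> + 2 + c > 0" by (simp add: abs_if)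
    ultimately show False using q[of t] by (smt (verit) mult_pos_pos)
  qed
  define y where "y = f x - l *\<^sub>R x"
  have yS: "y \<in> S" using inv xS S by (auto simp: y_def intro!: subspace_diff subspace_mul)
  have yx: "y \<bullet> x = 0" using xx by (simp add: y_def l_def inner_diff_left inner_commute[of "f x"])
  have "y \<bullet> y = y \<bullet> f x - l * (y \<bullet> x)" by (simp add: y_def inner_diff_right)
  then have "y = 0" using orth[OF yS yx] yx by simp
  then show ?thesis using that[OF xS nx] by (simp add: y_def l_def)
qed

text \<open>Splitting off an eigenvector leaves its orthogonal complement in \<open>S\<close> invariant, so the claim follows
by induction on the dimension. It is stated for subspaces for the sake of this induction.\<close>

lemma selfadjoint_orthonormal_eigenvectors:
  fixes f :: "'a::euclidean_space \<Rightarrow> 'a"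
  assumes lin: "linear f" and sym: "\<And>x y. f x \<bullet> y = x \<bullet> f y"
    and "subspace S" and "f ` S \<subseteq> S"
  shows "\<exists>B\<subseteq>S. finite B \<and> card B = dim S \<and> pairwise orthogonal B
           \<and> (\<forall>x\<in>B. norm x = 1 \<and> f x = (x \<bullet> f x) *\<^sub>R x)"
  using assms(3,4)
proof (induction "dim S" arbitrary: S)
  case 0
  show ?case by (rule exI[of _ "{}"]) (use 0 in auto)
next
  case (Suc k)
  have "S \<noteq> {0}" using Suc(2) by auto
  then obtain x where x: "x \<in> S" "norm x = 1" "f x = (x \<bullet> f x) *\<^sub>R x"
    using selfadjoint_eigenvector[OF lin sym Suc(3,4)] by blast
  define S' where "S' = {y \<in> S. orthogonal x y}"
  have sub': "subspace S'" unfolding S'_def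
    using Suc(3) by (auto simp: subspace_def orthogonal_def inner_add_right)
  have inv': "f ` S' \<subseteq> S'"
  proof
    fix z assume "z \<in> f ` S'"
    then obtain y where y: "y \<in> S" "x \<bullet> y = 0" "z = f y" by (auto simp: S'_def orthogonal_def)
    have "x \<bullet> f y = f x \<bullet> y" by (simp add: sym)
    also have "\<dots> = 0" by (subst x(3)) (simp add: y)
    finally show "z \<in> S'" using y Suc(4) by (auto simp: S'_def orthogonal_def)
  qed
  have dimS': "dim S' = k"
  proof -
    have "dim {y \<in> S. \<forall>x' \<in> span {x}. orthogonal x' y} + dim (span {x}) = dim S"
      by (rule dim_subspace_orthogonal_to_vectors) (use x Suc(3) span_minimal[of "{x}" S] in auto)
    moreover have "{y \<in> S. \<forall>x' \<in> span {x}. orthogonal x' y} = S'"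
      by (auto simp: S'_def span_singleton orthogonal_def intro: exI[of _ "1::real"])
    moreover have "dim (span {x}) = 1" using x(2) by (auto simp: dim_insert)
    ultimately show ?thesis using Suc(2) by simp
  qed
  from Suc(1)[of S'] dimS' sub' inv' obtain B where B: "B \<subseteq> S'" "finite B" "card B = k"
    "pairwise orthogonal B" "\<forall>x\<in>B. norm x = 1 \<and> f x = (x \<bullet> f x) *\<^sub>R x" by auto
  have "x \<notin> B" using B(1) x(2) by (auto simp: S'_def orthogonal_def)
  show ?case
  proof (intro exI[of _ "insert x B"] conjI)
    show "insert x B \<subseteq> S" using B(1) x(1) by (auto simp: S'_def)
    show "card (insert x B) = dim S" using B \<open>x \<notin> B\<close> Suc(2) by simp
    show "pairwise orthogonal (insert x B)"
      using B(1,4) by (auto simp: pairwise_insert S'_def orthogonal_commute)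
  qed (use B x in auto)
qed

lemma symmetric_matrix_eigenbasis:
  fixes A :: "real^'m^'m"
  assumes "transpose A = A"
  obtains e :: "'m \<Rightarrow> real^'m"
  where "\<And>i j. e i \<bullet> e j = (if i = j then 1 else 0)"
    and "\<And>i. A *v e i = (e i \<bullet> (A *v e i)) *\<^sub>R e i"
    and "det A = (\<Prod>i\<in>UNIV. e i \<bullet> (A *v e i))"
proof -
  have sym: "(A *v x) \<bullet> y = x \<bullet> (A *v y)" for x y
    by (metis assms dot_lmul_matrix transpose_matrix_vector)
  have "\<exists>B. B \<subseteq> UNIV \<and> finite B \<and> card B = dim (UNIV::(real^'m) set) \<and> pairwise orthogonal B
           \<and> (\<forall>x\<in>B. norm x = 1 \<and> A *v x = (x \<bullet> (A *v x)) *\<^sub>R x)"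
    by (rule selfadjoint_orthonormal_eigenvectors) (auto simp: sym matrix_vector_mul_linear)
  then obtain B where B: "finite B" "card B = CARD('m)" "pairwise orthogonal B"
    "\<forall>x\<in>B. norm x = 1 \<and> A *v x = (x \<bullet> (A *v x)) *\<^sub>R x"
    by (auto simp: dim_UNIV)
  then obtain e where e: "bij_betw e (UNIV::'m set) B"
    using finite_same_card_bij[of "UNIV::'m set" B] by auto
  have on: "e i \<bullet> e j = (if i = j then 1 else 0)" for i j
  proof -
    have "e i \<in> B" "e j \<in> B" using e by (auto simp: bij_betw_def)
    moreover have "e i = e j \<longleftrightarrow> i = j" using e by (auto simp: bij_betw_def inj_eq)
    ultimately show ?thesis
      using B(3,4) by (auto simp: pairwise_def orthogonal_def norm_eq_1)
  qed
  have ev: "A *v e i = (e i \<bullet> (A *v e i)) *\<^sub>R e i" for i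
    using e B(4) by (auto simp: bij_betw_def)
  define P :: "real^'m^'m" where "P = (\<chi> i j. e j $ i)"
  define D :: "real^'m^'m" where "D = (\<chi> i j. if i = j then e i \<bullet> (A *v e i) else 0)"
  have "transpose P ** P = mat 1"
    using on by (simp add: vec_eq_iff matrix_matrix_mult_def transpose_def P_def mat_def inner_vec_def)
  then have "det P \<noteq> 0"
    by (metis det_I det_mul mult_zero_right zero_neq_one)
  moreover have "A ** P = P ** D"
  proof -
    have "(A ** P) $ i $ j = (P ** D) $ i $ j" for i j
    proof -
      have "(A ** P) $ i $ j = (A *v e j) $ i"
        by (simp add: matrix_matrix_mult_def matrix_vector_mult_def P_def)
      also have "\<dots> = (e j \<bullet> (A *v e j)) * e j $ i"
        by (subst ev) simp
      also have "\<dots> = (P ** D) $ i $ j"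
        by (simp add: matrix_matrix_mult_def P_def D_def if_distrib cong: if_cong)
      finally show ?thesis .
    qed
    then show ?thesis by (simp add: vec_eq_iff)
  qed
  then have "det A * det P = det P * det D" by (metis det_mul)
  ultimately have "det A = det D" by simp
  also have "det D = (\<Prod>i\<in>UNIV. e i \<bullet> (A *v e i))"
    by (subst det_diagonal) (auto simp: D_def)
  finally show ?thesis using that on ev by blast
qed

section \<open>Transport of the exponential to the normal distribution\<close>

text \<open>The map \<open>\<phi>\<close> that carries the exponential to the standard normal distribution satisfies
\<open>normal_tail (\<phi> t) = exp (- t)\<close>: both sides are the mass beyond corresponding points.\<close>

definition normal_tail :: "real \<Rightarrow> real" where
  "normal_tail s = 1 - cdf (density lborel std_normal_density) s"

lemma real_distribution_std_normal: "real_distribution (density lborel std_normal_density)"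
proof -
  interpret prob_space "density lborel std_normal_density"
    by (rule prob_space_normal_density) simp
  show ?thesis by unfold_locales auto
qed

lemma normal_tail_eq_integral:
  "normal_tail s = (LINT x:{0<..}|lborel. std_normal_density (s + x))"
proof -
  let ?M = "density lborel std_normal_density"
  interpret real_distribution ?M by (rule real_distribution_std_normal)
  have "normal_tail s = prob {s<..}"
    using prob_compl[of "{..s}"] unfolding normal_tail_def cdf_def
    by (simp add: Compl_eq_Diff_UNIV[symmetric] Compl_atMost)
  also have "\<dots> = (LINT x|?M. indicator {s<..} x)" by simp
  also have "\<dots> = (LINT x|lborel. std_normal_density x * indicator {s<..} x)"
    by (subst integral_density) auto
  also have "\<dots> = (LINT x|lborel. std_normal_density (s + x) * indicator {s<..} (s + x))"
    by (subst lborel_integral_real_affine[where c=1 and t=s]) auto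
  also have "\<dots> = (LINT x:{0<..}|lborel. std_normal_density (s + x))"
    unfolding set_lebesgue_integral_def
    by (intro Bochner_Integration.integral_cong) (auto simp: indicator_def)
  finally show ?thesis .
qed

lemma integrable_std_normal_shift: "integrable lborel (\<lambda>x. std_normal_density (s + x))"
  using lborel_integrable_real_affine[of std_normal_density 1 s] by simp

lemma normal_tail_deriv:
  "(normal_tail has_real_derivative - std_normal_density s) (at s)"
proof -
  let ?M = "density lborel std_normal_density"
  interpret real_distribution ?M by (rule real_distribution_std_normal)
  have cont: "continuous_on A std_normal_density" for A
    unfolding normal_density_def by (intro continuous_intros) auto
  have eq: "cdf ?M y = cdf ?M (s - 1) + integral {s-1..y} std_normal_density" if "y \<in> {s-1..s+1}" for y
  proof (cases "y = s - 1")
    case False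
    then have "cdf ?M y - cdf ?M (s-1) = prob {s-1<..y}" using that by (intro cdf_diff_eq) auto
    also have "\<dots> = (LINT x|?M. indicator {s-1<..y} x)" by simp
    also have "\<dots> = (LINT x:{s-1<..y}|lborel. std_normal_density x)"
      by (subst integral_density) (auto simp: set_lebesgue_integral_def mult.commute)
    also have "\<dots> = integral {s-1<..y} std_normal_density"
      by (rule set_borel_integral_eq_integral)
        (unfold set_integrable_def, rule integrable_mult_indicator, auto)
    also have "\<dots> = integral {s-1..y} std_normal_density"
      by (rule integral_spike_set; rule negligible_subset[of "{s-1}"]) auto
    finally show ?thesis by simp
  qed simp
  have "((\<lambda>y. integral {s-1..y} std_normal_density) has_real_derivative std_normal_density s)
      (at s within {s-1..s+1})"
    by (rule integral_has_real_derivative[OF cont]) simp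
  then have "((\<lambda>y. integral {s-1..y} std_normal_density) has_real_derivative std_normal_density s) (at s)"
    by (subst (asm) at_within_interior[of s "{s-1..s+1}"]) auto
  then have "((\<lambda>y. 1 - (cdf ?M (s - 1) + integral {s-1..y} std_normal_density))
      has_real_derivative - std_normal_density s) (at s)"
    by (auto intro!: derivative_eq_intros)
  then show ?thesis
  proof (rule has_field_derivative_transform_within[where d=1])
    show "1 - (cdf ?M (s - 1) + integral {s-1..y} std_normal_density) = normal_tail y"
      if "dist y s < 1" for y
    proof -
      have "y \<in> {s-1..s+1}" using that by (auto simp: dist_real_def)
      from eq[OF this] show ?thesis by (simp add: normal_tail_def)
    qed
  qed auto
qed

lemma std_normal_density_mult_less:
  assumes "s < t" "0 < x"
  shows "std_normal_density (t + x) * std_normal_density s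
       < std_normal_density (s + x) * std_normal_density t"
proof -
  have "s * x < t * x" using assms by simp
  then have "- (t + x)\<^sup>2 / 2 - s\<^sup>2 / 2 < - (s + x)\<^sup>2 / 2 - t\<^sup>2 / 2"
    by (simp add: power2_eq_square field_simps)
  moreover have "std_normal_density a * std_normal_density b = exp (- a\<^sup>2 / 2 - b\<^sup>2 / 2) / (2 * pi)" for a b
  proof -
    have "exp (- a\<^sup>2 / 2) * exp (- b\<^sup>2 / 2) = exp (- a\<^sup>2 / 2 - b\<^sup>2 / 2)"
      by (simp add: exp_add[symmetric])
    moreover have "sqrt (2 * pi) * sqrt (2 * pi) = 2 * pi" by simp
    ultimately show ?thesis by (simp add: std_normal_density_def)
  qed
  ultimately show ?thesis by (simp add: divide_strict_right_mono)
qed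

lemma integral_strict_mono:
  fixes f g :: "'a \<Rightarrow> real"
  assumes "integrable M f" "integrable M g" "\<And>x. x \<in> space M \<Longrightarrow> f x < g x"
    and "emeasure M (space M) \<noteq> 0"
  shows "integral\<^sup>L M f < integral\<^sup>L M g"
proof (rule ccontr)
  assume "\<not> ?thesis"
  then have "(LINT x|M. g x - f x) \<le> 0" using assms(1,2) by simp
  moreover have nn: "AE x in M. 0 \<le> g x - f x" using assms(3) by (intro AE_I2) (auto intro: less_imp_le)
  ultimately have "(LINT x|M. g x - f x) = 0" using integral_nonneg_AE[OF nn] by linarith
  then have "AE x in M. g x - f x = 0"
    using integral_nonneg_eq_0_iff_AE[OF _ nn] assms(1,2) by auto
  then have "AE x in M. False"
  proof (rule AE_mp, intro AE_I2 impI)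
    fix x assume "x \<in> space M" "g x - f x = 0"
    with assms(3)[of x] show False by simp
  qed
  then show False using assms(4) by (simp add: AE_iff_measurable[OF sets.top])
qed

text \<open>The ratio of tail and density at \<open>s\<close> equals \<open>\<integral> exp (- x\<^sup>2 / 2 - s * x)\<close> over positive \<open>x\<close>, whose
integrand is strictly decreasing in \<open>s\<close>.\<close>

lemma mills_ratio_strict_antimono:
  assumes "s < t"
  shows "normal_tail t / std_normal_density t < normal_tail s / std_normal_density s"
proof -
  let ?L = "restrict_space lborel {0::real<..}"
  have int: "integrable ?L (\<lambda>x. std_normal_density (a + x) * b)" for a b
    using integrable_mult_indicator[OF _ integrable_std_normal_shift[of a], of "{0<..}"]
    by (simp add: integrable_restrict_space)
  have tail: "normal_tail a * b = (LINT x|?L. std_normal_density (a + x) * b)" for a b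
    using integrable_std_normal_shift[of a]
    by (simp add: normal_tail_eq_integral set_lebesgue_integral_def integral_restrict_space)
  have "normal_tail t * std_normal_density s < normal_tail s * std_normal_density t"
    unfolding tail
  proof (rule integral_strict_mono)
    show "std_normal_density (t + x) * std_normal_density s
        < std_normal_density (s + x) * std_normal_density t" if "x \<in> space ?L" for x
      using std_normal_density_mult_less[OF assms] that by (auto simp: space_restrict_space)
    have "emeasure lborel {0<..<1::real} \<le> emeasure lborel {0::real<..}"
      by (rule emeasure_mono) auto
    then show "emeasure ?L (space ?L) \<noteq> 0"
      by (simp add: space_restrict_space emeasure_restrict_space) (metis not_one_le_zero)
  qed (rule int)+
  then show ?thesis by (simp add: normal_density_pos divide_less_eq less_divide_eq mult.commute)
qed

lemma normal_tail_strict_antimono: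
  assumes "s < t"
  shows "normal_tail t < normal_tail s"
  using assms
proof (rule DERIV_neg_imp_decreasing)
  show "\<exists>y. (normal_tail has_real_derivative y) (at x) \<and> y < 0" for x
    using normal_density_pos[of 1 0 x]
    by (intro exI[of _ "- std_normal_density x"] conjI normal_tail_deriv) simp
qed

lemma normal_tail_surj:
  assumes "0 < y" "y < 1"
  shows "\<exists>s. normal_tail s = y"
proof -
  let ?M = "density lborel std_normal_density"
  interpret real_distribution ?M by (rule real_distribution_std_normal)
  have tail: "normal_tail = (\<lambda>s. 1 - cdf ?M s)" by (simp add: fun_eq_iff normal_tail_def)
  have top: "(normal_tail \<longlongrightarrow> 0) at_top"
    unfolding tail by (rule tendsto_eq_intros refl cdf_lim_at_top_prob)+ simp
  have bot: "(normal_tail \<longlongrightarrow> 1) at_bot"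
    unfolding tail by (rule tendsto_eq_intros refl cdf_lim_at_bot)+ simp
  obtain b where b: "normal_tail b < y"
    using eventually_happens'[OF _ order_tendstoD(2)[OF top assms(1)]] by auto
  obtain a where a: "y < normal_tail a"
    using eventually_happens'[OF _ order_tendstoD(1)[OF bot assms(2)]] by auto
  have "\<not> b \<le> a"
    using a b normal_tail_strict_antimono[of b a] by (cases "a = b") auto
  then have "a \<le> b" by simp
  then show ?thesis
    using IVT2[of normal_tail b y a] a b DERIV_isCont[OF normal_tail_deriv] by auto
qed

lemma normal_tail_bounds: "0 < normal_tail s" "normal_tail s < 1"
proof -
  let ?M = "density lborel std_normal_density"
  interpret real_distribution ?M by (rule real_distribution_std_normal)
  have "0 \<le> normal_tail (s + 1)" "normal_tail (s - 1) \<le> 1"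
    unfolding normal_tail_def using cdf_nonneg cdf_bounded_prob by simp_all
  then show "0 < normal_tail s" "normal_tail s < 1"
    using normal_tail_strict_antimono[of s "s+1"] normal_tail_strict_antimono[of "s-1" s] by auto
qed

text \<open>The third property is the transport equation. By it, \<open>\<phi>' t\<close> is the ratio of tail and density at \<open>\<phi> t\<close>,
hence strictly decreasing. That \<open>\<phi>'\<close> separates points is what makes the equality case rigid.\<close>

lemma exponential_to_normal_transport:
  obtains \<phi> \<phi>' :: "real \<Rightarrow> real"
  where "\<And>t. 0 < t \<Longrightarrow> (\<phi> has_real_derivative \<phi>' t) (at t)"
    and "\<And>t. 0 < t \<Longrightarrow> 0 < \<phi>' t"
    and "\<And>t. 0 < t \<Longrightarrow> exp (- t) = \<phi>' t * std_normal_density (\<phi> t)"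
    and "continuous_on {0<..} \<phi>'"
    and "\<And>s t. 0 < s \<Longrightarrow> s < t \<Longrightarrow> \<phi>' t < \<phi>' s"
proof -
  define G where "G s = - ln (normal_tail s)" for s
  define m where "m s = normal_tail s / std_normal_density s" for s
  have dens: "0 < std_normal_density s" for s by (simp add: normal_density_pos)
  have mpos: "0 < m s" for s by (simp add: m_def dens normal_tail_bounds)
  have Gmono: "G s < G t" if "s < t" for s t
    using normal_tail_strict_antimono[OF that] normal_tail_bounds by (simp add: G_def)
  have Gder: "(G has_real_derivative inverse (m s)) (at s)" for s
    unfolding G_def m_def
    by (rule derivative_eq_intros normal_tail_deriv refl normal_tail_bounds)+ (simp add: divide_inverse)
  define \<phi> where "\<phi> = the_inv G"
  have injG: "inj G" by (rule injI) (metis Gmono less_irrefl neqE)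
  have phiG: "\<phi> (G s) = s" for s by (simp add: \<phi>_def the_inv_f_f injG)
  have Gphi: "G (\<phi> t) = t" if "0 < t" for t
  proof -
    obtain s where "normal_tail s = exp (- t)" using normal_tail_surj[of "exp (-t)"] \<open>0 < t\<close> by auto
    then have "G s = t" by (simp add: G_def)
    then show ?thesis using phiG by metis
  qed
  have der: "(\<phi> has_real_derivative m (\<phi> t)) (at t)" if "0 < t" for t
  proof -
    have "isCont \<phi> (G (\<phi> t))"
      by (rule isCont_inverse_function[where d=1]) (auto simp: phiG intro: DERIV_isCont[OF Gder])
    then have "(\<phi> has_real_derivative inverse (inverse (m (\<phi> t)))) (at t)"
      using that mpos[of "\<phi> t"]
      by (intro DERIV_inverse_function[where f=G and a=0 and b="t+1"] Gder) (auto simp: Gphi)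
    then show ?thesis by simp
  qed
  have phimono: "\<phi> s < \<phi> t" if "0 < s" "s < t" for s t
  proof (rule ccontr)
    assume "\<not> ?thesis"
    then have "G (\<phi> t) \<le> G (\<phi> s)" using Gmono[of "\<phi> t" "\<phi> s"] by (cases "\<phi> t = \<phi> s") auto
    then show False using that by (simp add: Gphi)
  qed
  have "continuous_on UNIV m" unfolding m_def normal_density_def
    by (intro continuous_intros continuous_at_imp_continuous_on ballI)
      (auto intro!: DERIV_isCont[OF normal_tail_deriv])
  then have c: "continuous_on {0<..} (\<lambda>t. m (\<phi> t))"
    by (rule continuous_on_compose2)
      (auto intro!: continuous_at_imp_continuous_on DERIV_isCont[OF der])
  have e: "exp (- t) = m (\<phi> t) * std_normal_density (\<phi> t)" if "0 < t" for t
  proof -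
    have "normal_tail (\<phi> t) = exp (- G (\<phi> t))" by (simp add: G_def normal_tail_bounds)
    then show ?thesis using that dens[of "\<phi> t"] by (simp add: Gphi m_def)
  qed
  have mono: "m (\<phi> t) < m (\<phi> s)" if "0 < s" "s < t" for s t
    unfolding m_def by (rule mills_ratio_strict_antimono[OF phimono[OF that]])
  show ?thesis by (rule that[OF der mpos e c mono])
qed

section \<open>Measures with compact support\<close>

lemma compact_continuous_bounded:
  assumes "compact K" "continuous_on K h"
  obtains B where "B > 0" "\<And>u. u \<in> K \<Longrightarrow> norm (h u) \<le> B"
  using compact_imp_bounded[OF compact_continuous_image[OF assms(2,1)]]
  unfolding bounded_pos by auto

lemma compact_continuous_positive:
  fixes h :: "'a::topological_space \<Rightarrow> real"
  assumes "compact K" "continuous_on K h" "\<And>u. u \<in> K \<Longrightarrow> 0 < h u"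
  obtains m where "m > 0" "\<And>u. u \<in> K \<Longrightarrow> m \<le> h u"
proof (cases "K = {}")
  case False
  then obtain v where "v \<in> K" "\<And>u. u \<in> K \<Longrightarrow> h v \<le> h u"
    using continuous_attains_inf[OF assms(1) _ assms(2)] by blast
  then show ?thesis using assms(3) that by blast
qed (use that[of 1] in auto)

text \<open>Restricted to its support, a measure on the sphere has a compact underlying space that carries no
open null sets. Every continuous function is then integrable, and statements that hold almost
everywhere between continuous functions hold at every point.\<close>

locale compact_full_measure = finite_measure M for M :: "'a::euclidean_space measure" +
  assumes compact_space: "compact (space M)"
    and sets_M: "sets M = sets (restrict_space borel (space M))"
    and full_support: "\<And>U. open U \<Longrightarrow> U \<inter> space M \<noteq> {} \<Longrightarrow> 0 < measure M (U \<inter> space M)"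
begin

lemma integrable_continuous:
  fixes h :: "'a \<Rightarrow> 'b::{banach, second_countable_topology}"
  assumes h: "continuous_on (space M) h"
  shows "integrable M h"
proof -
  obtain B where "\<And>u. u \<in> space M \<Longrightarrow> norm (h u) \<le> B"
    using compact_continuous_bounded[OF compact_space h] by blast
  moreover have "h \<in> borel_measurable M"
    using borel_measurable_continuous_on_restrict[OF h] measurable_cong_sets[OF sets_M refl] by blast
  ultimately show ?thesis by (intro integrable_const_bound[where B=B] AE_I2)
qed

lemma integral_zero_imp_zero:
  fixes h :: "'a \<Rightarrow> real"
  assumes h: "continuous_on (space M) h" and nonneg: "\<And>u. u \<in> space M \<Longrightarrow> 0 \<le> h u"
    and zero: "integral\<^sup>L M h = 0" and u: "u \<in> space M"
  shows "h u = 0"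
proof (rule ccontr)
  assume "h u \<noteq> 0"
  have "openin (top_of_set (space M)) (space M \<inter> h -` {0<..})"
    by (rule continuous_openin_preimage_gen[OF h]) simp
  then obtain U where U: "open U" "space M \<inter> h -` {0<..} = space M \<inter> U"
    by (auto simp: openin_open)
  have "u \<in> U" using U(2) u \<open>h u \<noteq> 0\<close> nonneg[OF u] by auto
  then have pos: "0 < measure M (U \<inter> space M)" using full_support[OF U(1)] u by blast
  have ae: "AE v in M. h v = 0"
    using zero integral_nonneg_eq_0_iff_AE[OF integrable_continuous[OF h]] nonneg by auto
  have nU: "v \<notin> U" if "h v = 0" "v \<in> space M" for v
  proof
    assume "v \<in> U"
    then have "v \<in> space M \<inter> h -` {0<..}" using that U(2) by blast
    then show False using that by simp
  qed
  have "AE v in M. v \<notin> U \<inter> space M"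
    by (rule AE_mp[OF ae]) (use nU in \<open>intro AE_I2 impI, blast\<close>)
  moreover have "U \<inter> space M \<in> sets M" by (subst sets_M) (auto simp: sets_restrict_space U)
  ultimately have "emeasure M (U \<inter> space M) = 0"
    using AE_iff_measurable[of "U \<inter> space M" M "\<lambda>v. v \<notin> U \<inter> space M"] by auto
  then show False using pos by (simp add: measure_def)
qed

lemma integral_eq_imp_eq:
  fixes h k :: "'a \<Rightarrow> real"
  assumes h: "continuous_on (space M) h" and k: "continuous_on (space M) k"
    and le: "\<And>u. u \<in> space M \<Longrightarrow> h u \<le> k u" and eq: "integral\<^sup>L M h = integral\<^sup>L M k"
    and u: "u \<in> space M"
  shows "h u = k u"
proof -
  have "k u - h u = 0"
    by (rule integral_zero_imp_zero[of "\<lambda>u. k u - h u", OF continuous_on_diff[OF k h] _ _ u])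
      (use le eq in \<open>auto simp: integrable_continuous h k\<close>)
  then show ?thesis by simp
qed

text \<open>A superposition of ridge functions \<open>\<psi> (a u \<bullet> z)\<close> may be differentiated under the integral sign. On the
compact space the arguments \<open>a u \<bullet> z\<close> stay in a compact interval of positive numbers, where \<open>\<psi>'\<close> is
uniformly continuous, so the remainder in the mean value theorem is small uniformly in \<open>u\<close>.\<close>

lemma has_derivative_ridge_integral:
  fixes a :: "'a \<Rightarrow> 'b::euclidean_space" and b :: "'a \<Rightarrow> 'c::euclidean_space"
  assumes der: "\<And>t. 0 < t \<Longrightarrow> (\<psi> has_real_derivative \<psi>' t) (at t)"
    and cont: "continuous_on {0<..} \<psi>'"
    and a: "continuous_on (space M) a" and b: "continuous_on (space M) b"
    and z: "\<And>u. u \<in> space M \<Longrightarrow> 0 < a u \<bullet> z"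
  shows "((\<lambda>z. LINT u|M. \<psi> (a u \<bullet> z) *\<^sub>R b u) has_derivative
           (\<lambda>h. LINT u|M. (\<psi>' (a u \<bullet> z) * (a u \<bullet> h)) *\<^sub>R b u)) (at z)"
proof -
  note K = compact_space
  obtain m where m: "m > 0" "\<And>u. u \<in> space M \<Longrightarrow> m \<le> a u \<bullet> z"
    using compact_continuous_positive[OF K continuous_on_inner[OF a continuous_on_const] z] by blast
  obtain A where A: "A > 0" "\<And>u. u \<in> space M \<Longrightarrow> norm (a u) \<le> A"
    using compact_continuous_bounded[OF K a] by blast
  obtain B where B: "B > 0" "\<And>u. u \<in> space M \<Longrightarrow> norm (b u) \<le> B"
    using compact_continuous_bounded[OF K b] by blast
  have contpsi: "continuous_on {0<..} \<psi>"
    by (auto intro!: continuous_at_imp_continuous_on DERIV_isCont[OF der])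
  have ci: "continuous_on (space M) (\<lambda>u. g (a u \<bullet> y))" if "continuous_on {0<..} g"
    "\<And>u. u \<in> space M \<Longrightarrow> 0 < a u \<bullet> y" for g :: "real \<Rightarrow> real" and y
    by (rule continuous_on_compose2[OF that(1)]) (use that(2) in \<open>auto intro!: continuous_intros a\<close>)
  define C where "C = measure M (space M)"
  have int': "integrable M (\<lambda>u. (\<psi>' (a u \<bullet> z) * (a u \<bullet> h)) *\<^sub>R b u)" for h
    by (intro integrable_continuous continuous_intros a b ci[OF cont z])
  show ?thesis unfolding has_derivative_at_alt
  proof (intro conjI allI impI)
    show "bounded_linear (\<lambda>h. LINT u|M. (\<psi>' (a u \<bullet> z) * (a u \<bullet> h)) *\<^sub>R b u)"
      unfolding linear_conv_bounded_linear[symmetric]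
    proof (rule linearI)
      fix x y
      show "(LINT u|M. (\<psi>' (a u \<bullet> z) * (a u \<bullet> (x + y))) *\<^sub>R b u)
          = (LINT u|M. (\<psi>' (a u \<bullet> z) * (a u \<bullet> x)) *\<^sub>R b u) + (LINT u|M. (\<psi>' (a u \<bullet> z) * (a u \<bullet> y)) *\<^sub>R b u)"
        using int' by (simp add: inner_add_right distrib_left scaleR_add_left)
    next
      fix r x
      have "(LINT u|M. (\<psi>' (a u \<bullet> z) * (a u \<bullet> (r *\<^sub>R x))) *\<^sub>R b u)
          = (LINT u|M. r *\<^sub>R ((\<psi>' (a u \<bullet> z) * (a u \<bullet> x)) *\<^sub>R b u))"
        by (simp add: mult_ac)
      also have "\<dots> = r *\<^sub>R (LINT u|M. (\<psi>' (a u \<bullet> z) * (a u \<bullet> x)) *\<^sub>R b u)"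
        by (rule integral_scaleR_right)
      finally show "(LINT u|M. (\<psi>' (a u \<bullet> z) * (a u \<bullet> (r *\<^sub>R x))) *\<^sub>R b u)
          = r *\<^sub>R (LINT u|M. (\<psi>' (a u \<bullet> z) * (a u \<bullet> x)) *\<^sub>R b u)" .
    qed
  next
    fix e :: real assume "0 < e"
    define \<eta> where "\<eta> = e / (A * B * (C + 1))"
    have C0: "C \<ge> 0" by (simp add: C_def)
    have eta: "\<eta> > 0" using A B C0 \<open>0 < e\<close> by (simp add: \<eta>_def)
    \<comment> \<open>contains all \<open>a u \<bullet> y\<close> for \<open>y\<close> near \<open>z\<close> and stays away from the boundary point 0 of the domain of \<open>\<psi>\<close>\<close>
    let ?I = "{m/2..A * norm z + m}"
    have "uniformly_continuous_on ?I \<psi>'"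
      by (rule compact_uniformly_continuous) (use m in \<open>auto intro: continuous_on_subset[OF cont]\<close>)
    then have "\<exists>d>0. \<forall>t\<in>?I. \<forall>s\<in>?I. dist s t < d \<longrightarrow> dist (\<psi>' s) (\<psi>' t) < \<eta>"
      unfolding uniformly_continuous_on_def using eta by (drule_tac spec[of _ \<eta>]) simp
    then obtain d where d: "d > 0" "\<And>s t. s \<in> ?I \<Longrightarrow> t \<in> ?I \<Longrightarrow> dist s t < d \<Longrightarrow> dist (\<psi>' s) (\<psi>' t) < \<eta>"
      by blast
    define \<delta> where "\<delta> = min d (m/2) / A"
    have delta: "\<delta> > 0" using d m A by (simp add: \<delta>_def)
    have lin: "norm (\<psi> s - \<psi> t - \<psi>' t * (s - t)) \<le> \<eta> * \<bar>s - t\<bar>"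
      if t: "m \<le> t" "t \<le> A * norm z" and st: "\<bar>s - t\<bar> < min d (m/2)" for s t
    proof (cases "s = t")
      case False
      obtain \<xi> where xi: "\<bar>\<xi> - t\<bar> \<le> \<bar>s - t\<bar>" "\<psi> s - \<psi> t = (s - t) * \<psi>' \<xi>"
      proof (cases "s < t")
        case True
        have "\<exists>\<xi>>s. \<xi> < t \<and> \<psi> t - \<psi> s = (t - s) * \<psi>' \<xi>"
          by (rule MVT2[OF True der]) (use t st m in linarith)
        then obtain \<xi> where "s < \<xi>" "\<xi> < t" "\<psi> t - \<psi> s = (t - s) * \<psi>' \<xi>" by blast
        then show ?thesis by (intro that[of \<xi>]) (auto simp: algebra_simps)
      next
        case 2: False
        then have "t < s" using False by simp
        then have "\<exists>\<xi>>t. \<xi> < s \<and> \<psi> s - \<psi> t = (s - t) * \<psi>' \<xi>"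
          by (rule MVT2[OF _ der]) (use t st m in linarith)
        then obtain \<xi> where "t < \<xi>" "\<xi> < s" "\<psi> s - \<psi> t = (s - t) * \<psi>' \<xi>" by blast
        then show ?thesis by (intro that[of \<xi>]) auto
      qed
      have "\<bar>\<psi>' \<xi> - \<psi>' t\<bar> \<le> \<eta>"
      proof -
        have "\<xi> \<in> ?I" "t \<in> ?I" "dist \<xi> t < d"
          unfolding atLeastAtMost_iff dist_real_def using xi(1) st t m by linarith+
        from d(2)[OF this] show ?thesis by (simp add: dist_real_def)
      qed
      moreover have "\<psi> s - \<psi> t - \<psi>' t * (s - t) = (s - t) * (\<psi>' \<xi> - \<psi>' t)"
        unfolding xi(2) by (simp add: algebra_simps)
      ultimately show ?thesis by (simp add: abs_mult mult.commute[of \<eta>] mult_left_mono)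
    qed simp
    show "\<exists>\<delta>>0. \<forall>y. norm (y - z) < \<delta> \<longrightarrow>
      norm ((LINT u|M. \<psi> (a u \<bullet> y) *\<^sub>R b u) - (LINT u|M. \<psi> (a u \<bullet> z) *\<^sub>R b u)
        - (LINT u|M. (\<psi>' (a u \<bullet> z) * (a u \<bullet> (y - z))) *\<^sub>R b u)) \<le> e * norm (y - z)"
    proof (intro exI[of _ \<delta>] conjI allI impI delta)
      fix y assume y: "norm (y - z) < \<delta>"
      have close: "\<bar>a u \<bullet> y - a u \<bullet> z\<bar> \<le> A * norm (y - z)" if "u \<in> space M" for u
      proof -
        have "\<bar>a u \<bullet> (y - z)\<bar> \<le> norm (a u) * norm (y - z)" by (rule Cauchy_Schwarz_ineq2)
        also have "\<dots> \<le> A * norm (y - z)" using A(2)[OF that] by (intro mult_right_mono) auto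
        finally show ?thesis by (simp add: inner_diff_right)
      qed
      have close': "A * norm (y - z) < min d (m/2)"
        using y A(1) by (simp add: \<delta>_def pos_less_divide_eq mult.commute)
      have y0: "0 < a u \<bullet> y" if "u \<in> space M" for u
        using close[OF that] close' m(2)[OF that] m(1) by linarith
      have int: "integrable M (\<lambda>u. \<psi> (a u \<bullet> y) *\<^sub>R b u)" "integrable M (\<lambda>u. \<psi> (a u \<bullet> z) *\<^sub>R b u)"
        using ci[OF contpsi z] ci[OF contpsi y0]
        by (auto intro!: integrable_continuous continuous_on_scaleR b)
      let ?r = "\<lambda>u. (\<psi> (a u \<bullet> y) - \<psi> (a u \<bullet> z) - \<psi>' (a u \<bullet> z) * (a u \<bullet> y - a u \<bullet> z)) *\<^sub>R b u"
      have "norm ((LINT u|M. \<psi> (a u \<bullet> y) *\<^sub>R b u) - (LINT u|M. \<psi> (a u \<bullet> z) *\<^sub>R b u)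
        - (LINT u|M. (\<psi>' (a u \<bullet> z) * (a u \<bullet> (y - z))) *\<^sub>R b u)) = norm (LINT u|M. ?r u)"
        by (simp add: scaleR_diff_left inner_diff_right int int'[of "y - z", unfolded inner_diff_right]
            Bochner_Integration.integral_diff)
      also have "\<dots> \<le> (LINT u|M. norm (?r u))" by (rule integral_norm_bound)
      also have "\<dots> \<le> (LINT u|M. \<eta> * (A * norm (y - z)) * B)"
      proof (rule integral_mono)
        show "integrable M (\<lambda>u. norm (?r u))"
          unfolding scaleR_diff_left
          by (intro integrable_norm Bochner_Integration.integrable_diff int
              int'[of "y - z", unfolded inner_diff_right])
      next
        fix u assume u: "u \<in> space M"
        have "a u \<bullet> z \<le> A * norm z"
          using norm_cauchy_schwarz[of "a u" z] mult_right_mono[OF A(2)[OF u], of "norm z"] by simp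
        then have "norm (\<psi> (a u \<bullet> y) - \<psi> (a u \<bullet> z) - \<psi>' (a u \<bullet> z) * (a u \<bullet> y - a u \<bullet> z))
            \<le> \<eta> * \<bar>a u \<bullet> y - a u \<bullet> z\<bar>"
          using m(2)[OF u] close[OF u] close' by (intro lin) auto
        also have "\<dots> \<le> \<eta> * (A * norm (y - z))" using close[OF u] eta by (intro mult_left_mono) auto
        finally show "norm (?r u) \<le> \<eta> * (A * norm (y - z)) * B"
          using B(2)[OF u] B(1) by (simp add: mult_mono)
      qed auto
      also have "\<dots> = (\<eta> * A * B * C) * norm (y - z)" by (simp add: C_def)
      also have "\<dots> \<le> e * norm (y - z)"
      proof (rule mult_right_mono)
        have "\<eta> * A * B * C = e * (C / (C + 1))" using A B C0 by (simp add: \<eta>_def)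
        also have "\<dots> \<le> e * 1" using \<open>0 < e\<close> C0 by (intro mult_left_mono) auto
        finally show "\<eta> * A * B * C \<le> e" by simp
      qed simp
      finally show "norm ((LINT u|M. \<psi> (a u \<bullet> y) *\<^sub>R b u) - (LINT u|M. \<psi> (a u \<bullet> z) *\<^sub>R b u)
        - (LINT u|M. (\<psi>' (a u \<bullet> z) * (a u \<bullet> (y - z))) *\<^sub>R b u)) \<le> e * norm (y - z)" .
    qed
  qed
qed

end

section \<open>Determinants of weighted isotropic frames\<close>

lemma orthonormal_family_inner:
  fixes e :: "'m::finite \<Rightarrow> real^'m"
  assumes "\<And>i j. e i \<bullet> e j = (if i = j then 1 else 0)"
  shows "x \<bullet> y = (\<Sum>i\<in>UNIV. (x \<bullet> e i) * (y \<bullet> e i))"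
proof -
  define P :: "real^'m^'m" where "P = (\<chi> i j. e j $ i)"
  have "transpose P ** P = mat 1"
    using assms by (simp add: vec_eq_iff matrix_matrix_mult_def transpose_def P_def mat_def inner_vec_def)
  then have PP: "P ** transpose P = mat 1" by (rule matrix_left_right_inverse[THEN iffD1])
  have coord: "(transpose P *v v) $ i = v \<bullet> e i" for v i
    by (simp add: matrix_vector_mult_def transpose_def P_def inner_vec_def mult.commute)
  have "P *v (transpose P *v y) = y" by (simp only: matrix_vector_mul_assoc PP matrix_vector_mul_lid)
  then have "x \<bullet> y = x \<bullet> (P *v (transpose P *v y))" by simp
  also have "\<dots> = (transpose P *v x) \<bullet> (transpose P *v y)"
    by (metis dot_lmul_matrix transpose_matrix_vector)
  also have "\<dots> = (\<Sum>i\<in>UNIV. (x \<bullet> e i) * (y \<bullet> e i))"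
    by (subst inner_vec_def) (simp only: coord inner_real_def)
  finally show ?thesis .
qed

definition gaussian :: "'a::euclidean_space \<Rightarrow> real" where
  "gaussian y = (\<Prod>b\<in>Basis. std_normal_density (y \<bullet> b))"

lemma gaussian_pos: "0 < gaussian y"
  unfolding gaussian_def by (intro prod_pos) (simp add: normal_density_pos)

lemma has_bochner_integral_gaussian: "has_bochner_integral lborel (gaussian :: 'a::euclidean_space \<Rightarrow> real) 1"
proof (rule has_bochner_integral_nn_integral)
  have "(\<integral>\<^sup>+x. ennreal (std_normal_density x) \<partial>lborel) = 1"
    using nn_integral_eq_integral[of lborel std_normal_density] by simp
  moreover have "nn_integral lborel (\<lambda>y::'a. \<Prod>b\<in>Basis. ennreal (std_normal_density (y \<bullet> b)))
      = (\<Prod>b\<in>(Basis::'a set). \<integral>\<^sup>+x. ennreal (std_normal_density x) \<partial>lborel)"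
    by (rule nn_integral_lborel_prod) auto
  ultimately show "nn_integral lborel (\<lambda>y::'a. ennreal (gaussian y)) = ennreal 1"
    unfolding gaussian_def by (simp add: prod_ennreal)
qed (auto simp: gaussian_def[abs_def] intro!: prod_nonneg)

lemma ln_std_normal_density: "ln (std_normal_density s) = - ln (2 * pi) / 2 - s\<^sup>2 / 2"
  by (simp add: std_normal_density_def ln_mult ln_div ln_sqrt field_simps)

lemma ln_gaussian:
  fixes y :: "'a::euclidean_space"
  shows "ln (gaussian y) = - DIM('a) * (ln (2 * pi) / 2) - (y \<bullet> y) / 2"
proof -
  have "ln (gaussian y) = (\<Sum>b\<in>Basis. ln (std_normal_density (y \<bullet> b)))"
    unfolding gaussian_def by (rule ln_prod) (auto simp: normal_density_pos[THEN less_imp_neq[THEN not_sym]])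
  also have "\<dots> = (\<Sum>b\<in>(Basis::'a set). - ln (2 * pi) / 2) - (\<Sum>b\<in>Basis. (y \<bullet> b)\<^sup>2) / 2"
    by (simp add: ln_std_normal_density sum_subtractf sum_divide_distrib sum_negf)
  also have "(\<Sum>b\<in>Basis. (y \<bullet> b)\<^sup>2) = y \<bullet> y"
    by (simp add: euclidean_inner[of y y] power2_eq_square)
  finally show ?thesis by simp
qed

context compact_full_measure begin

text \<open>Jensen's inequality for the logarithm and the probability density \<open>p\<close>, with its equality case: integrate
\<open>ln (\<tau> u / a) \<le> \<tau> u / a - 1\<close> against \<open>p\<close>, where \<open>a\<close> is the mean of \<open>\<tau>\<close>; equality holds only at \<open>\<tau> u = a\<close>.\<close>

lemma jensen_ln:
  fixes p \<tau> :: "'a \<Rightarrow> real"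
  assumes p: "continuous_on (space M) p" and p0: "\<And>u. u \<in> space M \<Longrightarrow> 0 \<le> p u"
    and p1: "(LINT u|M. p u) = 1"
    and t: "continuous_on (space M) \<tau>" and t0: "\<And>u. u \<in> space M \<Longrightarrow> 0 < \<tau> u"
  shows "0 < (LINT u|M. p u * \<tau> u)"
    and "(LINT u|M. p u * ln (\<tau> u)) \<le> ln (LINT u|M. p u * \<tau> u)"
    and "(LINT u|M. p u * ln (\<tau> u)) = ln (LINT u|M. p u * \<tau> u) \<Longrightarrow> u \<in> space M \<Longrightarrow>
           p u = 0 \<or> \<tau> u = (LINT u|M. p u * \<tau> u)"
proof -
  define a where "a = (LINT u|M. p u * \<tau> u)"
  have cpt: "continuous_on (space M) (\<lambda>u. p u * \<tau> u)" by (intro continuous_intros p t)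
  have cln: "continuous_on (space M) (\<lambda>u. p u * ln (\<tau> u))"
    by (rule continuous_on_mult[OF p continuous_on_ln[OF t]]) (use t0 in force)
  have a0: "0 \<le> a" unfolding a_def by (rule integral_nonneg_AE, rule AE_I2) (use p0 t0 in \<open>auto intro: less_imp_le mult_nonneg_nonneg\<close>)
  have "a \<noteq> 0"
  proof
    assume "a = 0"
    have "p u * \<tau> u = 0" if "u \<in> space M" for u
      by (rule integral_zero_imp_zero[OF cpt _ _ that])
        (use p0 t0 \<open>a = 0\<close> in \<open>auto simp: a_def intro: less_imp_le mult_nonneg_nonneg\<close>)
    then have "p u = 0" if "u \<in> space M" for u using that t0[of u] by force
    then have "(LINT u|M. p u) = 0" by (simp cong: Bochner_Integration.integral_cong)
    then show False using p1 by simp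
  qed
  with a0 have a: "0 < a" by simp
  then show "0 < (LINT u|M. p u * \<tau> u)" by (simp add: a_def)
  \<comment> \<open>the right-hand function is the affine upper bound of the logarithm at \<open>a\<close>, with integral \<open>ln a\<close>\<close>
  let ?l = "\<lambda>u. p u * ln (\<tau> u)" and ?r = "\<lambda>u. p u * \<tau> u / a + p u * (ln a - 1)"
  have cr: "continuous_on (space M) ?r" by (intro continuous_intros p t) (use a in auto)
  have le: "?l u \<le> ?r u" if "u \<in> space M" for u
  proof -
    have "ln (\<tau> u / a) \<le> \<tau> u / a - 1" using a t0[OF that] by (intro ln_le_minus_one) auto
    then have "ln (\<tau> u) \<le> \<tau> u / a + (ln a - 1)" using a t0[OF that] by (simp add: ln_div)
    from mult_left_mono[OF this p0[OF that]] show ?thesis by (simp add: distrib_left)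
  qed
  have "(LINT u|M. ?r u) = (LINT u|M. p u * \<tau> u) / a + (LINT u|M. p u) * (ln a - 1)"
    using integrable_continuous[OF p] integrable_continuous[OF cpt] by simp
  then have r: "(LINT u|M. ?r u) = ln a" using a by (simp add: p1 a_def[symmetric])
  have "(LINT u|M. ?l u) \<le> (LINT u|M. ?r u)"
    by (rule integral_mono[OF integrable_continuous[OF cln] integrable_continuous[OF cr]]) (rule le)
  then show "(LINT u|M. ?l u) \<le> ln (LINT u|M. p u * \<tau> u)" by (simp only: r a_def[symmetric])
  show "p u = 0 \<or> \<tau> u = (LINT u|M. p u * \<tau> u)"
    if "(LINT u|M. ?l u) = ln (LINT u|M. p u * \<tau> u)" "u \<in> space M"
  proof -
    have eq: "?l u = ?r u"
      using integral_eq_imp_eq[OF cln cr le _ that(2)] that(1) by (simp add: a_def[symmetric] r)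
    show ?thesis
    proof (cases "p u = 0")
      case False
      have "p u * ln (\<tau> u) = p u * (\<tau> u / a + (ln a - 1))" using eq by (simp add: distrib_left)
      with False have "ln (\<tau> u) = \<tau> u / a + (ln a - 1)" by simp
      then have "ln (\<tau> u / a) = \<tau> u / a - 1" using a t0[OF that(2)] by (simp add: ln_div)
      then have "\<tau> u / a = 1" using a t0[OF that(2)] by (intro ln_eq_minus_one) auto
      then show ?thesis using a by (simp add: a_def)
    qed simp
  qed
qed

end

text \<open>The vectors \<open>w u\<close> need not be unit vectors; isotropy says that \<open>\<integral> w u \<otimes> w u\<close> is the identity.\<close>

locale isotropic_system = compact_full_measure M for M :: "'a::euclidean_space measure" +
  fixes w :: "'a \<Rightarrow> real^'m"
  assumes w: "continuous_on (space M) w"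
    and iso: "\<And>x y. (LINT u|M. (w u \<bullet> x) * (w u \<bullet> y)) = x \<bullet> y"
begin

lemma integral_norm_squared: "(LINT u|M. w u \<bullet> w u) = CARD('m)"
proof -
  have "(LINT u|M. w u \<bullet> w u) = (LINT u|M. (\<Sum>b\<in>Basis. (w u \<bullet> b) * (w u \<bullet> b)))"
    by (subst euclidean_inner) simp
  also have "\<dots> = (\<Sum>b\<in>Basis. LINT u|M. (w u \<bullet> b) * (w u \<bullet> b))"
    by (intro Bochner_Integration.integral_sum integrable_continuous continuous_intros w)
  also have "\<dots> = (\<Sum>b\<in>(Basis::(real^'m) set). 1)" by (intro sum.cong refl) (simp add: iso inner_Basis)
  finally show ?thesis by simp
qed

definition weighted_frame :: "('a \<Rightarrow> real) \<Rightarrow> real^'m^'m" where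
  "weighted_frame \<tau> = (\<chi> i j. LINT u|M. \<tau> u * (w u $ i * w u $ j))"

lemma weighted_frame_mult:
  assumes t: "continuous_on (space M) \<tau>"
  shows "weighted_frame \<tau> *v x = (LINT u|M. (\<tau> u * (w u \<bullet> x)) *\<^sub>R w u)"
proof -
  have "(weighted_frame \<tau> *v x) $ i = (LINT u|M. (\<tau> u * (w u \<bullet> x)) *\<^sub>R w u) $ i" for i
  proof -
    have "(LINT u|M. (\<tau> u * (w u \<bullet> x)) *\<^sub>R w u) $ i = (LINT u|M. ((\<tau> u * (w u \<bullet> x)) *\<^sub>R w u) $ i)"
      by (rule integral_bounded_linear[OF bounded_linear_vec_nth, symmetric])
        (intro integrable_continuous continuous_intros t w)
    also have "\<dots> = (LINT u|M. (\<Sum>j\<in>UNIV. (\<tau> u * (w u $ i * w u $ j)) * x $ j))"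
      by (simp add: inner_vec_def sum_distrib_left sum_distrib_right mult_ac)
    also have "\<dots> = (\<Sum>j\<in>UNIV. LINT u|M. (\<tau> u * (w u $ i * w u $ j)) * x $ j)"
      by (intro Bochner_Integration.integral_sum integrable_continuous continuous_intros w t)
    finally show ?thesis
      by (simp add: weighted_frame_def matrix_vector_mult_def)
  qed
  then show ?thesis by (simp add: vec_eq_iff)
qed

lemma weighted_frame_form:
  assumes t: "continuous_on (space M) \<tau>"
  shows "y \<bullet> (weighted_frame \<tau> *v x) = (LINT u|M. \<tau> u * ((w u \<bullet> x) * (w u \<bullet> y)))"
proof -
  have "y \<bullet> (LINT u|M. (\<tau> u * (w u \<bullet> x)) *\<^sub>R w u) = (LINT u|M. y \<bullet> ((\<tau> u * (w u \<bullet> x)) *\<^sub>R w u))"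
    by (rule integral_bounded_linear[OF bounded_linear_inner_right, symmetric]) (intro integrable_continuous continuous_intros t w)
  then show ?thesis by (simp add: weighted_frame_mult[OF t] inner_commute[of y] mult.assoc)
qed

text \<open>In an orthonormal eigenbasis \<open>e\<close> of the frame the determinant is the product of the numbers
\<open>\<integral> \<tau> u * (w u \<bullet> e i)\<^sup>2\<close>. Each \<open>(w u \<bullet> e i)\<^sup>2\<close> is a probability density by isotropy, so Jensen's inequality
applies to each factor, and the densities add up to \<open>|w u|\<^sup>2\<close>. In the equality case \<open>\<tau> u\<close> is the \<open>i\<close>-th
eigenvalue whenever \<open>w u\<close> has a component along \<open>e i\<close>; vectors with different values of \<open>\<tau>\<close> therefore share
no component.\<close>

lemma det_weighted_frame:
  assumes t: "continuous_on (space M) \<tau>" and t0: "\<And>u. u \<in> space M \<Longrightarrow> 0 < \<tau> u"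
  shows "exp (LINT u|M. (w u \<bullet> w u) * ln (\<tau> u)) \<le> det (weighted_frame \<tau>)"
    and "\<lbrakk>exp (LINT u|M. (w u \<bullet> w u) * ln (\<tau> u)) = det (weighted_frame \<tau>);
          u \<in> space M; v \<in> space M; \<tau> u \<noteq> \<tau> v\<rbrakk> \<Longrightarrow> w u \<bullet> w v = 0"
proof -
  let ?A = "weighted_frame \<tau>"
  have "transpose ?A = ?A" by (simp add: transpose_def weighted_frame_def vec_eq_iff mult.commute)
  then obtain e :: "'m \<Rightarrow> real^'m" where e: "\<And>i j. e i \<bullet> e j = (if i = j then 1 else 0)"
    and det: "det ?A = (\<Prod>i\<in>UNIV. e i \<bullet> (?A *v e i))"
    by (rule symmetric_matrix_eigenbasis) blast
  define p where "p i u = (w u \<bullet> e i)\<^sup>2" for i u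
  define d where "d i = (LINT u|M. p i u * \<tau> u)" for i
  have d: "e i \<bullet> (?A *v e i) = d i" for i
    by (simp add: weighted_frame_form[OF t] d_def p_def power2_eq_square mult.commute)
  have cp: "continuous_on (space M) (p i)" for i
    unfolding p_def by (intro continuous_intros w)
  have p1: "(LINT u|M. p i u) = 1" for i by (simp add: p_def power2_eq_square iso e)
  have p0: "0 \<le> p i u" for i u by (simp add: p_def)
  have dpos: "0 < d i" for i unfolding d_def by (rule jensen_ln(1)[OF cp p0 p1 t t0])
  have le: "(LINT u|M. p i u * ln (\<tau> u)) \<le> ln (d i)" for i
    unfolding d_def by (rule jensen_ln(2)[OF cp p0 p1 t t0])
  have psum: "(\<Sum>i\<in>UNIV. p i u) = w u \<bullet> w u" for u
    by (simp add: p_def orthonormal_family_inner[OF e, of "w u" "w u"] power2_eq_square)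
  have lnt: "continuous_on (space M) (\<lambda>u. ln (\<tau> u))" by (rule continuous_on_ln[OF t]) (use t0 in force)
  have split: "(LINT u|M. (w u \<bullet> w u) * ln (\<tau> u)) = (\<Sum>i\<in>UNIV. LINT u|M. p i u * ln (\<tau> u))"
    unfolding psum[symmetric] sum_distrib_right
    by (intro Bochner_Integration.integral_sum integrable_continuous continuous_on_mult cp lnt)
  have lndet: "det ?A = exp (\<Sum>i\<in>UNIV. ln (d i))"
    using dpos by (simp add: det d exp_sum)
  show "exp (LINT u|M. (w u \<bullet> w u) * ln (\<tau> u)) \<le> det ?A"
    unfolding lndet split by (simp add: sum_mono le)
  show "w u \<bullet> w v = 0" if eq: "exp (LINT u|M. (w u \<bullet> w u) * ln (\<tau> u)) = det ?A"
    and uv: "u \<in> space M" "v \<in> space M" "\<tau> u \<noteq> \<tau> v"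
  proof -
    have "(\<Sum>i\<in>UNIV. ln (d i) - (LINT u|M. p i u * ln (\<tau> u))) = 0"
      using eq unfolding lndet split by (simp add: sum_subtractf)
    then have "ln (d i) - (LINT u|M. p i u * ln (\<tau> u)) = 0" for i
      using le by (subst (asm) sum_nonneg_eq_0_iff) auto
    then have "p i x = 0 \<or> \<tau> x = d i" if "x \<in> space M" for i x
      using jensen_ln(3)[OF cp p0 p1 t t0 _ that, of i] by (simp add: d_def)
    then have "(w u \<bullet> e i) * (w v \<bullet> e i) = 0" for i
      using uv by (metis mult_eq_0_iff p_def zero_eq_power2)
    then show ?thesis
      unfolding orthonormal_family_inner[OF e, of "w u" "w v"] by (intro sum.neutral ballI)
  qed
qed

end

section \<open>The transport map of an isotropic system\<close>

text \<open>The number \<open>c u * norm (w u)\<close> is the rate of the exponential density that is placed along the direction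
of \<open>w u\<close>. The index type is well-ordered because the change of variables theorem asks for it.\<close>

locale weighted_isotropic_system = isotropic_system M w
  for M :: "'a::euclidean_space measure" and w :: "'a \<Rightarrow> real^'m::{finite,wellorder}" +
  fixes c :: "'a \<Rightarrow> real"
  assumes c: "continuous_on (space M) c" and c_pos: "\<And>u. u \<in> space M \<Longrightarrow> 0 < c u"
    and w_nonzero: "\<And>u. u \<in> space M \<Longrightarrow> w u \<noteq> 0"
begin

definition positivity_cone where
  "positivity_cone = {z. \<forall>u\<in>space M. 0 < w u \<bullet> z}"

text \<open>The weighted product of the exponential densities along all directions is \<open>exp (- (exponent \<bullet> z))\<close> up
to a constant factor.\<close>

definition exponent where
  "exponent = (LINT u|M. (c u * (w u \<bullet> w u)) *\<^sub>R w u)"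

definition entropy :: real where
  "entropy = (LINT u|M. (w u \<bullet> w u) * ln (c u * norm (w u)))"

lemma open_positivity_cone: "open positivity_cone"
proof (rule openI)
  fix z assume z: "z \<in> positivity_cone"
  obtain m where m: "m > 0" "\<And>u. u \<in> space M \<Longrightarrow> m \<le> w u \<bullet> z"
    using compact_continuous_positive[OF compact_space continuous_on_inner[OF w continuous_on_const]] z
    unfolding positivity_cone_def by blast
  obtain B where B: "B > 0" "\<And>u. u \<in> space M \<Longrightarrow> norm (w u) \<le> B"
    using compact_continuous_bounded[OF compact_space w] by blast
  have "y \<in> positivity_cone" if "dist z y < m / B" for y
    unfolding positivity_cone_def
  proof safe
    fix u assume u: "u \<in> space M"
    have "\<bar>w u \<bullet> (y - z)\<bar> \<le> norm (w u) * norm (y - z)" by (rule Cauchy_Schwarz_ineq2)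
    also have "\<dots> \<le> B * norm (y - z)" using B(2)[OF u] by (rule mult_right_mono) simp
    also have "\<dots> < m" using that B(1) by (simp add: dist_norm norm_minus_commute less_divide_eq mult.commute)
    finally show "0 < w u \<bullet> y" using m(2)[OF u] by (simp add: inner_diff_right)
  qed
  then show "\<exists>e>0. ball z e \<subseteq> positivity_cone"
    using m(1) B(1) by (intro exI[of _ "m / B"]) auto
qed

text \<open>At a point \<open>z\<close> of the cone, the transport equation at \<open>c u * (w u \<bullet> z)\<close> is put into logarithmic form and
integrated against \<open>|w u|\<^sup>2\<close>. The Gaussian density at \<open>T z\<close> enters through \<open>T_le\<close> below, which is Bessel's
inequality: \<open>T z\<close> has the coefficients \<open>\<phi> (c u * (w u \<bullet> z)) * norm (w u)\<close> with respect to the isotropic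
system, and the norm of a superposition is at most the norm of its coefficients.\<close>

lemma brascamp_lieb_pointwise:
  assumes phi: "\<And>t. 0 < t \<Longrightarrow> (\<phi> has_real_derivative \<phi>' t) (at t)"
    "\<And>t. 0 < t \<Longrightarrow> 0 < \<phi>' t"
    "\<And>t. 0 < t \<Longrightarrow> exp (- t) = \<phi>' t * std_normal_density (\<phi> t)"
    "continuous_on {0<..} \<phi>'"
    and z: "z \<in> positivity_cone"
  defines "\<tau> \<equiv> \<lambda>u. \<phi>' (c u * (w u \<bullet> z)) * (c u * norm (w u))"
    and "T \<equiv> \<lambda>z. LINT u|M. \<phi> (c u * (w u \<bullet> z)) *\<^sub>R (norm (w u) *\<^sub>R w u)"
  shows "continuous_on (space M) \<tau>" and "\<And>u. u \<in> space M \<Longrightarrow> 0 < \<tau> u"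
    and "exp (- (exponent \<bullet> z)) \<le> exp (- entropy) * (exp (LINT u|M. (w u \<bullet> w u) * ln (\<tau> u)) * gaussian (T z))"
    and "(T has_derivative (*v) (weighted_frame \<tau>)) (at z)"
proof -
  have pos: "0 < c u * (w u \<bullet> z)" if "u \<in> space M" for u
    using z c_pos[OF that] that by (simp add: positivity_cone_def)
  have cz: "continuous_on (space M) (\<lambda>u. c u * (w u \<bullet> z))" by (intro continuous_intros c w)
  have comp: "continuous_on (space M) (\<lambda>u. g (c u * (w u \<bullet> z)))" if "continuous_on {0<..} g" for g :: "real \<Rightarrow> real"
    by (rule continuous_on_compose2[OF that cz]) (use pos in auto)
  have cphi: "continuous_on {0<..} \<phi>"
    by (auto intro!: continuous_at_imp_continuous_on DERIV_isCont[OF phi(1)])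
  note c1 = comp[OF cphi] and c2 = comp[OF phi(4)]
  have cn: "continuous_on (space M) (\<lambda>u. c u * norm (w u))" by (intro continuous_intros c w)
  have cn0: "0 < c u * norm (w u)" if "u \<in> space M" for u
    using c_pos[OF that] w_nonzero[OF that] by simp
  have cww: "continuous_on (space M) (\<lambda>u. w u \<bullet> w u)" by (intro continuous_intros w)
  show ct: "continuous_on (space M) \<tau>" unfolding \<tau>_def by (rule continuous_on_mult[OF c2 cn])
  show t0: "0 < \<tau> u" if "u \<in> space M" for u
    unfolding \<tau>_def using phi(2)[OF pos[OF that]] cn0[OF that] by simp
  show "(T has_derivative (*v) (weighted_frame \<tau>)) (at z)"
  proof -
    have T: "T = (\<lambda>z. LINT u|M. \<phi> ((c u *\<^sub>R w u) \<bullet> z) *\<^sub>R (norm (w u) *\<^sub>R w u))"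
      by (simp add: T_def)
    have "(T has_derivative (\<lambda>h. LINT u|M. (\<phi>' ((c u *\<^sub>R w u) \<bullet> z) * ((c u *\<^sub>R w u) \<bullet> h)) *\<^sub>R (norm (w u) *\<^sub>R w u))) (at z)"
      unfolding T
      by (rule has_derivative_ridge_integral[OF phi(1) phi(4)])
        (use pos in \<open>auto intro!: continuous_intros c w\<close>)
    moreover have "(\<lambda>h. LINT u|M. (\<phi>' ((c u *\<^sub>R w u) \<bullet> z) * ((c u *\<^sub>R w u) \<bullet> h)) *\<^sub>R (norm (w u) *\<^sub>R w u))
        = (*v) (weighted_frame \<tau>)"
      by (rule ext) (simp only: weighted_frame_mult[OF ct], simp add: \<tau>_def mult_ac)
    ultimately show ?thesis by simp
  qed
  have T_le: "T z \<bullet> T z \<le> (LINT u|M. (w u \<bullet> w u) * (\<phi> (c u * (w u \<bullet> z)))\<^sup>2)"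
  proof -
    let ?p = "\<lambda>u. \<phi> (c u * (w u \<bullet> z)) * norm (w u)"
    have cp: "continuous_on (space M) ?p" by (intro continuous_on_mult c1 continuous_intros w)
    have TT: "T z \<bullet> T z = (LINT u|M. ?p u * (w u \<bullet> T z))"
    proof -
      have "(LINT u|M. T z \<bullet> (?p u *\<^sub>R w u)) = T z \<bullet> (LINT u|M. ?p u *\<^sub>R w u)"
        by (rule integral_bounded_linear[OF bounded_linear_inner_right])
          (intro integrable_continuous continuous_on_scaleR cp w)
      then show ?thesis by (simp add: T_def inner_commute)
    qed
    have i1: "integrable M (\<lambda>u. (?p u)\<^sup>2)" by (intro integrable_continuous continuous_on_power cp)
    have i2: "integrable M (\<lambda>u. ?p u * (w u \<bullet> T z))"
      by (intro integrable_continuous continuous_on_mult cp continuous_intros w)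
    have i3: "integrable M (\<lambda>u. (w u \<bullet> T z) * (w u \<bullet> T z))"
      by (intro integrable_continuous continuous_intros w)
    have "0 \<le> (LINT u|M. (?p u - w u \<bullet> T z)\<^sup>2)" by simp
    also have "(LINT u|M. (?p u - w u \<bullet> T z)\<^sup>2)
        = (LINT u|M. ((?p u)\<^sup>2 - 2 * (?p u * (w u \<bullet> T z))) + (w u \<bullet> T z) * (w u \<bullet> T z))"
      by (simp add: power2_eq_square algebra_simps)
    also have "\<dots> = (LINT u|M. (?p u)\<^sup>2) - 2 * (LINT u|M. ?p u * (w u \<bullet> T z)) + (LINT u|M. (w u \<bullet> T z) * (w u \<bullet> T z))"
      using i1 i2 i3 by simp
    also have "\<dots> = (LINT u|M. (?p u)\<^sup>2) - T z \<bullet> T z" unfolding TT[symmetric] iso by simp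
    also have "(LINT u|M. (?p u)\<^sup>2) = (LINT u|M. (w u \<bullet> w u) * (\<phi> (c u * (w u \<bullet> z)))\<^sup>2)"
      by (simp add: power_mult_distrib power2_norm_eq_inner mult.commute)
    finally show ?thesis by simp
  qed
  show "exp (- (exponent \<bullet> z)) \<le> exp (- entropy) * (exp (LINT u|M. (w u \<bullet> w u) * ln (\<tau> u)) * gaussian (T z))"
  proof -
    let ?s = "\<lambda>u. c u * (w u \<bullet> z)"
    have cl1: "continuous_on (space M) (\<lambda>u. (w u \<bullet> w u) * ln (\<tau> u))"
      by (rule continuous_on_mult[OF cww continuous_on_ln[OF ct]]) (use t0 in force)
    have cl2: "continuous_on (space M) (\<lambda>u. (w u \<bullet> w u) * ln (c u * norm (w u)))"
      by (rule continuous_on_mult[OF cww continuous_on_ln[OF cn]]) (use cn0 in force)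
    have cl3: "continuous_on (space M) (\<lambda>u. (w u \<bullet> w u) * (\<phi> (?s u))\<^sup>2)"
      by (intro continuous_on_mult cww continuous_on_power c1)
    have "exponent \<bullet> z = (LINT u|M. (w u \<bullet> w u) * ?s u)"
    proof -
      have "(LINT u|M. z \<bullet> ((c u * (w u \<bullet> w u)) *\<^sub>R w u)) = z \<bullet> exponent"
        unfolding exponent_def by (rule integral_bounded_linear[OF bounded_linear_inner_right])
          (intro integrable_continuous continuous_intros c w)
      then show ?thesis by (simp add: inner_commute[of z] mult_ac)
    qed
    also have "\<dots> = (LINT u|M. - ((w u \<bullet> w u) * ln (\<tau> u)) + (w u \<bullet> w u) * ln (c u * norm (w u))
        + (w u \<bullet> w u) * (ln (2 * pi) / 2) + (w u \<bullet> w u) * (\<phi> (?s u))\<^sup>2 / 2)"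
    proof (rule Bochner_Integration.integral_cong[OF refl])
      fix u assume u: "u \<in> space M"
      have "- ?s u = ln (exp (- ?s u))" by simp
      also have "\<dots> = ln (\<phi>' (?s u)) + ln (std_normal_density (\<phi> (?s u)))"
        unfolding phi(3)[OF pos[OF u]]
        using phi(2)[OF pos[OF u]] normal_density_pos[of 1 0 "\<phi> (?s u)"] by (simp add: ln_mult)
      also have "\<dots> = ln (\<tau> u) - ln (c u * norm (w u)) - ln (2 * pi) / 2 - (\<phi> (?s u))\<^sup>2 / 2"
        unfolding \<tau>_def ln_std_normal_density using phi(2)[OF pos[OF u]] cn0[OF u]
        by (subst ln_mult) auto
      finally have "?s u = - ln (\<tau> u) + ln (c u * norm (w u)) + ln (2 * pi) / 2 + (\<phi> (?s u))\<^sup>2 / 2"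
        by linarith
      then show "(w u \<bullet> w u) * ?s u = - ((w u \<bullet> w u) * ln (\<tau> u)) + (w u \<bullet> w u) * ln (c u * norm (w u))
        + (w u \<bullet> w u) * (ln (2 * pi) / 2) + (w u \<bullet> w u) * (\<phi> (?s u))\<^sup>2 / 2"
        by (metis (no_types, opaque_lifting) distrib_left mult_minus_right times_divide_eq_right)
    qed
    also have "\<dots> = - (LINT u|M. (w u \<bullet> w u) * ln (\<tau> u)) + entropy + CARD('m) * (ln (2 * pi) / 2)
        + (LINT u|M. (w u \<bullet> w u) * (\<phi> (?s u))\<^sup>2) / 2"
      using integrable_continuous[OF cl1] integrable_continuous[OF cl2] integrable_continuous[OF cl3]
        integrable_continuous[OF cww]
      by (simp add: entropy_def integral_norm_squared)
    finally have "- (exponent \<bullet> z) = (LINT u|M. (w u \<bullet> w u) * ln (\<tau> u)) - entropy - CARD('m) * (ln (2 * pi) / 2)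
        - (LINT u|M. (w u \<bullet> w u) * (\<phi> (?s u))\<^sup>2) / 2" by simp
    also have "\<dots> \<le> (LINT u|M. (w u \<bullet> w u) * ln (\<tau> u)) - entropy + ln (gaussian (T z))"
      using T_le by (simp add: ln_gaussian)
    finally have "exp (- (exponent \<bullet> z)) \<le> exp ((LINT u|M. (w u \<bullet> w u) * ln (\<tau> u)) - entropy + ln (gaussian (T z)))"
      by simp
    then show ?thesis by (simp add: exp_add exp_diff exp_minus gaussian_pos divide_inverse mult_ac)
  qed
qed

text \<open>The map is monotone: its increment from \<open>y\<close> to \<open>x\<close>, paired with \<open>x - y\<close>, is an integral of products
of equal signs. If it vanishes, all \<open>w u\<close> are orthogonal to \<open>x - y\<close>, and isotropy gives \<open>x = y\<close>.\<close>

lemma transport_injective: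
  assumes mono: "\<And>s t. 0 < s \<Longrightarrow> s < t \<Longrightarrow> \<phi> s < (\<phi> t :: real)" and cphi: "continuous_on {0<..} \<phi>"
  shows "inj_on (\<lambda>z. LINT u|M. \<phi> (c u * (w u \<bullet> z)) *\<^sub>R (norm (w u) *\<^sub>R w u)) positivity_cone"
proof (rule inj_onI)
  fix x y assume xy: "x \<in> positivity_cone" "y \<in> positivity_cone"
  let ?s = "\<lambda>z u. c u * (w u \<bullet> z)" and ?d = "x - y"
  assume eq: "(LINT u|M. \<phi> (?s x u) *\<^sub>R (norm (w u) *\<^sub>R w u)) = (LINT u|M. \<phi> (?s y u) *\<^sub>R (norm (w u) *\<^sub>R w u))"
  have pos: "0 < ?s z u" if "z \<in> positivity_cone" "u \<in> space M" for z u
    using that c_pos[OF that(2)] by (simp add: positivity_cone_def)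
  have comp: "continuous_on (space M) (\<lambda>u. \<phi> (?s z u))" if "z \<in> positivity_cone" for z
    by (rule continuous_on_compose2[OF cphi])
      (use pos[OF that] in \<open>auto intro!: continuous_intros c w\<close>)
  let ?h = "\<lambda>u. (\<phi> (?s x u) - \<phi> (?s y u)) * (norm (w u) * (w u \<bullet> ?d))"
  have ch: "continuous_on (space M) ?h" by (intro continuous_intros comp xy w)
  have dot: "(LINT u|M. \<phi> (?s z u) * (norm (w u) * (w u \<bullet> ?d)))
      = ?d \<bullet> (LINT u|M. \<phi> (?s z u) *\<^sub>R (norm (w u) *\<^sub>R w u))" if "z \<in> positivity_cone" for z
  proof -
    have "(LINT u|M. ?d \<bullet> (\<phi> (?s z u) *\<^sub>R (norm (w u) *\<^sub>R w u)))
      = ?d \<bullet> (LINT u|M. \<phi> (?s z u) *\<^sub>R (norm (w u) *\<^sub>R w u))"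
      by (rule integral_bounded_linear[OF bounded_linear_inner_right])
        (intro integrable_continuous continuous_intros comp that w)
    then show ?thesis by (simp add: inner_commute[of ?d] mult.assoc)
  qed
  have "(LINT u|M. ?h u) = (LINT u|M. \<phi> (?s x u) * (norm (w u) * (w u \<bullet> ?d)))
      - (LINT u|M. \<phi> (?s y u) * (norm (w u) * (w u \<bullet> ?d)))"
    unfolding left_diff_distrib
    by (intro Bochner_Integration.integral_diff integrable_continuous continuous_intros comp xy w)
  then have int0: "(LINT u|M. ?h u) = 0" by (simp only: dot[OF xy(1)] dot[OF xy(2)] eq diff_self)
  have sgn: "0 \<le> (\<phi> (?s x u) - \<phi> (?s y u)) * (w u \<bullet> ?d)"
    and zero: "(\<phi> (?s x u) - \<phi> (?s y u)) * (w u \<bullet> ?d) = 0 \<Longrightarrow> w u \<bullet> ?d = 0" if u: "u \<in> space M" for u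
  proof -
    have cu: "0 < c u" by (rule c_pos[OF u])
    consider "w u \<bullet> x < w u \<bullet> y" | "w u \<bullet> x = w u \<bullet> y" | "w u \<bullet> y < w u \<bullet> x" by linarith
    then have "0 \<le> (\<phi> (?s x u) - \<phi> (?s y u)) * (w u \<bullet> ?d) \<and>
      ((\<phi> (?s x u) - \<phi> (?s y u)) * (w u \<bullet> ?d) = 0 \<longrightarrow> w u \<bullet> ?d = 0)"
    proof cases
      case 1
      then have "\<phi> (?s x u) < \<phi> (?s y u)" using cu pos[OF xy(1) u] by (intro mono) auto
      with 1 show ?thesis by (auto simp: inner_diff_right mult_neg_neg less_imp_le)
    next
      case 3
      then have "\<phi> (?s y u) < \<phi> (?s x u)" using cu pos[OF xy(2) u] by (intro mono) auto
      with 3 show ?thesis by (auto simp: inner_diff_right)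
    qed (simp add: inner_diff_right)
    then show "0 \<le> (\<phi> (?s x u) - \<phi> (?s y u)) * (w u \<bullet> ?d)"
      and "(\<phi> (?s x u) - \<phi> (?s y u)) * (w u \<bullet> ?d) = 0 \<Longrightarrow> w u \<bullet> ?d = 0" by auto
  qed
  have h: "?h u = norm (w u) * ((\<phi> (?s x u) - \<phi> (?s y u)) * (w u \<bullet> ?d))" for u by simp
  have "w u \<bullet> ?d = 0" if u: "u \<in> space M" for u
  proof -
    have "?h u = 0"
    proof (rule integral_zero_imp_zero[OF ch _ int0 u])
      show "0 \<le> ?h v" if "v \<in> space M" for v
        unfolding h using sgn[OF that] by simp
    qed
    then show ?thesis unfolding h using w_nonzero[OF u] zero[OF u] by (metis mult_eq_0_iff norm_eq_zero)
  qed
  then have "(LINT u|M. (w u \<bullet> ?d) * (w u \<bullet> ?d)) = 0"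
    by (simp cong: Bochner_Integration.integral_cong)
  then show "x = y" unfolding iso by simp
qed

end

section \<open>The Brascamp-Lieb inequality on the positivity cone\<close>

text \<open>Real functions are read as functions into the one-dimensional vector space to which the general
formula applies.\<close>

lemma absolutely_integrable_change_of_variables_real:
  fixes f :: "real^'m::{finite,wellorder} \<Rightarrow> real" and g :: "real^'m::_ \<Rightarrow> real^'m::_"
  assumes S: "S \<in> sets lebesgue"
    and der: "\<And>x. x \<in> S \<Longrightarrow> (g has_derivative g' x) (at x within S)"
    and inj: "inj_on g S" and f: "f absolutely_integrable_on (g ` S)"
  shows "(\<lambda>x. \<bar>det (matrix (g' x))\<bar> * f (g x)) absolutely_integrable_on S"
    and "integral S (\<lambda>x. \<bar>det (matrix (g' x))\<bar> * f (g x)) = integral (g ` S) f"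
proof -
  let ?F = "\<lambda>y. vec (f y) :: real^1"
  have F: "?F absolutely_integrable_on (g ` S)" "integral (g ` S) ?F = vec (integral (g ` S) f)"
    using f set_lebesgue_integral_eq_integral(1)[OF f]
    by (auto simp: absolutely_integrable_on_1_iff integral_on_1_eq)
  have "(\<lambda>x. \<bar>det (matrix (g' x))\<bar> *\<^sub>R ?F (g x)) absolutely_integrable_on S \<and>
     integral S (\<lambda>x. \<bar>det (matrix (g' x))\<bar> *\<^sub>R ?F (g x)) = vec (integral (g ` S) f)"
    by (subst has_absolute_integral_change_of_variables[OF S der inj]) (use F in auto)
  then show "(\<lambda>x. \<bar>det (matrix (g' x))\<bar> * f (g x)) absolutely_integrable_on S"
    and "integral S (\<lambda>x. \<bar>det (matrix (g' x))\<bar> * f (g x)) = integral (g ` S) f"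
    by (auto simp: absolutely_integrable_on_1_iff integral_on_1_eq vec_eq_iff)
qed

lemma gaussian_absolutely_integrable:
  "(gaussian :: 'a::euclidean_space \<Rightarrow> real) absolutely_integrable_on UNIV"
  "integral UNIV (gaussian :: 'a::euclidean_space \<Rightarrow> real) = 1"
proof -
  have i: "integrable lborel (gaussian :: 'a \<Rightarrow> real)" "integral\<^sup>L lborel (gaussian :: 'a \<Rightarrow> real) = 1"
    using has_bochner_integral_gaussian by (auto simp: has_bochner_integral_iff)
  then have "integrable lebesgue (gaussian :: 'a \<Rightarrow> real)" by (simp add: integrable_completion)
  then show "(gaussian :: 'a \<Rightarrow> real) absolutely_integrable_on UNIV" by (simp add: set_integrable_def)
  show "integral UNIV (gaussian :: 'a \<Rightarrow> real) = 1"
    using integral_lborel[OF i(1)] i(2) by simp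
qed

context weighted_isotropic_system begin

text \<open>Integrating the pointwise bound over the cone, where the Jacobian turns the Gaussian density into its
integral over the image of \<open>T\<close>, at most 1. In the equality case the pointwise bound is sharp almost
everywhere on the cone, hence at some point off the hyperplane on which \<open>c u *\<^sub>R w u\<close> and \<open>c v *\<^sub>R w v\<close>
agree. There the weights \<open>\<tau> u\<close> and \<open>\<tau> v\<close> differ, because \<open>\<phi>'\<close> is injective, and equality in the
determinant bound gives orthogonality.\<close>

theorem brascamp_lieb_cone:
  shows "(\<lambda>z. exp (- (exponent \<bullet> z))) absolutely_integrable_on positivity_cone"
    and "integral positivity_cone (\<lambda>z. exp (- (exponent \<bullet> z))) \<le> exp (- entropy)"
    and "\<lbrakk>integral positivity_cone (\<lambda>z. exp (- (exponent \<bullet> z))) = exp (- entropy);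
      u \<in> space M; v \<in> space M; c u * norm (w u) = c v * norm (w v); c u *\<^sub>R w u \<noteq> c v *\<^sub>R w v\<rbrakk>
      \<Longrightarrow> w u \<bullet> w v = 0"
proof -
  let ?C = positivity_cone and ?E = "\<lambda>z. exp (- (exponent \<bullet> z))"
  obtain \<phi> \<phi>' :: "real \<Rightarrow> real"
    where phi: "\<And>t. 0 < t \<Longrightarrow> (\<phi> has_real_derivative \<phi>' t) (at t)"
    "\<And>t. 0 < t \<Longrightarrow> 0 < \<phi>' t"
    "\<And>t. 0 < t \<Longrightarrow> exp (- t) = \<phi>' t * std_normal_density (\<phi> t)"
    "continuous_on {0<..} \<phi>'"
    and anti: "\<And>s t. 0 < s \<Longrightarrow> s < t \<Longrightarrow> \<phi>' t < \<phi>' s"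
    using exponential_to_normal_transport by metis
  define \<tau> where "\<tau> z u = \<phi>' (c u * (w u \<bullet> z)) * (c u * norm (w u))" for z u
  define T where "T z = (LINT u|M. \<phi> (c u * (w u \<bullet> z)) *\<^sub>R (norm (w u) *\<^sub>R w u))" for z
  define D where "D z = det (weighted_frame (\<tau> z)) * gaussian (T z)" for z
  note pointwise = brascamp_lieb_pointwise[where \<phi>=\<phi> and \<phi>'=\<phi>', folded \<tau>_def T_def]
  have pw1: "continuous_on (space M) (\<tau> z)" if "z \<in> ?C" for z
    by (rule pointwise(1); fact phi that)
  have pw2: "0 < \<tau> z u" if "z \<in> ?C" "u \<in> space M" for z u
    by (rule pointwise(2); fact phi that)
  have pw3: "?E z \<le> exp (- entropy) * (exp (LINT u|M. (w u \<bullet> w u) * ln (\<tau> z u)) * gaussian (T z))"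
    if "z \<in> ?C" for z
    by (rule pointwise(3); fact phi that)
  have pw4: "(T has_derivative (*v) (weighted_frame (\<tau> z))) (at z)" if "z \<in> ?C" for z
    by (rule pointwise(4); fact phi that)
  have op: "open ?C" by (rule open_positivity_cone)
  then have C: "?C \<in> sets lebesgue" by auto
  have der: "(T has_derivative (*v) (weighted_frame (\<tau> z))) (at z within ?C)" if "z \<in> ?C" for z
    using pw4[OF that] by (rule has_derivative_at_withinI)
  have inj: "inj_on T ?C"
    unfolding T_def[abs_def]
  proof (rule transport_injective)
    show "\<phi> s < \<phi> t" if "0 < s" "s < t" for s t
    proof (rule DERIV_pos_imp_increasing[OF \<open>s < t\<close>])
      fix x assume "s \<le> x"
      then have "0 < x" using that by simp
      then show "\<exists>y. (\<phi> has_real_derivative y) (at x) \<and> 0 < y" using phi(1,2) by blast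
    qed
    show "continuous_on {0<..} \<phi>"
      by (auto intro!: continuous_at_imp_continuous_on DERIV_isCont[OF phi(1)])
  qed
  have "continuous_on ?C T" using der by (rule has_derivative_continuous_on)
  then have "open (T ` ?C)" using op inj by (rule invariance_of_domain)
  then have TC: "gaussian absolutely_integrable_on (T ` ?C)"
    by (intro set_integrable_subset[OF gaussian_absolutely_integrable(1)]) auto
  have dpos: "exp (LINT u|M. (w u \<bullet> w u) * ln (\<tau> z u)) \<le> det (weighted_frame (\<tau> z))" if "z \<in> ?C" for z
    by (rule det_weighted_frame(1)[OF pw1[OF that] pw2[OF that]])
  have absD: "\<bar>det (weighted_frame (\<tau> z))\<bar> * gaussian (T z) = D z" if "z \<in> ?C" for z
    using less_le_trans[OF exp_gt_zero dpos[OF that]]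
    by (simp add: D_def)
  have Di: "D absolutely_integrable_on ?C" and "integral ?C D = integral (T ` ?C) gaussian"
    using absolutely_integrable_change_of_variables_real[OF C der inj TC]
    by (simp_all add: absD cong: set_integrable_cong integral_cong)
  moreover have "integral (T ` ?C) gaussian \<le> integral UNIV (gaussian :: (real,'m) vec \<Rightarrow> real)"
    by (rule integral_subset_le[OF _ set_lebesgue_integral_eq_integral(1)[OF TC]
          set_lebesgue_integral_eq_integral(1)[OF gaussian_absolutely_integrable(1)]])
      (auto simp: gaussian_pos less_imp_le)
  ultimately have D1: "integral ?C D \<le> 1" by (simp add: gaussian_absolutely_integrable)
  have le: "?E z \<le> exp (- entropy) * D z" if "z \<in> ?C" for z
  proof -
    have "?E z \<le> exp (- entropy) * (exp (LINT u|M. (w u \<bullet> w u) * ln (\<tau> z u)) * gaussian (T z))"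
      by (rule pw3[OF that])
    also have "\<dots> \<le> exp (- entropy) * D z"
      unfolding D_def using dpos[OF that] by (intro mult_left_mono mult_right_mono) (auto simp: gaussian_pos less_imp_le)
    finally show ?thesis .
  qed
  have eDi: "(\<lambda>z. exp (- entropy) * D z) absolutely_integrable_on ?C"
    using Di by (rule set_integrable_mult_right)
  have eDe: "integral ?C (\<lambda>z. exp (- entropy) * D z) = exp (- entropy) * integral ?C D" by simp
  show Ei: "?E absolutely_integrable_on ?C"
  proof (rule measurable_bounded_by_integrable_imp_absolutely_integrable[OF _ C])
    show "?E \<in> borel_measurable (lebesgue_on ?C)"
      by (rule continuous_imp_measurable_on_sets_lebesgue[OF _ C]) (intro continuous_intros)
    show "(\<lambda>z. exp (- entropy) * D z) integrable_on ?C"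
      using eDi by (rule set_lebesgue_integral_eq_integral(1))
    show "norm (?E z) \<le> exp (- entropy) * D z" if "z \<in> ?C" for z using le[OF that] by simp
  qed
  have "integral ?C ?E \<le> integral ?C (\<lambda>z. exp (- entropy) * D z)"
    by (rule integral_le[OF set_lebesgue_integral_eq_integral(1)[OF Ei]
          set_lebesgue_integral_eq_integral(1)[OF eDi] le])
  also have "\<dots> \<le> exp (- entropy)" unfolding eDe using D1 by (simp add: mult_left_le)
  finally show "integral ?C ?E \<le> exp (- entropy)" .
  show "w u \<bullet> w v = 0" if eq: "integral ?C ?E = exp (- entropy)" and uv: "u \<in> space M" "v \<in> space M"
    and cw: "c u * norm (w u) = c v * norm (w v)" "c u *\<^sub>R w u \<noteq> c v *\<^sub>R w v"
  proof -
    let ?r = "\<lambda>z. exp (- entropy) * D z - ?E z"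
    have ri: "?r absolutely_integrable_on ?C" by (rule set_integral_diff(1)[OF eDi Ei])
    have "integral ?C ?r = exp (- entropy) * integral ?C D - exp (- entropy)"
      using integral_diff[OF set_lebesgue_integral_eq_integral(1)[OF eDi]
          set_lebesgue_integral_eq_integral(1)[OF Ei]] eq by simp
    then have "integral ?C ?r \<le> 0" using D1 by simp
    moreover have "0 \<le> integral ?C ?r"
      by (rule integral_nonneg[OF set_lebesgue_integral_eq_integral(1)[OF ri]]) (use le in auto)
    ultimately have r0: "integral ?C ?r = 0" by simp
    have "(LINT z|lebesgue. indicator ?C z *\<^sub>R ?r z) = 0"
      using set_lebesgue_integral_eq_integral(2)[OF ri] r0 by (simp add: set_lebesgue_integral_def)
    then have ae: "AE z in lebesgue. indicator ?C z *\<^sub>R ?r z = 0"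
      using ri le by (subst (asm) integral_nonneg_eq_0_iff_AE) (auto simp: set_integrable_def indicator_def)
    \<comment> \<open>the normal of the hyperplane on which the arguments of \<open>\<phi>\<close> at \<open>u\<close> and \<open>v\<close> coincide\<close>
    let ?n = "c u *\<^sub>R w u - c v *\<^sub>R w v"
    have "negligible {z. ?n \<bullet> z = 0}" using cw by (intro negligible_hyperplane) simp
    then have ae2: "AE z in lebesgue. ?n \<bullet> z \<noteq> 0"
      by (simp add: negligible_iff_null_sets AE_iff_null_sets)
    have "\<exists>z\<in>?C. ?r z = 0 \<and> ?n \<bullet> z \<noteq> 0"
    proof (rule ccontr)
      assume no: "\<not> ?thesis"
      have "AE z in lebesgue. z \<notin> ?C"
        using ae ae2 by eventually_elim (use no in \<open>auto simp: indicator_def split: if_splits\<close>)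
      then have "negligible ?C" by (simp add: negligible_iff_null_sets AE_iff_null_sets C)
      then have "?C = {}" using open_not_negligible[OF op] by blast
      then show False using eq by simp
    qed
    then obtain z where z: "z \<in> ?C" "?r z = 0" "?n \<bullet> z \<noteq> 0" by blast
    let ?I = "exp (LINT u|M. (w u \<bullet> w u) * ln (\<tau> z u))"
    have "exp (- entropy) * D z \<le> exp (- entropy) * (?I * gaussian (T z))"
      using pw3[OF z(1)] z(2) by simp
    then have "D z \<le> ?I * gaussian (T z)" by simp
    then have "det (weighted_frame (\<tau> z)) \<le> ?I" unfolding D_def by (simp add: gaussian_pos)
    then have det_eq: "?I = det (weighted_frame (\<tau> z))" using dpos[OF z(1)] by simp
    have pos: "0 < c u * (w u \<bullet> z)" "0 < c v * (w v \<bullet> z)"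
      using z(1) uv c_pos by (auto simp: positivity_cone_def)
    have "c u * (w u \<bullet> z) \<noteq> c v * (w v \<bullet> z)" using z(3) by (simp add: inner_diff_left)
    then have "\<phi>' (c u * (w u \<bullet> z)) \<noteq> \<phi>' (c v * (w v \<bullet> z))"
      using anti[OF pos(1), of "c v * (w v \<bullet> z)"] anti[OF pos(2), of "c u * (w u \<bullet> z)"] by linarith
    then have "\<tau> z u \<noteq> \<tau> z v"
      using cw(1) c_pos[OF uv(2)] w_nonzero[OF uv(2)] by (simp add: \<tau>_def)
    from det_weighted_frame(2)[OF pw1[OF z(1)] pw2[OF z(1)] det_eq uv this] show ?thesis .
  qed
qed

end

section \<open>One more coordinate\<close>

text \<open>A well-ordered index type with one more element than \<open>'n\<close>, for the coordinates of the lifted vectors.\<close>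

typedef 'n succ = "{..CARD('n::finite)}" by auto

setup_lifting type_definition_succ

instantiation succ :: (finite) linorder
begin
lift_definition less_eq_succ :: "'a succ \<Rightarrow> 'a succ \<Rightarrow> bool" is "(\<le>)" .
lift_definition less_succ :: "'a succ \<Rightarrow> 'a succ \<Rightarrow> bool" is "(<)" .
instance by standard (transfer; auto)+
end

lemma bij_betw_Rep_succ: "bij_betw Rep_succ (UNIV :: 'n::finite succ set) {..CARD('n)}"
  using type_definition.Rep_range[OF type_definition_succ] Rep_succ_inject
  by (auto simp: bij_betw_def inj_on_def)

instance succ :: (finite) finite
  by standard (use bij_betw_finite[OF bij_betw_Rep_succ] in simp)

instance succ :: (finite) wellorder
proof -
  have "wf {(x :: 'a succ, y). x < y}"
    by (rule wf_subset[OF wf_measure[of Rep_succ]]) (auto simp: less_succ.rep_eq)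
  then show "OFCLASS('a succ, wellorder_class)"
    by (rule wf_wellorderI) intro_classes
qed

lemma card_succ: "CARD('n::finite succ) = CARD('n) + 1"
  using bij_betw_same_card[OF bij_betw_Rep_succ[where 'n='n]] by simp

text \<open>Any bijection between the standard bases identifies two Euclidean spaces of equal dimension,
including their Lebesgue measures. It is used to pass from pairs \<open>(x, t)\<close> to vectors with \<open>n + 1\<close>
coordinates.\<close>

definition basis_bij :: "'a::euclidean_space \<Rightarrow> 'b::euclidean_space" where
  "basis_bij = (SOME \<beta>. bij_betw \<beta> Basis Basis)"

definition basis_iso :: "'a::euclidean_space \<Rightarrow> 'b::euclidean_space" where
  "basis_iso x = (\<Sum>b\<in>Basis. (x \<bullet> b) *\<^sub>R basis_bij b)"

lemma basis_bij:
  assumes "DIM('a::euclidean_space) = DIM('b::euclidean_space)"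
  shows "bij_betw (basis_bij :: 'a \<Rightarrow> 'b) Basis Basis"
proof -
  have "\<exists>\<beta> :: 'a \<Rightarrow> 'b. bij_betw \<beta> Basis Basis"
    by (rule finite_same_card_bij) (use assms in auto)
  then show ?thesis unfolding basis_bij_def by (rule someI_ex)
qed

lemma linear_basis_iso: "linear basis_iso"
  by (rule linearI) (simp_all add: basis_iso_def inner_add_left scaleR_add_left sum.distrib scaleR_sum_right)

lemma basis_iso_inner_basis:
  assumes D: "DIM('a::euclidean_space) = DIM('b::euclidean_space)" and b: "b \<in> Basis"
  shows "(basis_iso (x::'a) :: 'b) \<bullet> basis_bij b = x \<bullet> b"
proof -
  note bij = basis_bij[OF D]
  have "(basis_iso x :: 'b) \<bullet> basis_bij b = (\<Sum>b'\<in>Basis. (x \<bullet> b') * (basis_bij b' \<bullet> (basis_bij b :: 'b)))"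
    by (simp add: basis_iso_def inner_sum_left)
  also have "\<dots> = (\<Sum>b'\<in>Basis. if b' = b then x \<bullet> b' else 0)"
  proof (intro sum.cong refl)
    fix b' :: 'a assume b': "b' \<in> Basis"
    then have "basis_bij b' = (basis_bij b :: 'b) \<longleftrightarrow> b' = b"
      using bij b by (auto simp: bij_betw_def inj_on_eq_iff)
    moreover have "(basis_bij b :: 'b) \<in> Basis" "(basis_bij b' :: 'b) \<in> Basis"
      using bij b b' by (auto simp: bij_betw_def)
    ultimately show "(x \<bullet> b') * (basis_bij b' \<bullet> (basis_bij b :: 'b)) = (if b' = b then x \<bullet> b' else 0)"
      by (simp add: inner_Basis)
  qed
  also have "\<dots> = x \<bullet> b" using b by simp
  finally show ?thesis .
qed

lemma basis_iso_inner:
  assumes D: "DIM('a::euclidean_space) = DIM('b::euclidean_space)"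
  shows "(basis_iso x :: 'b) \<bullet> basis_iso y = (x::'a) \<bullet> y"
proof -
  have "(basis_iso x :: 'b) \<bullet> basis_iso y = (\<Sum>b\<in>Basis. (x \<bullet> b) * (basis_bij b \<bullet> (basis_iso y :: 'b)))"
    by (subst basis_iso_def) (simp add: inner_sum_left)
  also have "\<dots> = (\<Sum>b\<in>Basis. (x \<bullet> b) * (y \<bullet> b))"
    by (intro sum.cong refl) (simp add: inner_commute[of "basis_bij _"] basis_iso_inner_basis[OF D])
  finally show ?thesis by (simp add: euclidean_inner[of x y])
qed

lemma surj_basis_iso:
  assumes D: "DIM('a::euclidean_space) = DIM('b::euclidean_space)"
  shows "surj (basis_iso :: 'a \<Rightarrow> 'b)"
proof (rule surjI)
  fix y :: 'b
  note bij = basis_bij[OF D]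
  have "basis_iso (\<Sum>b\<in>Basis. (y \<bullet> basis_bij b) *\<^sub>R (b :: 'a)) = (\<Sum>b\<in>(Basis :: 'a set). (y \<bullet> basis_bij b) *\<^sub>R basis_bij b)"
    by (simp add: basis_iso_def)
  also have "\<dots> = (\<Sum>b\<in>Basis. (y \<bullet> b) *\<^sub>R b)" by (rule sum.reindex_bij_betw[OF bij])
  also have "\<dots> = y" by (rule euclidean_representation)
  finally show "basis_iso (\<Sum>b\<in>Basis. (y \<bullet> basis_bij b) *\<^sub>R (b :: 'a)) = y" .
qed

lemma distr_basis_iso:
  assumes D: "DIM('a::euclidean_space) = DIM('b::euclidean_space)"
  shows "distr lborel borel (basis_iso :: 'a \<Rightarrow> 'b) = lborel"
proof (rule lborel_eqI[symmetric])
  note bij = basis_bij[OF D]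
  have meas: "(basis_iso :: 'a \<Rightarrow> 'b) \<in> borel_measurable lborel"
    using borel_measurable_continuous_onI[OF linear_continuous_on[OF linear_conv_bounded_linear[THEN iffD1, OF linear_basis_iso]]]
    by simp
  fix l u :: 'b assume lu: "\<And>b. b \<in> Basis \<Longrightarrow> l \<bullet> b \<le> u \<bullet> b"
  define pull :: "'b \<Rightarrow> 'a" where "pull y = (\<Sum>b\<in>Basis. (y \<bullet> basis_bij b) *\<^sub>R b)" for y
  have pull: "pull y \<bullet> b = y \<bullet> basis_bij b" if "b \<in> Basis" for y b
    using that by (simp add: pull_def)
  have B: "(Basis :: 'b set) = basis_bij ` (Basis :: 'a set)" using bij by (simp add: bij_betw_def)
  have ball: "(\<forall>b\<in>Basis. P b) \<longleftrightarrow> (\<forall>b\<in>(Basis :: 'a set). P (basis_bij b :: 'b))" for P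
    unfolding B by blast
  have pre: "basis_iso -` box l u = box (pull l) (pull u)"
    by (auto simp: mem_box ball pull basis_iso_inner_basis[OF D])
  have "emeasure (distr lborel borel (basis_iso :: 'a \<Rightarrow> 'b)) (box l u) = emeasure lborel (box (pull l) (pull u))"
    using meas by (subst emeasure_distr) (auto simp: pre)
  also have "\<dots> = (\<Prod>b\<in>Basis. (pull u - pull l) \<bullet> b)"
    using bij lu by (intro emeasure_lborel_box) (auto simp: pull bij_betw_def)
  also have "(\<Prod>b\<in>Basis. (pull u - pull l) \<bullet> b) = (\<Prod>b\<in>(Basis :: 'a set). (u - l) \<bullet> basis_bij b)"
    by (intro prod.cong refl) (simp add: inner_diff_left pull)
  also have "\<dots> = (\<Prod>b\<in>Basis. (u - l) \<bullet> b)" by (rule prod.reindex_bij_betw[OF bij])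
  finally show "emeasure (distr lborel borel (basis_iso :: 'a \<Rightarrow> 'b)) (box l u) = (\<Prod>b\<in>Basis. (u - l) \<bullet> b)" .
qed simp

lemma nn_integral_power_exp:
  assumes a: "0 < a" and L: "0 < (L::real)"
  shows "(\<integral>\<^sup>+t. ennreal ((t / L) ^ n * exp (- (t / L * a))) * indicator {0<..} t \<partial>lborel)
    = ennreal (L * fact n / a ^ (n + 1))"
proof -
  have "(\<integral>\<^sup>+t. ennreal ((t / L) ^ n * exp (- (t / L * a))) * indicator {0<..} t \<partial>lborel)
    = \<bar>L / a\<bar> * (\<integral>\<^sup>+s. ennreal (((0 + L / a * s) / L) ^ n * exp (- ((0 + L / a * s) / L * a))) * indicator {0<..} (0 + L / a * s) \<partial>lborel)"
    by (rule nn_integral_real_affine) (use a L in auto)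
  also have "(\<integral>\<^sup>+s. ennreal (((0 + L / a * s) / L) ^ n * exp (- ((0 + L / a * s) / L * a))) * indicator {0<..} (0 + L / a * s) \<partial>lborel)
     = (\<integral>\<^sup>+s. ennreal (1 / a ^ n) * (ennreal (s ^ n * exp (- s)) * indicator {0..} s) \<partial>lborel)"
  proof (rule nn_integral_cong_AE)
    have "AE s in lborel. s \<noteq> (0::real)" by (rule AE_lborel_singleton)
    then show "AE s in lborel. ennreal (((0 + L / a * s) / L) ^ n * exp (- ((0 + L / a * s) / L * a))) * indicator {0<..} (0 + L / a * s)
      = ennreal (1 / a ^ n) * (ennreal (s ^ n * exp (- s)) * indicator {0..} s)"
    proof eventually_elim
      case (elim s)
      show ?case
      proof (cases "s > 0")
        case True
        then have "0 < L / a * s" using a L by simp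
        then show ?thesis using True a L
          by (simp add: ennreal_mult[symmetric] power_divide power_mult_distrib mult.assoc)
      next
        case False
        then have "s < 0" using elim by simp
        then have "L / a * s < 0" using a L by (intro mult_pos_neg) auto
        then show ?thesis using \<open>s < 0\<close> by (simp add: indicator_def)
      qed
    qed
  qed
  also have "\<dots> = ennreal (1 / a ^ n) * ennreal (fact n)"
    by (subst nn_integral_cmult) (auto simp: nn_intergal_power_times_exp_Ici)
  finally show ?thesis using a L by (simp add: ennreal_mult[symmetric] mult_ac)
qed

text \<open>The substitution \<open>x = (t / L) *\<^sub>R y\<close> at each height \<open>t\<close> and Tonelli's theorem reduce the integral to a
Gamma integral along the ray through each point \<open>y\<close> of the base.\<close>

lemma nn_integral_cone:
  fixes W :: "'a::euclidean_space set"
  assumes W: "W \<in> sets borel" and L: "0 < (L::real)" and pos: "\<And>y. y \<in> W \<Longrightarrow> p \<bullet> y < N"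
    and S: "{(x, t). 0 < t \<and> (L / t) *\<^sub>R x \<in> W} \<in> sets borel"
  shows "(\<integral>\<^sup>+z. ennreal (exp (p \<bullet> fst z - N * snd z / L)) * indicator {(x, t). 0 < t \<and> (L / t) *\<^sub>R x \<in> W} z \<partial>lborel)
    = (\<integral>\<^sup>+y. ennreal (L * fact DIM('a) / (N - p \<bullet> y) ^ (DIM('a) + 1)) * indicator W y \<partial>lborel)"
proof -
  let ?S = "{(x, t). 0 < t \<and> (L / t) *\<^sub>R x \<in> W}" and ?n = "DIM('a)"
  let ?g = "\<lambda>x t. ennreal (exp (p \<bullet> x - N * t / L)) * indicator ?S (x, t)"
  let ?h = "\<lambda>y t. ennreal ((t / L) ^ ?n * exp (- (t / L * (N - p \<bullet> y)))) * indicator {0<..} t * indicator W y"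
  have m0: "(\<lambda>z :: 'a \<times> real. exp (p \<bullet> fst z - N * snd z / L)) \<in> borel_measurable borel"
    by (intro borel_measurable_continuous_onI continuous_intros) (use L in auto)
  have m1: "(\<lambda>(x, t). ?g x t) \<in> borel_measurable (lborel \<Otimes>\<^sub>M lborel)"
    unfolding lborel_prod case_prod_beta
    using S m0 by (auto simp: case_prod_unfold intro!: borel_measurable_times_ennreal borel_measurable_indicator)
  have m2: "(\<lambda>(y, t). ?h y t) \<in> borel_measurable (lborel \<Otimes>\<^sub>M lborel)"
    using W by measurable
  have inner: "(\<integral>\<^sup>+x. ?g x t \<partial>lborel) = (\<integral>\<^sup>+y. ?h y t \<partial>lborel)" for t
  proof (cases "0 < t")
    case True
    let ?c = "t / L"
    have c: "0 < ?c" using True L by simp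
    have mt: "(\<lambda>x. ?g x t) \<in> borel_measurable borel"
      using measurable_Pair1[OF m1, of t] by simp
    have "(\<integral>\<^sup>+x. ?g x t \<partial>lborel)
      = (\<integral>\<^sup>+x. ?g x t \<partial>(density (distr lborel borel (\<lambda>x. 0 + ?c *\<^sub>R x)) (\<lambda>_. \<bar>?c\<bar> ^ ?n)))"
      using c by (subst lborel_affine[of ?c 0, symmetric]) auto
    also have "\<dots> = (\<integral>\<^sup>+y. \<bar>?c\<bar> ^ ?n * ?g (?c *\<^sub>R y) t \<partial>lborel)"
      using mt by (subst nn_integral_density) (auto simp: nn_integral_distr)
    also have "\<dots> = (\<integral>\<^sup>+y. ?h y t \<partial>lborel)"
    proof (rule nn_integral_cong)
      fix y :: 'a
      have "(L / t) *\<^sub>R ?c *\<^sub>R y = y" using True L by simp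
      then have "indicator ?S (?c *\<^sub>R y, t) = (indicator {0<..} t * indicator W y :: ennreal)"
        using True by (auto simp: indicator_def)
      moreover have "p \<bullet> (?c *\<^sub>R y) - N * t / L = - (?c * (N - p \<bullet> y))"
        by (simp add: right_diff_distrib diff_divide_distrib mult.commute)
      ultimately show "\<bar>?c\<bar> ^ ?n * ?g (?c *\<^sub>R y) t = ?h y t"
        using True L by (simp add: ennreal_mult mult.assoc)
    qed
    finally show ?thesis .
  qed simp
  have "(\<integral>\<^sup>+z. ennreal (exp (p \<bullet> fst z - N * snd z / L)) * indicator ?S z \<partial>lborel)
     = (\<integral>\<^sup>+z. (\<lambda>(x, t). ?g x t) z \<partial>(lborel \<Otimes>\<^sub>M lborel))"
    unfolding lborel_prod by (intro nn_integral_cong) (simp add: case_prod_beta)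
  also have "\<dots> = (\<integral>\<^sup>+t. (\<integral>\<^sup>+x. ?g x t \<partial>lborel) \<partial>lborel)"
    by (rule lborel_pair.nn_integral_snd[OF m1, symmetric, simplified])
  also have "\<dots> = (\<integral>\<^sup>+t. (\<integral>\<^sup>+y. ?h y t \<partial>lborel) \<partial>lborel)" by (simp only: inner)
  also have "\<dots> = (\<integral>\<^sup>+y. (\<integral>\<^sup>+t. ?h y t \<partial>lborel) \<partial>lborel)"
    by (rule lborel_pair.Fubini'[OF m2])
  also have "\<dots> = (\<integral>\<^sup>+y. ennreal (L * fact ?n / (N - p \<bullet> y) ^ (?n + 1)) * indicator W y \<partial>lborel)"
  proof (rule nn_integral_cong)
    fix y
    show "(\<integral>\<^sup>+t. ?h y t \<partial>lborel) = ennreal (L * fact ?n / (N - p \<bullet> y) ^ (?n + 1)) * indicator W y"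
    proof (cases "y \<in> W")
      case True
      then show ?thesis using nn_integral_power_exp[OF _ L, of "N - p \<bullet> y" ?n] pos[OF True] by simp
    qed simp
  qed
  finally show ?thesis .
qed

section \<open>Wulff shapes and their cones\<close>

text \<open>The data of the theorem after restriction to the support, which is now the whole space of \<open>M\<close>.\<close>

locale wulff_system = compact_full_measure M for M :: "(real^'n) measure" +
  fixes f :: "real^'n \<Rightarrow> real"
  assumes unit: "\<And>u. u \<in> space M \<Longrightarrow> norm u = 1"
    and f: "continuous_on (space M) f" and f_pos: "\<And>u. u \<in> space M \<Longrightarrow> 0 < f u"
    and iso: "\<And>x y. (LINT u|M. (u \<bullet> x) * (u \<bullet> y)) = x \<bullet> y"
    and centered: "(LINT u|M. f u *\<^sub>R u) = 0"
begin

definition L :: real where "L = sqrt (LINT u|M. (f u)\<^sup>2)"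
definition p where "p = (LINT u|M. (1 / f u) *\<^sub>R u)"
definition W where "W = {x. \<forall>u\<in>space M. x \<bullet> u \<le> f u}"
text \<open>The variant of \<open>W\<close> with strict inequalities; it is the set over which the open positivity cone stands.\<close>

definition W' where "W' = {x. \<forall>u\<in>space M. x \<bullet> u < f u}"
definition lift :: "(real, 'n) vec \<Rightarrow> (real, 'n succ) vec" where
  "lift u = basis_iso (- u, f u / L)"

lemma DIM_lift: "DIM((real, 'n) vec \<times> real) = DIM((real, 'n succ) vec)"
  by (simp add: card_succ)

lemma cont_id: "continuous_on (space M) (\<lambda>u. u)" by (rule continuous_on_id)

lemma total_mass: "(LINT u|M. 1) = real CARD('n)"
proof -
  have "(LINT u|M. 1) = (LINT u|M. u \<bullet> u)"
    using unit by (intro Bochner_Integration.integral_cong) (auto simp: norm_eq_1)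
  also have "\<dots> = (LINT u|M. (\<Sum>b\<in>Basis. (u \<bullet> b) * (u \<bullet> b)))"
    by (subst euclidean_inner) simp
  also have "\<dots> = (\<Sum>b\<in>Basis. LINT u|M. (u \<bullet> b) * (u \<bullet> b))"
    by (intro Bochner_Integration.integral_sum integrable_continuous continuous_intros)
  also have "\<dots> = (\<Sum>b\<in>(Basis::(real^'n) set). 1)" by (intro sum.cong refl) (simp add: iso inner_Basis)
  finally show ?thesis by simp
qed

lemma space_nonempty: "space M \<noteq> {}"
  using total_mass by auto

lemma centered_inner: "(LINT u|M. f u * (u \<bullet> x)) = 0"
proof -
  have "(LINT u|M. x \<bullet> (f u *\<^sub>R u)) = x \<bullet> (LINT u|M. f u *\<^sub>R u)"
    by (rule integral_bounded_linear[OF bounded_linear_inner_right])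
      (intro integrable_continuous continuous_intros f)
  then show ?thesis by (simp add: centered inner_commute[of x])
qed

lemma continuous_inverse_f: "continuous_on (space M) (\<lambda>u. 1 / f u)"
  using f_pos by (intro continuous_intros f) force

lemma p_inner: "(LINT u|M. (u \<bullet> x) / f u) = p \<bullet> x"
proof -
  have "(LINT u|M. x \<bullet> ((1 / f u) *\<^sub>R u)) = x \<bullet> p"
    unfolding p_def by (rule integral_bounded_linear[OF bounded_linear_inner_right])
      (intro integrable_continuous continuous_on_scaleR continuous_inverse_f cont_id)
  then show ?thesis by (simp add: inner_commute[of x])
qed

lemma L: "0 < L" and L2: "(LINT u|M. (f u)\<^sup>2) = L\<^sup>2"
proof -
  have c: "continuous_on (space M) (\<lambda>u. (f u)\<^sup>2)" by (intro continuous_intros f)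
  have nn: "0 \<le> (LINT u|M. (f u)\<^sup>2)" by simp
  have "(LINT u|M. (f u)\<^sup>2) \<noteq> 0"
  proof
    assume "(LINT u|M. (f u)\<^sup>2) = 0"
    then have "(f u)\<^sup>2 = 0" if "u \<in> space M" for u
      by (intro integral_zero_imp_zero[OF c _ _ that]) auto
    then show False using space_nonempty f_pos by force
  qed
  with nn have "0 < (LINT u|M. (f u)\<^sup>2)" by (rule le_neq_trans[OF _ not_sym])
  then show "0 < L" "(LINT u|M. (f u)\<^sup>2) = L\<^sup>2" by (simp_all add: L_def)
qed

lemma lift_inner_iso: "lift u \<bullet> basis_iso (a, s) = - (u \<bullet> a) + f u * s / L"
  unfolding lift_def basis_iso_inner[OF DIM_lift] by (simp add: inner_prod_def)

lemma lift_inner: "lift u \<bullet> lift v = u \<bullet> v + f u * f v / L\<^sup>2"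
  unfolding lift_def basis_iso_inner[OF DIM_lift] by (simp add: inner_prod_def power2_eq_square)

lemma lift_sq: "u \<in> space M \<Longrightarrow> lift u \<bullet> lift u = 1 + (f u)\<^sup>2 / L\<^sup>2"
  using unit[of u] by (simp add: lift_inner norm_eq_1 power2_eq_square)

lemma lift_preimage: "\<exists>(a :: (real, 'n) vec) (s :: real). x = (basis_iso (a, s) :: (real, 'n succ) vec)"
proof -
  obtain z where "x = basis_iso (z :: (real, 'n) vec \<times> real)" using surjD[OF surj_basis_iso[OF DIM_lift]] by blast
  then have "x = basis_iso (fst z, snd z)" by simp
  then show ?thesis by blast
qed

text \<open>The mixed terms in the expansion of the product are multiples of \<open>\<integral> f u * (u \<bullet> a)\<close> and vanish because
\<open>\<nu>\<close> is centered; the last coordinates contribute \<open>\<integral> (f u / L)\<^sup>2 = 1\<close>.\<close>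

lemma lift_iso: "(LINT u|M. (lift u \<bullet> x) * (lift u \<bullet> y)) = x \<bullet> y"
proof -
  obtain a :: "(real, 'n) vec" and s :: real where x: "x = basis_iso (a, s)" using lift_preimage by blast
  obtain b :: "(real, 'n) vec" and t :: real where y: "y = basis_iso (b, t)" using lift_preimage by blast
  have "(LINT u|M. (lift u \<bullet> x) * (lift u \<bullet> y))
    = (LINT u|M. (u \<bullet> a) * (u \<bullet> b) - (f u * (u \<bullet> a)) * (t / L) - (f u * (u \<bullet> b)) * (s / L) + (f u)\<^sup>2 * (s * t / L\<^sup>2))"
    unfolding x y lift_inner_iso
    by (intro Bochner_Integration.integral_cong refl) (simp add: algebra_simps power2_eq_square)
  also have "\<dots> = (LINT u|M. (u \<bullet> a) * (u \<bullet> b)) - (LINT u|M. f u * (u \<bullet> a)) * (t / L)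
      - (LINT u|M. f u * (u \<bullet> b)) * (s / L) + (LINT u|M. (f u)\<^sup>2) * (s * t / L\<^sup>2)"
  proof -
    have i: "integrable M (\<lambda>u. (u \<bullet> a) * (u \<bullet> b))" "integrable M (\<lambda>u. f u * (u \<bullet> a))"
       "integrable M (\<lambda>u. f u * (u \<bullet> b))" "integrable M (\<lambda>u. (f u)\<^sup>2)"
      by (intro integrable_continuous continuous_intros f)+
    then show ?thesis by simp
  qed
  also have "\<dots> = a \<bullet> b + s * t" using L by (simp add: iso centered_inner L2)
  also have "\<dots> = x \<bullet> y" unfolding x y basis_iso_inner[OF DIM_lift] by (simp add: inner_prod_def)
  finally show ?thesis .
qed

lemma continuous_lift: "continuous_on (space M) lift"
proof -
  have "continuous_on UNIV (basis_iso :: (real, 'n) vec \<times> real \<Rightarrow> (real, 'n succ) vec)"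
    by (rule linear_continuous_on[OF linear_conv_bounded_linear[THEN iffD1, OF linear_basis_iso]])
  then show ?thesis unfolding lift_def
    by (rule continuous_on_compose2) (use L in \<open>auto intro!: continuous_intros f\<close>)
qed

sublocale lifted: weighted_isotropic_system M lift "\<lambda>u. 1 / f u"
proof unfold_locales
  show "lift u \<noteq> 0" if "u \<in> space M" for u
  proof
    assume "lift u = 0"
    then have "1 + (f u)\<^sup>2 / L\<^sup>2 = 0" using lift_sq[OF that] by simp
    moreover have "0 \<le> (f u)\<^sup>2 / L\<^sup>2" by simp
    ultimately show False by linarith
  qed
qed (auto intro: continuous_lift lift_iso continuous_inverse_f f_pos)

text \<open>The weights \<open>1 / f u\<close> are chosen for this formula: the term \<open>(f u)\<^sup>2 / L\<^sup>2\<close> of \<open>|w u|\<^sup>2\<close> contributes nothing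
to the first component, by centering, and raises the \<open>n\<close> in the last one to \<open>n + 1\<close>.\<close>

lemma exponent_inner: "lifted.exponent \<bullet> basis_iso (x, t) = - (p \<bullet> x) + (real CARD('n) + 1) * t / L"
proof -
  let ?y = "basis_iso (x, t) :: (real, 'n succ) vec"
  have cl: "continuous_on (space M) (\<lambda>u. lift u \<bullet> lift u)" by (intro continuous_intros continuous_lift)
  have "(LINT u|M. ?y \<bullet> ((1 / f u * (lift u \<bullet> lift u)) *\<^sub>R lift u)) = ?y \<bullet> lifted.exponent"
    unfolding lifted.exponent_def by (rule integral_bounded_linear[OF bounded_linear_inner_right])
      (intro integrable_continuous continuous_on_scaleR continuous_on_mult continuous_inverse_f cl continuous_lift)
  then have "lifted.exponent \<bullet> ?y = (LINT u|M. (1 / f u * (lift u \<bullet> lift u)) * (lift u \<bullet> ?y))"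
    by (simp add: inner_commute[of ?y])
  also have "\<dots> = (LINT u|M. - ((u \<bullet> x) / f u) - (f u * (u \<bullet> x)) / L\<^sup>2 + t / L * 1 + (f u)\<^sup>2 * (t / L ^ 3))"
  proof (intro Bochner_Integration.integral_cong refl)
    fix u assume u: "u \<in> space M"
    then show "(1 / f u * (lift u \<bullet> lift u)) * (lift u \<bullet> ?y)
      = - ((u \<bullet> x) / f u) - (f u * (u \<bullet> x)) / L\<^sup>2 + t / L * 1 + (f u)\<^sup>2 * (t / L ^ 3)"
      unfolding lift_sq[OF u] lift_inner_iso using f_pos[OF u] L
      by (simp add: field_simps power2_eq_square power3_eq_cube)
  qed
  also have "\<dots> = - (LINT u|M. (u \<bullet> x) / f u) - (LINT u|M. f u * (u \<bullet> x)) / L\<^sup>2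
      + t / L * (LINT u|M. 1) + (LINT u|M. (f u)\<^sup>2) * (t / L ^ 3)"
  proof -
    have "continuous_on (space M) (\<lambda>u. (u \<bullet> x) / f u)"
      using f_pos by (intro continuous_intros f) force
    then have "integrable M (\<lambda>u. (u \<bullet> x) / f u)" by (rule integrable_continuous)
    moreover have "integrable M (\<lambda>u. f u * (u \<bullet> x))" "integrable M (\<lambda>u. (f u)\<^sup>2)"
      by (intro integrable_continuous continuous_intros f)+
    ultimately show ?thesis by simp
  qed
  also have "\<dots> = - (p \<bullet> x) + (real CARD('n) + 1) * t / L"
    using L unfolding p_inner centered_inner total_mass L2
    by (simp add: field_simps power2_eq_square power3_eq_cube)
  finally show ?thesis .
qed

text \<open>Points of the cone have positive height: at height \<open>t \<le> 0\<close> all products \<open>u \<bullet> x\<close> would be negative,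
against \<open>\<integral> f u * (u \<bullet> x) = 0\<close>.\<close>

lemma mem_cone_iff: "basis_iso (x, t) \<in> lifted.positivity_cone \<longleftrightarrow> 0 < t \<and> (L / t) *\<^sub>R x \<in> W'"
proof -
  have mem: "basis_iso (x, t) \<in> lifted.positivity_cone \<longleftrightarrow> (\<forall>u\<in>space M. u \<bullet> x < f u * t / L)"
    by (simp add: lifted.positivity_cone_def lift_inner_iso)
  show ?thesis
  proof (cases "0 < t")
    case True
    then have "u \<bullet> x < f u * t / L \<longleftrightarrow> ((L / t) *\<^sub>R x) \<bullet> u < f u" for u
      using L by (simp add: field_simps inner_commute[of u])
    then show ?thesis using True by (simp add: mem W'_def)
  next
    case False
    have "\<not> (\<forall>u\<in>space M. u \<bullet> x < f u * t / L)"
    proof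
      assume *: "\<forall>u\<in>space M. u \<bullet> x < f u * t / L"
      have neg: "u \<bullet> x < 0" if "u \<in> space M" for u
      proof -
        have "f u * t / L \<le> 0" using f_pos[OF that] L False by (simp add: divide_le_0_iff mult_le_0_iff)
        then show ?thesis using * that by force
      qed
      have c: "continuous_on (space M) (\<lambda>u. - (f u * (u \<bullet> x)))" by (intro continuous_intros f)
      have i: "(LINT u|M. - (f u * (u \<bullet> x))) = 0" by (simp add: centered_inner)
      obtain u where u: "u \<in> space M" using space_nonempty by blast
      have "- (f u * (u \<bullet> x)) = 0"
        by (rule integral_zero_imp_zero[OF c _ i u]) (use neg f_pos in \<open>auto simp: mult_le_0_iff less_imp_le\<close>)
      then show False using neg[OF u] f_pos[OF u] by simp
    qed
    then show ?thesis using False by (simp add: mem)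
  qed
qed

lemma zero_W': "0 \<in> W'" by (simp add: W'_def f_pos)

lemma W'_subset: "W' \<subseteq> W" by (auto simp: W'_def W_def)

lemma convex_W': "convex W'" and closed_W: "closed W"
proof -
  have eq: "W' = (\<Inter>u\<in>space M. {x. u \<bullet> x < f u})" "W = (\<Inter>u\<in>space M. {x. u \<bullet> x \<le> f u})"
    by (auto simp: W'_def W_def inner_commute)
  show "convex W'" "closed W" unfolding eq
    by (auto intro!: convex_INT convex_halfspace_lt closed_INT closed_halfspace_le)
qed

text \<open>For \<open>x\<close> in \<open>W\<close> the positive parts of \<open>u \<bullet> x\<close> are at most \<open>f u\<close>, and by centering the negative parts
weigh as much as the positive ones. Isotropy recovers \<open>norm x\<close> from the products \<open>u \<bullet> x\<close>.\<close>

lemma W_bounded: "bounded W"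
proof -
  obtain m where m: "m > 0" "\<And>u. u \<in> space M \<Longrightarrow> m \<le> f u"
    using compact_continuous_positive[OF compact_space f f_pos] by blast
  have "norm x \<le> 2 * L\<^sup>2 / m" if x: "x \<in> W" for x
  proof (cases "x = 0")
    case False
    have "(norm x)\<^sup>2 = (LINT u|M. (u \<bullet> x) * (u \<bullet> x))" by (simp add: iso power2_norm_eq_inner)
    also have "\<dots> \<le> (LINT u|M. norm x / m * (2 * (f u)\<^sup>2 - f u * (u \<bullet> x)))"
    proof (rule integral_mono)
      fix u assume u: "u \<in> space M"
      have a: "\<bar>u \<bullet> x\<bar> \<le> norm x" using Cauchy_Schwarz_ineq2[of u x] unit[OF u] by simp
      have b: "u \<bullet> x \<le> f u" using x u by (auto simp: W_def inner_commute)
      have "m * \<bar>u \<bullet> x\<bar> \<le> f u * \<bar>u \<bullet> x\<bar>" using m(2)[OF u] by (rule mult_right_mono) simp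
      also have "\<dots> \<le> f u * (2 * f u - u \<bullet> x)"
        using b f_pos[OF u] by (intro mult_left_mono) auto
      finally have c: "\<bar>u \<bullet> x\<bar> \<le> (2 * (f u)\<^sup>2 - f u * (u \<bullet> x)) / m"
        using m(1) by (simp add: pos_le_divide_eq power2_eq_square algebra_simps)
      have "(u \<bullet> x) * (u \<bullet> x) = \<bar>u \<bullet> x\<bar> * \<bar>u \<bullet> x\<bar>" by simp
      also have "\<dots> \<le> norm x * ((2 * (f u)\<^sup>2 - f u * (u \<bullet> x)) / m)" by (rule mult_mono[OF a c]) auto
      finally show "(u \<bullet> x) * (u \<bullet> x) \<le> norm x / m * (2 * (f u)\<^sup>2 - f u * (u \<bullet> x))" by simp
    qed (intro integrable_continuous continuous_intros f)+
    also have "\<dots> = norm x / m * (2 * (LINT u|M. (f u)\<^sup>2) - (LINT u|M. f u * (u \<bullet> x)))"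
    proof -
      have "integrable M (\<lambda>u. f u * (u \<bullet> x))" "integrable M (\<lambda>u. (f u)\<^sup>2)"
        by (intro integrable_continuous continuous_intros f)+
      then show ?thesis by simp
    qed
    also have "\<dots> = norm x * (2 * L\<^sup>2 / m)" by (simp add: L2 centered_inner)
    finally have "norm x * norm x \<le> norm x * (2 * L\<^sup>2 / m)" by (simp add: power2_eq_square)
    moreover have "0 < norm x" using False by simp
    ultimately show ?thesis by (rule mult_left_le_imp_le)
  qed (use m in simp)
  then show ?thesis unfolding bounded_iff by blast
qed

lemma open_W': "open W'"
proof (rule openI)
  fix x assume x: "x \<in> W'"
  have "0 < f u - x \<bullet> u" if "u \<in> space M" for u using x that by (simp add: W'_def)
  then obtain m where m: "m > 0" "\<And>u. u \<in> space M \<Longrightarrow> m \<le> f u - x \<bullet> u"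
    using compact_continuous_positive[OF compact_space, of "\<lambda>u. f u - x \<bullet> u"]
      continuous_on_diff[OF f continuous_on_inner[OF continuous_on_const cont_id]] by blast
  have "y \<in> W'" if "dist x y < m" for y
    unfolding W'_def
  proof safe
    fix u assume u: "u \<in> space M"
    have "\<bar>(y - x) \<bullet> u\<bar> \<le> norm (y - x)" using Cauchy_Schwarz_ineq2[of "y - x" u] unit[OF u] by simp
    then have "(y - x) \<bullet> u < m" using that by (simp add: dist_norm norm_minus_commute)
    then show "y \<bullet> u < f u" using m(2)[OF u] by (simp add: inner_diff_left)
  qed
  then show "\<exists>e>0. ball x e \<subseteq> W'" using m(1) by (intro exI[of _ m]) auto
qed

text \<open>Shrinking towards the origin makes all inequalities strict, since \<open>f\<close> is positive.\<close>

lemma W_closure: "W \<subseteq> closure W'"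
proof
  fix x assume x: "x \<in> W"
  have "(1 - 1 / real (Suc k)) *\<^sub>R x \<in> W'" for k
    unfolding W'_def
  proof safe
    fix u assume u: "u \<in> space M"
    let ?t = "1 - 1 / real (Suc k)"
    have t: "0 \<le> ?t" "?t < 1" by auto
    have "?t * (x \<bullet> u) \<le> ?t * f u" using x u t by (intro mult_left_mono) (auto simp: W_def)
    also have "\<dots> < f u" using t f_pos[OF u] by simp
    finally show "(?t *\<^sub>R x) \<bullet> u < f u" by simp
  qed
  moreover have "(\<lambda>k. (1 - 1 / real (Suc k)) *\<^sub>R x) \<longlonglongrightarrow> (1 - 0) *\<^sub>R x"
    by (intro tendsto_intros LIMSEQ_Suc[OF lim_1_over_n])
  ultimately show "x \<in> closure W'" unfolding closure_sequential
    by (intro exI[of _ "\<lambda>k. (1 - 1 / real (Suc k)) *\<^sub>R x"]) simp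
qed

lemma AE_W: "AE x in lborel. x \<in> W \<longleftrightarrow> x \<in> W'"
proof -
  have "negligible (frontier W')" by (rule negligible_convex_frontier[OF convex_W'])
  then have "frontier W' \<in> null_sets lborel"
    by (simp add: negligible_iff_null_sets null_sets_completion_iff)
  then have "AE x in lborel. x \<notin> frontier W'" by (rule AE_not_in)
  then show ?thesis
    by eventually_elim (use W_closure W'_subset open_W' in \<open>auto simp: frontier_def interior_open\<close>)
qed

lemma measurable_W: "W \<in> sets borel" "emeasure lborel W < \<infinity>" "0 < measure lborel W"
proof -
  have c: "compact W" using W_bounded closed_W by (simp add: compact_eq_bounded_closed)
  then show "W \<in> sets borel" by (rule borel_compact)
  show fin: "emeasure lborel W < \<infinity>" using emeasure_bounded_finite[OF W_bounded] by simp
  have "emeasure lborel W' \<noteq> 0"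
  proof
    assume "emeasure lborel W' = 0"
    then have "W' \<in> null_sets lborel" using open_W' by (intro null_setsI) auto
    then have "negligible W'" using open_W' by (simp add: negligible_iff_null_sets null_sets_completionI)
    then show False using open_not_negligible[OF open_W'] zero_W' by blast
  qed
  moreover have "emeasure lborel W' \<le> emeasure lborel W"
    using W'_subset c by (intro emeasure_mono) (auto simp: borel_compact)
  ultimately have "0 < emeasure lborel W" by (metis le_zero_eq zero_less_iff_neq_zero)
  then show "0 < measure lborel W" using fin
    by (simp add: measure_def enn2real_positive_iff)
qed

end

section \<open>Volume, centroid and the cone integral\<close>

text \<open>The tangent at \<open>b\<close> to the convex function \<open>1 / a ^ k\<close>; it follows from Bernoulli's inequality for \<open>b / a\<close>.\<close>

lemma inverse_power_tangent:
  fixes a b :: real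
  assumes a: "0 < a" and b: "0 < b"
  shows "1 / b ^ k - k * (a - b) / b ^ (k + 1) \<le> 1 / a ^ k"
proof -
  have "0 \<le> (a - b)\<^sup>2 / (a * b)" using a b by simp
  also have "(a - b)\<^sup>2 / (a * b) = (b / a - 1) - (1 - a / b)"
    using a b by (simp add: power2_eq_square field_simps)
  finally have s: "1 - a / b \<le> b / a - 1" by simp
  have "1 + real k * (1 - a / b) \<le> 1 + real k * (b / a - 1)" using s by (intro add_left_mono mult_left_mono) auto
  also have "\<dots> \<le> (1 + (b / a - 1)) ^ k"
    by (rule Bernoulli_inequality) (use a b in \<open>simp add: less_imp_le\<close>)
  also have "\<dots> = b ^ k / a ^ k" by (simp add: power_divide)
  finally have "(1 + real k * (1 - a / b)) / b ^ k \<le> (b ^ k / a ^ k) / b ^ k"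
    using b by (intro divide_right_mono) auto
  then show ?thesis using a b by (simp add: field_simps)
qed

context wulff_system begin

definition cone_integral :: real where
  "cone_integral = integral lifted.positivity_cone (\<lambda>z. exp (- (lifted.exponent \<bullet> z)))"

text \<open>In particular the displacement is at most \<open>n\<close>, so all denominators \<open>n + 1 - p \<bullet> y\<close> are at least 1.\<close>

lemma p_W: "y \<in> W \<Longrightarrow> p \<bullet> y \<le> CARD('n)"
proof -
  assume y: "y \<in> W"
  have c: "continuous_on (space M) (\<lambda>u. (u \<bullet> y) / f u)"
    using f_pos by (intro continuous_intros f) force
  have "(LINT u|M. (u \<bullet> y) / f u) \<le> (LINT u|M. 1)"
  proof (rule integral_mono[OF integrable_continuous[OF c]])
    fix u assume u: "u \<in> space M"
    then show "(u \<bullet> y) / f u \<le> 1"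
      using y f_pos[OF u] by (auto simp: W_def inner_commute)
  qed simp
  then show ?thesis by (simp only: p_inner total_mass)
qed

lemma nn_integral_cone_integral:
  "ennreal cone_integral = (\<integral>\<^sup>+y. ennreal (L * fact CARD('n) / (real CARD('n) + 1 - p \<bullet> y) ^ (CARD('n) + 1)) * indicator W y \<partial>lborel)"
proof -
  let ?C = "lifted.positivity_cone" and ?E = "\<lambda>z. exp (- (lifted.exponent \<bullet> z))"
  let ?N = "real CARD('n) + 1"
  let ?S = "{(x, t). 0 < t \<and> (L / t) *\<^sub>R x \<in> W'}"
  let ?J = "basis_iso :: (real, 'n) vec \<times> real \<Rightarrow> (real, 'n succ) vec"
  have J: "?J \<in> borel_measurable borel"
    by (intro borel_measurable_continuous_onI linear_continuous_on
      linear_conv_bounded_linear[THEN iffD1, OF linear_basis_iso])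
  have C: "?C \<in> sets borel" using lifted.open_positivity_cone by simp
  have S: "?S = ?J -` ?C" by (auto simp: mem_cone_iff)
  have Sb: "?S \<in> sets borel" unfolding S using measurable_sets[OF J C] by simp
  have "(?E has_integral cone_integral) ?C"
    unfolding cone_integral_def
    by (intro integrable_integral set_lebesgue_integral_eq_integral(1)[OF lifted.brascamp_lieb_cone(1)])
  then have "ennreal cone_integral = (\<integral>\<^sup>+z. ennreal (indicator ?C z * ?E z) \<partial>lborel)"
    by (subst nn_integral_has_integral_lebesgue) auto
  also have "\<dots> = (\<integral>\<^sup>+z. ennreal (indicator ?C z * ?E z) \<partial>distr lborel borel ?J)"
    by (simp only: distr_basis_iso[OF DIM_lift])
  also have "\<dots> = (\<integral>\<^sup>+z. ennreal (indicator ?C (?J z) * ?E (?J z)) \<partial>lborel)"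
  proof (rule nn_integral_distr)
    have "?E \<in> borel_measurable borel" by (intro borel_measurable_continuous_onI continuous_intros)
    then show "(\<lambda>z. ennreal (indicator ?C z * ?E z)) \<in> borel_measurable (distr lborel borel ?J)"
      using C by simp
  qed (use J in simp)
  also have "\<dots> = (\<integral>\<^sup>+z. ennreal (exp (p \<bullet> fst z - ?N * snd z / L)) * indicator ?S z \<partial>lborel)"
  proof (rule nn_integral_cong)
    fix z :: "(real, 'n) vec \<times> real"
    obtain x t where z: "z = (x, t)" by (cases z)
    show "ennreal (indicator ?C (?J z) * ?E (?J z)) = ennreal (exp (p \<bullet> fst z - ?N * snd z / L)) * indicator ?S z"
      unfolding z exponent_inner by (auto simp: indicator_def mem_cone_iff)
  qed
  also have "\<dots> = (\<integral>\<^sup>+y. ennreal (L * fact DIM((real, 'n) vec) / (?N - p \<bullet> y) ^ (DIM((real, 'n) vec) + 1)) * indicator W' y \<partial>lborel)"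
  proof (rule nn_integral_cone[OF _ L _ Sb])
    show "p \<bullet> y < ?N" if "y \<in> W'" for y using p_W[of y] that W'_subset by auto
  qed (simp add: open_W')
  also have "\<dots> = (\<integral>\<^sup>+y. ennreal (L * fact CARD('n) / (?N - p \<bullet> y) ^ (CARD('n) + 1)) * indicator W y \<partial>lborel)"
    using AE_W by (intro nn_integral_cong_AE) (auto simp: indicator_def elim!: eventually_mono)
  finally show ?thesis .
qed

lemma compact_W: "compact W"
  using W_bounded closed_W by (simp add: compact_eq_bounded_closed)

lemma centroid_inner: "(LINT x:W|lborel. p \<bullet> x) = measure lborel W * (centroid W \<bullet> p)"
  and centroid_le: "centroid W \<bullet> p \<le> CARD('n)"
proof -
  let ?V = "measure lborel W"
  have i: "integrable lborel (\<lambda>x. indicator W x *\<^sub>R x)"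
    by (rule borel_integrable_compact[OF compact_W]) (rule continuous_on_id)
  have "(LINT x|lborel. p \<bullet> (indicator W x *\<^sub>R x)) = p \<bullet> (LINT x|lborel. indicator W x *\<^sub>R x)"
    by (rule integral_bounded_linear[OF bounded_linear_inner_right i])
  then show eq: "(LINT x:W|lborel. p \<bullet> x) = ?V * (centroid W \<bullet> p)"
    using measurable_W(3) by (simp add: centroid_def set_lebesgue_integral_def inner_commute[of p])
  have i2: "integrable lborel (\<lambda>x. indicator W x *\<^sub>R (p \<bullet> x))"
    by (rule borel_integrable_compact[OF compact_W]) (intro continuous_intros)
  have "(LINT x:W|lborel. p \<bullet> x) \<le> (LINT x|lborel. indicator W x * real CARD('n))"
    unfolding set_lebesgue_integral_def
  proof (rule integral_mono[OF i2])
    show "integrable lborel (\<lambda>x. indicator W x * real CARD('n))"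
      using measurable_W by (intro integrable_mult_left integrable_real_indicator) auto
    show "indicator W x *\<^sub>R (p \<bullet> x) \<le> indicator W x * real CARD('n)" for x
      using p_W[of x] by (auto simp: indicator_def)
  qed
  also have "\<dots> = ?V * CARD('n)" using measurable_W by simp
  finally show "centroid W \<bullet> p \<le> CARD('n)" unfolding eq using measurable_W(3) by simp
qed

lemma cone_integral_eq_set_integral:
  "cone_integral = (LINT y:W|lborel. L * fact CARD('n) / (real CARD('n) + 1 - p \<bullet> y) ^ (CARD('n) + 1))"
  and set_integrable_density: "set_integrable lborel W (\<lambda>y. L * fact CARD('n) / (real CARD('n) + 1 - p \<bullet> y) ^ (CARD('n) + 1))"
proof -
  let ?N = "real CARD('n) + 1"
  let ?h = "\<lambda>y. L * fact CARD('n) / (?N - p \<bullet> y) ^ (CARD('n) + 1)"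
  have pos: "0 < ?N - p \<bullet> y" if "y \<in> W" for y using p_W[OF that] by simp
  have "continuous_on W ?h" by (intro continuous_intros) (use pos in force)
  from borel_integrable_compact[OF compact_W this] show i: "set_integrable lborel W ?h"
    by (simp add: set_integrable_def)
  have "0 \<le> cone_integral" unfolding cone_integral_def
    by (rule integral_nonneg[OF set_lebesgue_integral_eq_integral(1)[OF lifted.brascamp_lieb_cone(1)]]) simp
  have nn: "0 \<le> indicator W y *\<^sub>R ?h y" for y
    using pos[of y] L by (auto simp: indicator_def)
  have "ennreal cone_integral = (\<integral>\<^sup>+y. ennreal (indicator W y *\<^sub>R ?h y) \<partial>lborel)"
    unfolding nn_integral_cone_integral by (intro nn_integral_cong) (auto simp: indicator_def)
  also have "\<dots> = ennreal (LINT y:W|lborel. ?h y)"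
    using i nn unfolding set_lebesgue_integral_def set_integrable_def
    by (intro nn_integral_eq_integral AE_I2) auto
  finally show "cone_integral = (LINT y:W|lborel. ?h y)"
    using \<open>0 \<le> cone_integral\<close> nn by (subst (asm) ennreal_inj) (auto simp: set_lebesgue_integral_def intro!: integral_nonneg_AE)
qed

text \<open>Jensen's inequality for the uniform distribution on \<open>W\<close>: the tangent at the centroid is affine, so its
deviation from the value there integrates to zero.\<close>

lemma volume_le_cone_integral:
  defines "b \<equiv> real CARD('n) + 1 - centroid W \<bullet> p"
  shows "measure lborel W * (L * fact CARD('n) / b ^ (CARD('n) + 1)) \<le> cone_integral"
proof -
  let ?N = "real CARD('n) + 1" and ?k = "CARD('n) + 1"
  let ?h = "\<lambda>y. L * fact CARD('n) / (?N - p \<bullet> y) ^ ?k"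
  let ?A = "L * fact CARD('n)"
  have b: "0 < b" using centroid_le by (simp add: b_def)
  let ?t = "\<lambda>y. ?A * (1 / b ^ ?k - ?k * ((?N - p \<bullet> y) - b) / b ^ (?k + 1))"
  have c: "continuous_on W ?t" by (intro continuous_intros) (use b in auto)
  have it: "integrable lborel (\<lambda>y. indicator W y *\<^sub>R ?t y)"
    by (rule borel_integrable_compact[OF compact_W c])
  have "(LINT y:W|lborel. ?t y) \<le> (LINT y:W|lborel. ?h y)"
    unfolding set_lebesgue_integral_def
  proof (rule integral_mono[OF it])
    show "integrable lborel (\<lambda>y. indicator W y *\<^sub>R ?h y)"
      using set_integrable_density by (simp add: set_integrable_def)
    fix y
    show "indicator W y *\<^sub>R ?t y \<le> indicator W y *\<^sub>R ?h y"
    proof (cases "y \<in> W")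
      case True
      have "0 < ?N - p \<bullet> y" using p_W[OF True] by simp
      from inverse_power_tangent[OF this b, of ?k]
      have "?t y \<le> ?A * (1 / (?N - p \<bullet> y) ^ ?k)" using L by (intro mult_left_mono) auto
      then show ?thesis using True by simp
    qed simp
  qed
  also have "(LINT y:W|lborel. ?h y) = cone_integral" by (rule cone_integral_eq_set_integral[symmetric])
  also have "(LINT y:W|lborel. ?t y) = measure lborel W * (?A / b ^ ?k)"
  proof -
    let ?B = "?A * ?k / b ^ (?k + 1)"
    have t: "?t y = ?A / b ^ ?k - ?B * (centroid W \<bullet> p - p \<bullet> y)" for y
      by (simp add: b_def algebra_simps diff_divide_distrib)
    have i1: "set_integrable lborel W (\<lambda>y. p \<bullet> y)"
      unfolding set_integrable_def
      by (rule borel_integrable_compact[OF compact_W]) (intro continuous_intros)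
    have i0: "set_integrable lborel W (\<lambda>y. k)" for k :: real
      unfolding set_integrable_def
      by (rule borel_integrable_compact[OF compact_W]) (intro continuous_intros)
    have c0: "(LINT y:W|lborel. k) = measure lborel W * k" for k :: real
      using measurable_W by (simp add: set_lebesgue_integral_def)
    have "(LINT y:W|lborel. ?t y) = (LINT y:W|lborel. ?A / b ^ ?k) - ?B * ((LINT y:W|lborel. centroid W \<bullet> p) - (LINT y:W|lborel. p \<bullet> y))"
      unfolding t using i0 i1 by (simp add: set_integral_diff)
    then show ?thesis by (simp add: c0 centroid_inner)
  qed
  finally show ?thesis .
qed

end

section \<open>The optimal constant\<close>

text \<open>The cone is the image of the positive orthant under the orthogonal matrix with columns \<open>e i\<close>, which
turns the density into a product of one-dimensional exponentials.\<close>

lemma integral_exp_orthant: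
  fixes e :: "'m \<Rightarrow> real^'m::{finite,wellorder}"
  assumes e: "\<And>i j. e i \<bullet> e j = (if i = j then 1 else 0)"
    and q: "\<And>i. q \<bullet> e i = \<kappa>" and l: "0 < \<kappa>"
    and C: "C = {z. \<forall>i. 0 < e i \<bullet> z}"
    and i: "(\<lambda>z. exp (- (q \<bullet> z))) absolutely_integrable_on C"
  shows "integral C (\<lambda>z. exp (- (q \<bullet> z))) = 1 / \<kappa> ^ CARD('m)"
proof -
  define P :: "((real, 'm) vec, 'm) vec" where "P = (\<chi> i j. e j $ i)"
  have PtP: "transpose P ** P = mat 1"
    using e by (simp add: vec_eq_iff matrix_matrix_mult_def transpose_def P_def mat_def inner_vec_def)
  then have oP: "orthogonal_matrix P" by (simp add: orthogonal_matrix)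
  have detP: "\<bar>det P\<bar> = 1" using det_orthogonal_matrix[OF oP] by auto
  have Py: "P *v y = (\<Sum>j\<in>UNIV. y $ j *\<^sub>R e j)" for y
    by (simp add: vec_eq_iff matrix_vector_mult_def P_def mult.commute)
  have ePy: "e k \<bullet> (P *v y) = y $ k" for k y
    by (simp add: Py inner_sum_right e if_distrib cong: if_cong)
  have qPy: "q \<bullet> (P *v y) = (\<Sum>j\<in>UNIV. \<kappa> * y $ j)" for y
    by (simp add: Py inner_sum_right q mult.commute)
  have inj: "inj ((*v) P)" by (rule injI) (metis ePy vec_eq_iff)
  have surj: "\<exists>y. z = P *v y" for z
    using PtP by (metis matrix_left_right_inverse matrix_vector_mul_assoc matrix_vector_mul_lid)
  let ?S = "{y. \<forall>i. 0 < y $ i} :: ((real, 'm) vec) set"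
  have img: "(*v) P ` ?S = C"
  proof (intro equalityI subsetI)
    fix z assume "z \<in> C"
    obtain y where "z = P *v y" using surj by blast
    then show "z \<in> (*v) P ` ?S" using \<open>z \<in> C\<close> by (auto simp: C ePy)
  qed (auto simp: C ePy)
  have "?S = (\<Inter>i. {y. 0 < y $ i})" by auto
  also have "open \<dots>" by (intro open_INT ballI open_Collect_less continuous_intros) simp
  finally have "open ?S" .
  then have Sb: "?S \<in> sets borel" by simp
  then have S: "?S \<in> sets lebesgue" by simp
  have der: "((*v) P has_derivative (*v) P) (at y within ?S)" for y
    by (rule linear_imp_has_derivative) simp
  let ?f = "\<lambda>z. exp (- (q \<bullet> z))"
  have I: "(\<lambda>y. ?f (P *v y)) absolutely_integrable_on ?S" "integral ?S (\<lambda>y. ?f (P *v y)) = integral C ?f"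
    using absolutely_integrable_change_of_variables_real[OF S der inj_on_subset[OF inj], of ?f] i
    by (simp_all add: img detP)
  have "ennreal (integral C ?f) = (\<integral>\<^sup>+y. ennreal (indicator ?S y * ?f (P *v y)) \<partial>lborel)"
    unfolding I(2)[symmetric]
    by (rule nn_integral_has_integral_lebesgue[symmetric])
      (auto intro!: integrable_integral set_lebesgue_integral_eq_integral(1)[OF I(1)])
  also have "\<dots> = nn_integral lborel (\<lambda>y :: (real, 'm) vec. \<Prod>b\<in>Basis. ennreal (exp (- (\<kappa> * (y \<bullet> b)))) * indicator {0<..} (y \<bullet> b))"
  proof (rule nn_integral_cong)
    fix y :: "(real, 'm) vec"
    have B: "(\<Prod>b\<in>Basis. g (y \<bullet> b)) = (\<Prod>i\<in>UNIV. g (y $ i))" for g :: "real \<Rightarrow> ennreal"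
    proof -
      have "bij_betw (\<lambda>i. axis i 1) (UNIV :: 'm set) (Basis :: ((real, 'm) vec) set)"
        by (auto simp: bij_betw_def inj_on_def axis_eq_axis Basis_vec_def)
      from prod.reindex_bij_betw[OF this, of "\<lambda>b. g (y \<bullet> b)"] show ?thesis
        by (simp add: inner_axis)
    qed
    show "ennreal (indicator ?S y * ?f (P *v y)) = (\<Prod>b\<in>Basis. ennreal (exp (- (\<kappa> * (y \<bullet> b)))) * indicator {0<..} (y \<bullet> b))"
      unfolding B[of "\<lambda>s. ennreal (exp (- (\<kappa> * s))) * indicator {0<..} s"]
    proof (cases "y \<in> ?S")
      case True
      then show "ennreal (indicator ?S y * ?f (P *v y)) = (\<Prod>i\<in>UNIV. ennreal (exp (- (\<kappa> * y $ i))) * indicator {0<..} (y $ i))"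
        by (simp add: qPy sum_negf[symmetric] exp_sum prod_ennreal)
    next
      case False
      then obtain i where "\<not> 0 < y $ i" by auto
      then have "(\<Prod>i\<in>UNIV. ennreal (exp (- (\<kappa> * y $ i))) * indicator {0<..} (y $ i)) = 0"
        by (intro prod_zero) (auto intro!: exI[of _ i])
      then show "ennreal (indicator ?S y * ?f (P *v y)) = (\<Prod>i\<in>UNIV. ennreal (exp (- (\<kappa> * y $ i))) * indicator {0<..} (y $ i))"
        using False by simp
    qed
  qed
  also have "\<dots> = (\<Prod>b\<in>(Basis :: ((real, 'm) vec) set). \<integral>\<^sup>+s. ennreal (exp (- (\<kappa> * s))) * indicator {0<..} s \<partial>lborel)"
    by (rule nn_integral_lborel_prod) auto
  also have "(\<integral>\<^sup>+s. ennreal (exp (- (\<kappa> * s))) * indicator {0<..} s \<partial>lborel) = ennreal (1 / \<kappa>)"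
    using nn_integral_power_exp[OF l, of 1 0] by (simp add: mult.commute)
  also have "(\<Prod>b\<in>(Basis :: ((real, 'm) vec) set). ennreal (1 / \<kappa>)) = ennreal (1 / \<kappa> ^ CARD('m))"
    using l by (simp add: ennreal_power power_divide)
  finally show ?thesis
    using l by (subst (asm) ennreal_inj) (auto intro!: integral_nonneg set_lebesgue_integral_eq_integral(1)[OF i])
qed

context wulff_system begin

text \<open>Since \<open>|w u|\<^sup>2 / (n + 1)\<close> is a probability density, \<open>- entropy\<close> is \<open>(n + 1) / 2\<close> times the mean of
\<open>ln ((f u)\<^sup>2 / |w u|\<^sup>2)\<close>. The mean of \<open>(f u)\<^sup>2 / |w u|\<^sup>2\<close> itself is \<open>L\<^sup>2 / (n + 1)\<close>, and Jensen's inequality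
compares the two. The ratio determines \<open>f u\<close>, which gives the equality case.\<close>

lemma entropy_bound:
  shows "exp (- lifted.entropy) \<le> (L / sqrt (real CARD('n) + 1)) ^ (CARD('n) + 1)"
    and "exp (- lifted.entropy) = (L / sqrt (real CARD('n) + 1)) ^ (CARD('n) + 1) \<Longrightarrow> u \<in> space M \<Longrightarrow>
       (f u)\<^sup>2 = L\<^sup>2 / CARD('n)"
proof -
  let ?n = "real CARD('n)" let ?N = "?n + 1"
  define q where "q u = (lift u \<bullet> lift u) / ?N" for u
  \<comment> \<open>the inverse square of the rate \<open>norm (lift u) / f u\<close>\<close>
  define \<tau> where "\<tau> u = (f u)\<^sup>2 / (lift u \<bullet> lift u)" for u
  have N0: "0 < ?N" by simp
  have ww: "0 < lift u \<bullet> lift u" if "u \<in> space M" for u using lifted.w_nonzero[OF that] by simp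
  have cq: "continuous_on (space M) q" unfolding q_def by (intro continuous_intros continuous_lift) simp
  have ct: "continuous_on (space M) \<tau>" unfolding \<tau>_def
    by (intro continuous_intros continuous_lift f) (use ww in force)
  have q0: "0 \<le> q u" for u by (simp add: q_def)
  have t0: "0 < \<tau> u" if "u \<in> space M" for u using ww[OF that] f_pos[OF that] by (simp add: \<tau>_def)
  have q1: "(LINT u|M. q u) = 1" using lifted.integral_norm_squared N0 by (simp add: q_def card_succ)
  have qt: "(LINT u|M. q u * \<tau> u) = L\<^sup>2 / ?N"
  proof -
    have "(LINT u|M. q u * \<tau> u) = (LINT u|M. (f u)\<^sup>2 / ?N)"
      using ww by (intro Bochner_Integration.integral_cong refl) (force simp: q_def \<tau>_def)
    then show ?thesis by (simp add: L2)
  qed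
  have ent: "- lifted.entropy = ?N / 2 * (LINT u|M. q u * ln (\<tau> u))"
  proof -
    have "lifted.entropy = (LINT u|M. - (?N / 2) * (q u * ln (\<tau> u)))"
      unfolding lifted.entropy_def
    proof (intro Bochner_Integration.integral_cong refl)
      fix u assume u: "u \<in> space M"
      have "ln (1 / f u * norm (lift u)) = - (1 / 2) * ln (\<tau> u)"
        unfolding \<tau>_def using ww[OF u] f_pos[OF u] lifted.w_nonzero[OF u]
        by (simp add: ln_mult ln_div ln_realpow power2_norm_eq_inner[symmetric] diff_divide_distrib)
      then show "(lift u \<bullet> lift u) * ln (1 / f u * norm (lift u)) = - (?N / 2) * (q u * ln (\<tau> u))"
        using N0 by (simp add: q_def field_simps)
    qed
    then show ?thesis by simp
  qed
  have pw: "(L / sqrt ?N) ^ (CARD('n) + 1) = exp (?N / 2 * ln (L\<^sup>2 / ?N))"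
  proof -
    have "exp (?N / 2 * ln (L\<^sup>2 / ?N)) = exp (real (CARD('n) + 1) * ln (L / sqrt ?N))"
      using L N0 by (simp add: ln_div ln_realpow ln_sqrt algebra_simps)
    also have "\<dots> = (L / sqrt ?N) ^ (CARD('n) + 1)"
      using L N0 by (subst exp_of_nat_mult) simp
    finally show ?thesis by simp
  qed
  have j: "(LINT u|M. q u * ln (\<tau> u)) \<le> ln (L\<^sup>2 / ?N)"
    using jensen_ln(2)[OF cq q0 q1 ct t0] by (simp add: qt)
  show "exp (- lifted.entropy) \<le> (L / sqrt ?N) ^ (CARD('n) + 1)"
    unfolding pw ent using j N0 by simp
  show "(f u)\<^sup>2 = L\<^sup>2 / ?n" if "exp (- lifted.entropy) = (L / sqrt ?N) ^ (CARD('n) + 1)" and u: "u \<in> space M"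
  proof -
    have "(LINT u|M. q u * ln (\<tau> u)) = ln (L\<^sup>2 / ?N)" using that(1) unfolding pw ent using N0 by simp
    then have "q u = 0 \<or> \<tau> u = L\<^sup>2 / ?N" using jensen_ln(3)[OF cq q0 q1 ct t0 _ u] by (simp add: qt)
    moreover have "q u \<noteq> 0" using ww[OF u] N0 by (simp add: q_def)
    ultimately have "(f u)\<^sup>2 / (1 + (f u)\<^sup>2 / L\<^sup>2) = L\<^sup>2 / ?N" by (simp add: \<tau>_def lift_sq[OF u])
    moreover have "0 < 1 + (f u)\<^sup>2 / L\<^sup>2" by (simp add: add_pos_nonneg)
    ultimately have "(f u)\<^sup>2 * ?N = L\<^sup>2 * (1 + (f u)\<^sup>2 / L\<^sup>2)" using N0 by (simp add: frac_eq_eq)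
    also have "\<dots> = L\<^sup>2 + (f u)\<^sup>2" using L by (simp add: distrib_left)
    finally have "(f u)\<^sup>2 * ?n = L\<^sup>2" by (simp add: distrib_left)
    then show ?thesis by (simp add: eq_divide_eq)
  qed
qed

text \<open>Orthogonal lifted vectors are linearly independent, and by isotropy nothing is orthogonal to all of
them; so they form a basis of the space of dimension \<open>n + 1\<close>.\<close>

lemma orthogonal_lift_card:
  assumes orth: "\<And>u v. u \<in> space M \<Longrightarrow> v \<in> space M \<Longrightarrow> u \<noteq> v \<Longrightarrow> lift u \<bullet> lift v = 0"
  shows "finite (space M)" and "card (space M) = CARD('n) + 1" and "inj_on lift (space M)"
proof -
  show inj: "inj_on lift (space M)"
  proof (rule inj_onI, rule ccontr)
    fix u v assume "u \<in> space M" "v \<in> space M" "lift u = lift v" "u \<noteq> v"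
    then have "lift u \<bullet> lift u = 0" using orth[of u v] by simp
    then show False using lifted.w_nonzero[OF \<open>u \<in> space M\<close>] by simp
  qed
  let ?B = "lift ` space M"
  have "pairwise orthogonal ?B" using orth by (force simp: pairwise_def orthogonal_def)
  moreover have "0 \<notin> ?B" using lifted.w_nonzero by auto
  ultimately have ind: "independent ?B" by (rule pairwise_orthogonal_independent)
  then have fin: "finite ?B" by (rule independent_imp_finite)
  then show "finite (space M)" using inj by (rule finite_imageD)
  have "span ?B = UNIV"
  proof (rule ccontr)
    assume "span ?B \<noteq> UNIV"
    then obtain a where a: "a \<noteq> 0" "\<forall>x \<in> span ?B. a \<bullet> x = 0" using span_not_UNIV_orthogonal by blast
    then have "(LINT u|M. (lift u \<bullet> a) * (lift u \<bullet> a)) = (LINT u|M. 0)"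
      by (intro Bochner_Integration.integral_cong refl) (simp add: span_base inner_commute[of _ a])
    then show False using a(1) by (simp add: lift_iso)
  qed
  then have "card ?B = CARD('n succ)"
    using ind basis_card_eq_dim[of ?B UNIV] by (simp add: dim_UNIV)
  then show "card (space M) = CARD('n) + 1" using inj by (simp add: card_image card_succ)
qed

text \<open>The normalised lifted vectors form an orthonormal basis that bounds the cone as an orthant, and
the exponent has the same product with each of them.\<close>

lemma cone_integral_orthogonal:
  assumes const: "\<And>u. u \<in> space M \<Longrightarrow> f u = k"
    and orth: "\<And>u v. u \<in> space M \<Longrightarrow> v \<in> space M \<Longrightarrow> u \<noteq> v \<Longrightarrow> lift u \<bullet> lift v = 0"
  shows "p = 0" and "cone_integral = (L / sqrt (real CARD('n) + 1)) ^ (CARD('n) + 1)"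
proof -
  let ?n = "real CARD('n)" let ?N = "?n + 1"
  have k: "0 < k" using space_nonempty const f_pos by force
  have L2k: "L\<^sup>2 = k\<^sup>2 * ?n"
  proof -
    have "L\<^sup>2 = (LINT u|M. k\<^sup>2 * 1)" unfolding L2[symmetric] by (intro Bochner_Integration.integral_cong) (auto simp: const)
    then show ?thesis by (simp only: integral_mult_right_zero total_mass)
  qed
  show p0: "p = 0"
  proof -
    have "p = (LINT u|M. (1 / k\<^sup>2) *\<^sub>R (f u *\<^sub>R u))" unfolding p_def
      by (intro Bochner_Integration.integral_cong refl) (simp add: const power2_eq_square k)
    also have "\<dots> = 0" by (simp only: integral_scaleR_right centered scaleR_zero_right)
    finally show ?thesis .
  qed
  have sq: "lift u \<bullet> lift u = ?N / ?n" if "u \<in> space M" for u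
    using k by (simp add: lift_sq[OF that] const[OF that] L2k field_simps)
  note card = orthogonal_lift_card[OF orth]
  then obtain g :: "'n succ \<Rightarrow> real^'n" where g: "bij_betw g UNIV (space M)"
    using finite_same_card_bij[of "UNIV :: 'n succ set" "space M"] by (auto simp: card_succ)
  have gM: "g i \<in> space M" for i using g by (auto simp: bij_betw_def)
  define r where "r = sqrt (?N / ?n)"
  have r: "0 < r" "r\<^sup>2 = ?N / ?n" by (auto simp: r_def)
  define e where "e i = (1 / r) *\<^sub>R lift (g i)" for i
  have ee: "e i \<bullet> e j = (if i = j then 1 else 0)" for i j
  proof (cases "i = j")
    case True
    then show ?thesis using r(1) by (simp add: e_def sq[OF gM] r(2)[symmetric] power2_eq_square)
  next
    case False
    then have "g i \<noteq> g j" using g by (auto simp: bij_betw_def inj_eq)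
    then show ?thesis using False by (simp add: e_def orth[OF gM gM])
  qed
  have qe: "lifted.exponent \<bullet> e i = r / k" for i
  proof -
    have "lifted.exponent \<bullet> lift (g i) = ?N * (k / L) / L"
      unfolding lift_def exponent_inner by (simp add: p0 const[OF gM])
    also have "\<dots> = r\<^sup>2 / k" using L k by (simp add: r(2) L2k power2_eq_square[of L, symmetric]) (simp add: power2_eq_square)
    finally show ?thesis using r(1) by (simp add: e_def power2_eq_square)
  qed
  have C: "lifted.positivity_cone = {z. \<forall>i. 0 < e i \<bullet> z}"
  proof -
    have "(\<forall>u\<in>space M. 0 < lift u \<bullet> z) \<longleftrightarrow> (\<forall>i. 0 < lift (g i) \<bullet> z)" for z
      using g unfolding bij_betw_def by (metis gM rangeE)
    then show ?thesis unfolding lifted.positivity_cone_def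
      using r(1) by (simp add: e_def zero_less_divide_iff)
  qed
  have "cone_integral = 1 / (r / k) ^ CARD('n succ)"
    unfolding cone_integral_def using r(1) k
    by (intro integral_exp_orthant[OF ee qe _ C lifted.brascamp_lieb_cone(1)]) simp
  also have "\<dots> = (k / r) ^ (CARD('n) + 1)" by (simp add: card_succ power_divide)
  also have "k / r = L / sqrt ?N"
  proof -
    have "L = k * sqrt ?n" using L2k L k by (metis less_imp_le real_sqrt_abs real_sqrt_mult abs_of_pos)
    then show ?thesis by (simp add: r_def real_sqrt_divide)
  qed
  finally show "cone_integral = (L / sqrt ?N) ^ (CARD('n) + 1)" .
qed

end

section \<open>The volume bound and regular simplices\<close>

text \<open>By the Cauchy-Schwarz inequality the functional \<open>x \<bullet> w\<close> attains its maximum 1 over the unit ball only at \<open>w\<close>.\<close>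

lemma unit_vector_extreme_point:
  fixes w :: "'a::real_inner"
  assumes w: "norm w = 1" "w \<in> S" and S: "S \<subseteq> cball 0 1"
  shows "w extreme_point_of S"
  unfolding extreme_point_of_def
proof (intro conjI ballI notI w(2))
  fix a b assume ab: "a \<in> S" "b \<in> S" "w \<in> open_segment a b"
  then obtain t where t: "0 < t" "t < 1" "w = (1 - t) *\<^sub>R a + t *\<^sub>R b" and ne: "a \<noteq> b"
    by (auto simp: in_segment)
  have ww: "w \<bullet> w = 1" using w(1) by (simp add: norm_eq_1)
  have le: "x \<bullet> w \<le> 1" and eq: "x \<bullet> w = 1 \<Longrightarrow> x = w" if "x \<in> S" for x
  proof -
    have x: "norm x \<le> 1" using S that by auto
    then show "x \<bullet> w \<le> 1" using norm_cauchy_schwarz[of x w] w(1) by simp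
    assume "x \<bullet> w = 1"
    then have "(norm (x - w))\<^sup>2 = (norm x)\<^sup>2 - 1"
      by (simp add: power2_norm_eq_inner inner_diff_left inner_diff_right ww inner_commute[of w x])
    also have "\<dots> \<le> 0" using x by (simp add: power_le_one)
    finally show "x = w" by simp
  qed
  have "(1 - t) * (1 - a \<bullet> w) + t * (1 - b \<bullet> w) = 1 - ((1 - t) *\<^sub>R a + t *\<^sub>R b) \<bullet> w"
    by (simp add: inner_add_left algebra_simps)
  also have "\<dots> = 0" by (simp add: t(3)[symmetric] ww)
  finally have sum: "(1 - t) * (1 - a \<bullet> w) + t * (1 - b \<bullet> w) = 0" .
  moreover have "0 \<le> (1 - t) * (1 - a \<bullet> w)" "0 \<le> t * (1 - b \<bullet> w)" using t le ab by auto
  ultimately have "(1 - t) * (1 - a \<bullet> w) = 0" "t * (1 - b \<bullet> w) = 0" by linarith+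
  then have "a = w" "b = w" using t eq ab by auto
  then show False using ne by simp
qed

context wulff_system begin

lemma orthogonal_lift_if_equiangular:
  assumes h: "\<And>u v. u \<in> space M \<Longrightarrow> v \<in> space M \<Longrightarrow> u \<noteq> v \<Longrightarrow> f u = f v \<and> u \<bullet> v = - 1 / CARD('n)"
  obtains k where "\<And>u. u \<in> space M \<Longrightarrow> f u = k"
    and "\<And>u v. u \<in> space M \<Longrightarrow> v \<in> space M \<Longrightarrow> u \<noteq> v \<Longrightarrow> lift u \<bullet> lift v = 0"
proof -
  obtain x where x: "x \<in> space M" using space_nonempty by blast
  have const: "f u = f x" if "u \<in> space M" for u using h[OF that x] by (cases "u = x") auto
  have "L\<^sup>2 = (LINT u|M. (f x)\<^sup>2 * 1)" unfolding L2[symmetric]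
    by (intro Bochner_Integration.integral_cong) (auto simp: const)
  then have L2x: "L\<^sup>2 = (f x)\<^sup>2 * CARD('n)" by (simp only: integral_mult_right_zero total_mass)
  have "lift u \<bullet> lift v = 0" if "u \<in> space M" "v \<in> space M" "u \<noteq> v" for u v
  proof -
    have "f u * f v = (f x)\<^sup>2" using const that by (simp add: power2_eq_square)
    then show ?thesis using h[OF that] f_pos[OF x] by (simp add: lift_inner L2x)
  qed
  with const show ?thesis by (rule that)
qed

text \<open>The right-hand side of the theorem, with its power of \<open>n + 1\<close> written through the square root.\<close>

definition volume_bound :: real where
  "volume_bound = (real CARD('n) + 1 - centroid W \<bullet> p) ^ (CARD('n) + 1)
     / (fact CARD('n) * sqrt (real CARD('n) + 1) ^ (CARD('n) + 1)) * L ^ CARD('n)"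

text \<open>The chain consists of the tangent bound, the Brascamp-Lieb inequality and the entropy bound. Equality
forces equality in the last two, and hence the rigidity of \<open>f\<close> and then of the directions. In the
converse direction \<open>p = 0\<close> makes the density on \<open>W\<close> constant and the first step exact.\<close>

lemma volume_le_bound:
  shows "measure lborel W \<le> volume_bound"
    and "measure lborel W = volume_bound \<Longrightarrow> u \<in> space M \<Longrightarrow> v \<in> space M \<Longrightarrow> u \<noteq> v \<Longrightarrow>
      f u = f v \<and> u \<bullet> v = - 1 / CARD('n)"
    and "\<lbrakk>\<And>u v. u \<in> space M \<Longrightarrow> v \<in> space M \<Longrightarrow> u \<noteq> v \<Longrightarrow> f u = f v \<and> u \<bullet> v = - 1 / CARD('n)\<rbrakk>
      \<Longrightarrow> measure lborel W = volume_bound"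
proof -
  let ?n = "real CARD('n)" let ?N = "?n + 1" and ?k = "CARD('n) + 1"
  define b where "b = ?N - centroid W \<bullet> p"
  define s where "s = sqrt ?N"
  have b: "0 < b" using centroid_le by (simp add: b_def)
  have s: "0 < s" by (simp add: s_def)
  let ?A = "L * fact CARD('n) / b ^ ?k"
  have A: "0 < ?A" using L b by simp
  have bound: "volume_bound * ?A = (L / s) ^ ?k"
    using b s L by (simp add: volume_bound_def b_def[symmetric] s_def[symmetric] power_divide)
  have c1: "measure lborel W * ?A \<le> cone_integral" using volume_le_cone_integral by (simp add: b_def)
  have c2: "cone_integral \<le> exp (- lifted.entropy)"
    unfolding cone_integral_def by (rule lifted.brascamp_lieb_cone(2))
  have c3: "exp (- lifted.entropy) \<le> (L / s) ^ ?k" using entropy_bound(1) by (simp add: s_def)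
  have "measure lborel W * ?A \<le> volume_bound * ?A" unfolding bound using c1 c2 c3 by linarith
  then show "measure lborel W \<le> volume_bound" using A by (simp only: mult_le_cancel_right_pos)
  show "f u = f v \<and> u \<bullet> v = - 1 / CARD('n)"
    if eq: "measure lborel W = volume_bound" and u: "u \<in> space M" and v: "v \<in> space M" and uv: "u \<noteq> v"
  proof -
    have "(L / s) ^ ?k \<le> cone_integral" using c1 unfolding eq bound .
    then have e1: "cone_integral = exp (- lifted.entropy)" and e2: "exp (- lifted.entropy) = (L / s) ^ ?k"
      using c2 c3 by auto
    have sq: "(f x)\<^sup>2 = L\<^sup>2 / ?n" if "x \<in> space M" for x
      using entropy_bound(2)[OF _ that] e2 by (simp add: s_def)
    have fuv: "f u = f v"
      using sq[OF u] sq[OF v] f_pos[OF u] f_pos[OF v] by (metis less_imp_le power2_eq_imp_eq)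
    have ne: "lift u \<noteq> lift v"
    proof
      assume eq: "lift u = lift v"
      have "lift u \<bullet> lift v = lift u \<bullet> lift u" using eq by simp
      then have "u \<bullet> v = 1" using unit[OF u] fuv by (simp add: lift_inner norm_eq_1)
      then have "(norm (u - v))\<^sup>2 = 0"
        using unit[OF u] unit[OF v] by (simp add: power2_norm_eq_inner inner_diff_left inner_diff_right norm_eq_1 inner_commute)
      then show False using uv by simp
    qed
    have nn: "norm (lift u) = norm (lift v)" by (simp add: norm_eq_sqrt_inner lift_sq[OF u] lift_sq[OF v] fuv)
    have "lift u \<bullet> lift v = 0"
      by (rule lifted.brascamp_lieb_cone(3)[OF _ u v])
        (use e1 nn fuv ne f_pos[OF v] in \<open>auto simp: cone_integral_def\<close>)
    then have "u \<bullet> v = - ((f u)\<^sup>2 / L\<^sup>2)" by (simp add: lift_inner fuv power2_eq_square)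
    also have "\<dots> = - 1 / ?n" using L by (simp add: sq[OF u])
    finally show ?thesis using fuv by simp
  qed
  show "measure lborel W = volume_bound"
    if h: "\<And>u v. u \<in> space M \<Longrightarrow> v \<in> space M \<Longrightarrow> u \<noteq> v \<Longrightarrow> f u = f v \<and> u \<bullet> v = - 1 / CARD('n)"
  proof -
    obtain k where const: "\<And>u. u \<in> space M \<Longrightarrow> f u = k"
      and orth: "\<And>u v. u \<in> space M \<Longrightarrow> v \<in> space M \<Longrightarrow> u \<noteq> v \<Longrightarrow> lift u \<bullet> lift v = 0"
      by (rule orthogonal_lift_if_equiangular[OF h]) auto
    have p0: "p = 0" and ci: "cone_integral = (L / s) ^ ?k"
      using cone_integral_orthogonal[OF const orth] by (auto simp: s_def)
    have "cone_integral = (LINT y:W|lborel. ?A)" unfolding cone_integral_eq_set_integral by (simp add: p0 b_def)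
    also have "\<dots> = measure lborel W * ?A" using measurable_W by (simp add: set_lebesgue_integral_def)
    finally have m: "cone_integral = measure lborel W * ?A" .
    have "measure lborel W * ?A = volume_bound * ?A" by (simp only: m[symmetric] ci bound)
    then show ?thesis using A by (metis less_irrefl mult_right_cancel)
  qed
qed

lemma regular_simplex_if_equiangular:
  assumes h: "\<And>u v. u \<in> space M \<Longrightarrow> v \<in> space M \<Longrightarrow> u \<noteq> v \<Longrightarrow> f u = f v \<and> u \<bullet> v = - 1 / CARD('n)"
  shows "regular_simplex (int CARD('n)) (convex hull (space M))"
    and "inscribed_in_sphere (convex hull (space M))" and "f constant_on space M"
proof -
  let ?n = "real CARD('n)"
  obtain k where const: "\<And>u. u \<in> space M \<Longrightarrow> f u = k"
    and orth: "\<And>u v. u \<in> space M \<Longrightarrow> v \<in> space M \<Longrightarrow> u \<noteq> v \<Longrightarrow> lift u \<bullet> lift v = 0"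
    by (rule orthogonal_lift_if_equiangular[OF h]) auto
  then show "f constant_on space M" unfolding constant_on_def by blast
  note card = orthogonal_lift_card[OF orth]
  have ind: "\<not> affine_dependent (space M)"
  proof
    assume "affine_dependent (space M)"
    then obtain U v where U: "sum U (space M) = 0" "v \<in> space M" "U v \<noteq> 0" "(\<Sum>v\<in>space M. U v *\<^sub>R v) = 0"
      using affine_dependent_explicit_finite[OF card(1)] by blast
    have "0 = (\<Sum>u\<in>space M. U u *\<^sub>R u) \<bullet> v" using U(4) by simp
    also have "\<dots> = (\<Sum>u\<in>space M. U u * (u \<bullet> v))" by (simp add: inner_sum_left)
    also have "\<dots> = (\<Sum>u\<in>space M. (if u = v then U v * (1 + 1 / ?n) else 0) - U u * (1 / ?n))"
    proof (intro sum.cong refl)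
      fix u assume u: "u \<in> space M"
      show "U u * (u \<bullet> v) = (if u = v then U v * (1 + 1 / ?n) else 0) - U u * (1 / ?n)"
        using h[OF u U(2)] unit[OF U(2)] by (cases "u = v") (auto simp: norm_eq_1 distrib_left)
    qed
    also have "\<dots> = U v * (1 + 1 / ?n) - sum U (space M) * (1 / ?n)"
      using card(1) U(2) by (simp add: sum_subtractf sum_divide_distrib)
    also have "\<dots> = U v * (1 + 1 / ?n)" by (simp add: U(1))
    finally have "U v = 0 \<or> 1 + 1 / ?n = 0" by simp
    moreover have "0 < 1 + 1 / ?n" by (simp add: add_pos_nonneg)
    ultimately show False using U(3) by linarith
  qed
  have ext: "v extreme_point_of (convex hull (space M)) \<longleftrightarrow> v \<in> space M" for v
    by (rule extreme_point_of_convex_hull_affine_independent[OF ind])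
  show "inscribed_in_sphere (convex hull (space M))"
    using unit by (auto simp: inscribed_in_sphere_def ext)
  have dist: "dist v w = sqrt (2 + 2 / ?n)" if "v \<in> space M" "w \<in> space M" "v \<noteq> w" for v w
  proof -
    have "(dist v w)\<^sup>2 = v \<bullet> v + w \<bullet> w - 2 * (v \<bullet> w)"
      by (simp add: dist_norm power2_norm_eq_inner inner_diff_left inner_diff_right inner_commute)
    also have "\<dots> = 2 + 2 / ?n" using h[OF that] unit[OF that(1)] unit[OF that(2)] by (simp add: norm_eq_1)
    finally show ?thesis by (metis real_sqrt_unique zero_le_dist)
  qed
  show "regular_simplex (int CARD('n)) (convex hull (space M))"
    unfolding regular_simplex_def
  proof
    show "int CARD('n) simplex convex hull space M"
      unfolding simplex_def using ind card(2) by (intro exI[of _ "space M"]) simp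
    show "\<exists>d. \<forall>v w. v extreme_point_of convex hull space M \<longrightarrow> w extreme_point_of convex hull space M
        \<longrightarrow> v \<noteq> w \<longrightarrow> dist v w = d"
      using dist by (auto simp: ext)
  qed
qed

text \<open>All points of the support are unit vectors, hence vertices, so products of distinct ones have a common
value \<open>a\<close>. It is found without using the number of vertices: for a fixed \<open>v\<close>, the product
\<open>(x \<bullet> v - 1) * (x \<bullet> v - a)\<close> vanishes for all \<open>x\<close> in the support, and isotropy and centering evaluate its
integral to \<open>1 + a * n\<close>.\<close>

lemma equiangular_if_regular_simplex:
  assumes reg: "regular_simplex (int CARD('n)) (convex hull (space M))"
    and ins: "inscribed_in_sphere (convex hull (space M))" and const: "f constant_on space M"
    and u: "u \<in> space M" and v: "v \<in> space M" and uv: "u \<noteq> v"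
  shows "f u = f v \<and> u \<bullet> v = - 1 / CARD('n)"
proof
  let ?n = "real CARD('n)"
  show fuv: "f u = f v" using const u v unfolding constant_on_def by auto
  obtain C where C: "\<not> affine_dependent C" "int (card C) = int CARD('n) + 1" "convex hull (space M) = convex hull C"
    using reg unfolding regular_simplex_def simplex_def by blast
  have finC: "finite C" using C(1) by (rule aff_independent_finite)
  have extC: "w extreme_point_of (convex hull (space M)) \<longleftrightarrow> w \<in> C" for w
    unfolding C(3) by (rule extreme_point_of_convex_hull_affine_independent[OF C(1)])
  have normC: "norm w = 1" if "w \<in> C" for w
    using ins that by (auto simp: inscribed_in_sphere_def extC)
  have ball: "convex hull (space M) \<subseteq> cball 0 1"
    by (rule hull_minimal) (auto simp: unit)
  have MC: "w \<in> C" if w: "w \<in> space M" for w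
  proof -
    have "w extreme_point_of (convex hull (space M))"
      by (rule unit_vector_extreme_point[OF unit[OF w] hull_inc[OF w] ball])
    then show ?thesis by (simp add: extC)
  qed
  obtain d where d: "\<And>x y. x \<in> C \<Longrightarrow> y \<in> C \<Longrightarrow> x \<noteq> y \<Longrightarrow> dist x y = d"
    using reg unfolding regular_simplex_def extC by blast
  define a where "a = 1 - d\<^sup>2 / 2"
  have ip: "x \<bullet> v = a" if "x \<in> space M" "x \<noteq> v" for x
  proof -
    have "d\<^sup>2 = (dist x v)\<^sup>2" using d[OF MC[OF that(1)] MC[OF v] that(2)] by simp
    also have "\<dots> = x \<bullet> x + v \<bullet> v - 2 * (x \<bullet> v)"
      by (simp add: dist_norm power2_norm_eq_inner inner_diff_left inner_diff_right inner_commute)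
    also have "\<dots> = 2 - 2 * (x \<bullet> v)" using unit[OF that(1)] unit[OF v] by (simp add: norm_eq_1)
    finally show ?thesis by (simp add: a_def diff_divide_distrib)
  qed
  have vv: "v \<bullet> v = 1" using unit[OF v] by (simp add: norm_eq_1)
  have a1: "a \<noteq> 1"
    using d[OF MC[OF u] MC[OF v] uv] uv by (auto simp: a_def)
  have int_id: "integrable M (\<lambda>x. x \<bullet> v)" "integrable M (\<lambda>x. (x \<bullet> v) * (x \<bullet> v))" "integrable M (\<lambda>x. 1 :: real)"
    by (intro integrable_continuous continuous_intros)+
  have e1: "(LINT x|M. x \<bullet> v) = 0"
  proof -
    have "(LINT x|M. f v * (x \<bullet> v)) = (LINT x|M. f x * (x \<bullet> v))"
      using const v by (intro Bochner_Integration.integral_cong refl) (metis constant_on_def)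
    then have "f v * (LINT x|M. x \<bullet> v) = 0" by (simp add: centered_inner)
    then show ?thesis using f_pos[OF v] by simp
  qed
  have e2: "(LINT x|M. (x \<bullet> v) * (x \<bullet> v)) = 1" by (simp add: iso vv)
  have "(LINT x|M. (x \<bullet> v - 1) * (x \<bullet> v - a)) = (LINT x|M. 0)"
    using ip vv by (intro Bochner_Integration.integral_cong refl) auto
  then have "(LINT x|M. (x \<bullet> v) * (x \<bullet> v) - (1 + a) * (x \<bullet> v) + a * 1) = 0"
    by (simp add: algebra_simps)
  moreover have "(LINT x|M. (x \<bullet> v) * (x \<bullet> v) - (1 + a) * (x \<bullet> v) + a * 1)
     = (LINT x|M. (x \<bullet> v) * (x \<bullet> v)) - (1 + a) * (LINT x|M. x \<bullet> v) + a * (LINT x|M. 1)"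
    using int_id by simp
  ultimately have "1 + a * ?n = 0" unfolding e1 e2 total_mass by simp
  then have "a = - 1 / ?n" by (simp add: field_simps eq_neg_iff_add_eq_0)
  then show "u \<bullet> v = - 1 / ?n" using ip[OF u uv] by simp
qed

lemma volume_eq_iff:
  "measure lborel W = volume_bound \<longleftrightarrow> regular_simplex (int CARD('n)) (convex hull (space M))
     \<and> inscribed_in_sphere (convex hull (space M)) \<and> f constant_on space M"
proof
  assume "measure lborel W = volume_bound"
  from volume_le_bound(2)[OF this] show "regular_simplex (int CARD('n)) (convex hull (space M))
     \<and> inscribed_in_sphere (convex hull (space M)) \<and> f constant_on space M"
    using regular_simplex_if_equiangular by blast
next
  assume "regular_simplex (int CARD('n)) (convex hull (space M))
     \<and> inscribed_in_sphere (convex hull (space M)) \<and> f constant_on space M"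
  then show "measure lborel W = volume_bound"
    by (intro volume_le_bound(3) equiangular_if_regular_simplex) auto
qed

end

text \<open>The complement of the support is covered by the null sets among countably many basic open sets.\<close>

lemma AE_in_supp:
  fixes \<nu> :: "(real^'n) measure"
  assumes "borel_measure_on_sphere \<nu>"
  shows "AE u in \<nu>. u \<in> supp \<nu>"
proof -
  interpret finite_measure \<nu> using assms by (simp add: borel_measure_on_sphere_def)
  have sets: "sets \<nu> = sets (restrict_space borel (sphere 0 1))"
    using assms by (simp add: borel_measure_on_sphere_def)
  then have sp: "space \<nu> = sphere 0 1" using sets_eq_imp_space_eq[OF sets] by (simp add: space_restrict_space)
  have U: "U \<inter> space \<nu> \<in> sets \<nu>" if "open U" for U
    using that unfolding sets sp by (auto simp: sets_restrict_space)
  obtain \<B> :: "(real^'n) set set" where B: "countable \<B>" "topological_basis \<B>"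
    using ex_countable_basis by blast
  define N where "N = {U \<in> \<B>. measure \<nu> (U \<inter> space \<nu>) = 0}"
  have "countable N" unfolding N_def using B(1) by simp
  have "AE u in \<nu>. \<forall>U\<in>N. u \<notin> U"
  proof (subst AE_ball_countable[OF \<open>countable N\<close>], intro ballI)
    fix V assume V: "V \<in> N"
    then have "open V" using B(2) by (auto simp: N_def topological_basis_open)
    then have "V \<inter> space \<nu> \<in> null_sets \<nu>" using V U by (auto simp: N_def null_sets_def emeasure_eq_measure)
    then have "AE u in \<nu>. u \<notin> V \<inter> space \<nu>" by (rule AE_not_in)
    then show "AE u in \<nu>. u \<notin> V" using AE_space by eventually_elim auto
  qed
  then show ?thesis using AE_space
  proof eventually_elim
    case (elim u)
    show "u \<in> supp \<nu>" unfolding supp_def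
    proof (intro CollectI conjI allI impI)
      fix O' assume O': "open O'" "u \<in> O'"
      then obtain V where V: "V \<in> \<B>" "u \<in> V" "V \<subseteq> O'" using topological_basisE[OF B(2)] by metis
      have "measure \<nu> (V \<inter> space \<nu>) \<noteq> 0" using elim(1) V by (auto simp: N_def)
      then have "0 < measure \<nu> (V \<inter> space \<nu>)" by (simp add: zero_less_measure_iff)
      also have "\<dots> \<le> measure \<nu> (O' \<inter> space \<nu>)"
        using V O' U by (intro finite_measure_mono) auto
      finally show "0 < measure \<nu> (O' \<inter> space \<nu>)" .
    qed (use elim in auto)
  qed
qed

section \<open>From the measure to its support\<close>

lemma compact_supp:
  fixes \<nu> :: "(real^'n) measure"
  assumes "space \<nu> = sphere 0 1"
  shows "compact (supp \<nu>)"
proof -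
  define G where "G = \<Union>{U. open U \<and> measure \<nu> (U \<inter> space \<nu>) = 0}"
  have "supp \<nu> = sphere 0 1 - G"
    unfolding supp_def G_def assms by (auto simp: zero_less_measure_iff)
  moreover have "open G" unfolding G_def by auto
  ultimately show ?thesis by (simp add: compact_diff)
qed

theorem theorem5p1:
  fixes f :: "real^'n \<Rightarrow> real" and \<nu> :: "(real^'n) measure"
  assumes "CARD('n) \<ge> 2"
    and "continuous_on (sphere 0 1) f"
    and "\<forall>u \<in> sphere 0 1. 0 < f u"
    and "borel_measure_on_sphere \<nu>"
    and "isotropic \<nu>"
    and "centered f \<nu>"
  shows "measure lborel (wulff_shape \<nu> f)
           \<le> (real CARD('n) + 1 - disp \<nu> f) ^ (CARD('n) + 1)
               / (fact CARD('n) * (real CARD('n) + 1) powr ((real CARD('n) + 1) / 2))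
               * L2_norm_on \<nu> f ^ CARD('n)
         \<and> (measure lborel (wulff_shape \<nu> f)
              = (real CARD('n) + 1 - disp \<nu> f) ^ (CARD('n) + 1)
                  / (fact CARD('n) * (real CARD('n) + 1) powr ((real CARD('n) + 1) / 2))
                  * L2_norm_on \<nu> f ^ CARD('n)
            \<longleftrightarrow> regular_simplex (int CARD('n)) (convex hull (supp \<nu>))
              \<and> inscribed_in_sphere (convex hull (supp \<nu>))
              \<and> f constant_on supp \<nu>)"
proof -
  note cont = assms(2) and pos = assms(3)
  let ?K = "supp \<nu>"
  interpret nu: finite_measure \<nu> using assms(4) by (simp add: borel_measure_on_sphere_def)
  have sets: "sets \<nu> = sets (restrict_space borel (sphere 0 1))"
    using assms(4) by (simp add: borel_measure_on_sphere_def)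
  then have sp: "space \<nu> = sphere 0 1" using sets_eq_imp_space_eq[OF sets] by (simp add: space_restrict_space)
  have K: "compact ?K" by (rule compact_supp[OF sp])
  have Ksub: "?K \<subseteq> sphere 0 1" unfolding supp_def sp by blast
  have inter: "A \<inter> sphere 0 1 \<in> sets \<nu>" if "A \<in> sets borel" for A
    using that unfolding sets by (auto simp: sets_restrict_space)
  have Ks: "?K \<in> sets \<nu>" using inter[OF borel_compact[OF K]] Ksub by (simp add: Int_absorb2)
  have AEK: "AE u in \<nu>. u \<in> ?K" by (rule AE_in_supp[OF assms(4)])
  define M where "M = restrict_space \<nu> ?K"
  have spM: "space M = ?K" using Ksub by (auto simp: M_def space_restrict_space sp)
  have int_M: "(LINT u|M. h u) = (LINT u|\<nu>. h u)" if "continuous_on (sphere 0 1) h"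
    for h :: "real^'n \<Rightarrow> 'c::{banach, second_countable_topology}"
  proof -
    have h: "h \<in> borel_measurable \<nu>"
      using borel_measurable_continuous_on_restrict[OF that] measurable_cong_sets[OF sets refl] by blast
    have "(LINT u|M. h u) = (LINT u|\<nu>. indicator ?K u *\<^sub>R h u)"
      unfolding M_def using Ks by (intro integral_restrict_space) auto
    also have "\<dots> = (LINT u|\<nu>. h u)"
      using AEK h Ks by (intro integral_cong_AE) (auto elim!: eventually_mono)
    finally show ?thesis .
  qed
  interpret finite_measure M
    by (rule finite_measureI) (use Ks in \<open>simp add: spM, simp add: M_def emeasure_restrict_space\<close>)
  interpret wulff_system M f
  proof unfold_locales
    show "compact (space M)" unfolding spM by (rule K)
    show "sets M = sets (restrict_space borel (space M))"
    proof -
      have "sets M = sets (restrict_space (restrict_space borel (sphere 0 1)) ?K)"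
        unfolding M_def by (rule sets_restrict_space_cong[OF sets])
      also have "\<dots> = sets (restrict_space borel (sphere 0 1 \<inter> ?K))"
        by (rule sets_restrict_restrict_space)
      finally show ?thesis using Ksub by (simp add: spM Int_absorb1)
    qed
    show "0 < measure M (U \<inter> space M)" if U: "open U" "U \<inter> space M \<noteq> {}" for U
    proof -
      obtain u where u: "u \<in> U" "u \<in> ?K" using U(2) by (auto simp: spM)
      then have "0 < measure \<nu> (U \<inter> space \<nu>)" using U(1) by (simp add: supp_def)
      also have "\<dots> = measure \<nu> (U \<inter> ?K)"
        using AEK AE_space inter[of U] U(1) sets.Int[OF inter[of U] Ks] Ksub
        by (intro nu.finite_measure_eq_AE) (auto simp: sp Int_assoc Int_absorb1 elim!: eventually_elim2)
      also have "\<dots> = measure M (U \<inter> space M)"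
        unfolding spM M_def using Ks by (subst measure_restrict_space) auto
      finally show ?thesis .
    qed
    show "norm u = 1" if "u \<in> space M" for u using that Ksub by (auto simp: spM)
    show "continuous_on (space M) f" unfolding spM by (rule continuous_on_subset[OF cont Ksub])
    show "0 < f u" if "u \<in> space M" for u using that pos Ksub by (auto simp: spM)
    show "(LINT u|M. (u \<bullet> x) * (u \<bullet> y)) = x \<bullet> y" for x y
    proof -
      have ct: "continuous_on (sphere 0 1) (tensor_square :: real^'n \<Rightarrow> _)"
        unfolding tensor_square_def by (intro continuous_intros)
      obtain B where "\<And>u :: real^'n. u \<in> sphere 0 1 \<Longrightarrow> norm (tensor_square u) \<le> B"
        using compact_continuous_bounded[OF compact_sphere ct] by blast
      moreover have "tensor_square \<in> borel_measurable \<nu>"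
        using borel_measurable_continuous_on_restrict[OF ct] measurable_cong_sets[OF sets refl] by blast
      ultimately have int: "integrable \<nu> tensor_square"
        by (intro nu.integrable_const_bound[where B=B] AE_I2) (auto simp: sp)
      have "bounded_linear (\<lambda>A :: real^'n^'n. x \<bullet> (A *v y))"
        unfolding linear_conv_bounded_linear[symmetric]
        by (rule linearI) (simp_all add: matrix_vector_mult_add_rdistrib inner_add_right scaleR_matrix_vector_assoc[symmetric])
      from integral_bounded_linear[OF this int]
      have "(LINT u|\<nu>. x \<bullet> (tensor_square u *v y)) = x \<bullet> y"
        using assms(5) by (simp add: isotropic_def)
      then show ?thesis
        by (subst int_M) (auto intro!: continuous_intros simp: tensor_square_mult inner_commute[of x] mult.commute)
    qed
    show "(LINT u|M. f u *\<^sub>R u) = 0"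
      using assms(6) by (subst int_M) (auto intro!: continuous_intros cont simp: centered_def)
  qed
  have W: "wulff_shape \<nu> f = W" by (simp add: wulff_shape_def W_def spM)
  have p: "disp \<nu> f = centroid W \<bullet> p"
    unfolding disp_def W p_def using pos
    by (subst int_M) (auto intro!: continuous_intros cont)
  have L: "L2_norm_on \<nu> f = L"
    unfolding L2_norm_on_def L_def by (subst int_M) (auto intro!: continuous_intros cont)
  have "(real CARD('n) + 1) powr ((real CARD('n) + 1) / 2) = ((real CARD('n) + 1) powr (1 / 2)) powr (real (CARD('n) + 1))"
    by (simp add: powr_powr add.commute)
  also have "\<dots> = sqrt (real CARD('n) + 1) ^ (CARD('n) + 1)"
    by (subst powr_realpow) (auto simp: powr_half_sqrt)
  finally have bound: "(real CARD('n) + 1 - disp \<nu> f) ^ (CARD('n) + 1)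
      / (fact CARD('n) * (real CARD('n) + 1) powr ((real CARD('n) + 1) / 2)) * L2_norm_on \<nu> f ^ CARD('n) = volume_bound"
    by (simp only: volume_bound_def p L)
  show ?thesis unfolding bound W spM[symmetric] using volume_le_bound(1) volume_eq_iff by blast
qed

end
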